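(* Let $g:\mathbb R\to\mathbb R$ be continuous, and suppose there is $K_6\ge0$ with $0\ne|g(\xi)|\le K_6$ for all $\xi\in\mathbb R$. Let $\epsilon>0$, $f(\xi)=\epsilon^{-2}(\xi-\xi^3)$ for $\xi\in\mathbb R$, and $\lambda_1=\pi^2$. Then for every $N\in\mathbb N_+$ and every $\tau\in(0,1)$ with $(\epsilon^{-2}-\lambda_1)\tau<1$, the Markov chain $\{X^N_n\}_{n\in\mathbb N}$ on $V_N$ generated by the drift-implicit Euler Galerkin scheme $$X^N_{j+1}=X^N_j+\tau\Delta_N X^N_{j+1}+\tau\mathcal P_N F(X^N_{j+1})+\mathcal P_N G(X^N_j)\,\delta_jW,\qquad j\in\mathbb N,$$ for the stochastic Allen--Cahn equation $dX=\Delta X\,dt+\epsilon^{-2}(X-X^3)\,dt+g(X)\,dW$ on $(0,1)$ with homogeneous Dirichlet boundary condition is uniquely ergodic.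
   Context: $H=L^2(0,1)$ with norm $\|\cdot\|$ and inner product $\langle\cdot,\cdot\rangle$. $\Delta$ is the Dirichlet Laplacian on $(0,1)$, with $-\Delta e_k=\lambda_k e_k$, $k\in\mathbb N_+$, where $\{e_k\}$ are the orthonormal eigenfunctions vanishing at $0,1$ and the eigenvalues $\lambda_k$ are increasing; $\lambda_1=\pi^2$. $\dot H^1=H^1_0(0,1)$, with dual $\dot H^{-1}$ and duality pairing ${}_1\langle\cdot,\cdot\rangle_{-1}$. $V_N=\mathrm{span}\{e_1,\dots,e_N\}$ is equipped with the norm $\|\cdot\|$ and its Borel $\sigma$-algebra $\mathcal B(V_N)$. $\Delta_N:V_N\to V_N$ is defined by $\langle\Delta_N u,v\rangle=-\langle\nabla u,\nabla v\rangle$ for $u,v\in V_N$; $\mathcal P_N:\dot H^{-1}\to V_N$ is defined by $\langle\mathcal P_N u,v\rangle={}_1\langle v,u\rangle_{-1}$ for $u\in\dot H^{-1}$, $v\in V_N$ (the $L^2$-orthogonal projection on $H$). $F(x)(\xi)=f(x(\xi))$ for $x\in\dot H^1$. $W$ is an $H$-valued cylindrical Wiener process on a complete filtered probability space $(\Omega,\mathscr F,(\mathscr F(t))_{t\ge0},\mathbb P)$: formally $W(t)=\sum_{k\ge1}g_k\beta_k(t)$ with $\{g_k\}$ an orthonormal basis of $H$ and $\{\beta_k\}$ independent Brownian motions (with respect to the filtration). For a step size $\tau$, $t_j=j\tau$ and $\delta_jW=W(t_{j+1})-W(t_j)$. $G(x)$ is multiplication by $g(x(\cdot))$: $(G(x)h)(\xi)=g(x(\xi))h(\xi)$;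 and $\mathcal P_N G(x)\delta_jW=\sum_{k\ge1}\mathcal P_N(G(x)g_k)\,(\beta_k(t_{j+1})-\beta_k(t_j))$ (convergent in $L^2(\Omega;V_N)$). The initial value $X^N_0$ is an $\mathscr F(0)$-measurable $V_N$-valued random variable. Under $(\epsilon^{-2}-\lambda_1)\tau<1$ the implicit scheme is uniquely solvable and $\{X^N_n\}$ is a Markov chain with transition kernel $P(x,A)=\mathbb P(X^N_{n+1}\in A\mid X^N_n=x)$, $x\in V_N$, $A\in\mathcal B(V_N)$, and semigroup $P_n\phi(x)=\mathbb E[\phi(X^N_n)\mid X^N_0=x]$. A probability measure $\mu$ on $V_N$ is invariant if $\int_{V_N}P(x,A)\,\mu(dx)=\mu(A)$ for all $A\in\mathcal B(V_N)$. An invariant probability measure $\mu$ is ergodic if $\lim_{m\to\infty}\frac1m\sum_{n=0}^mP_n\phi=\int\phi\,d\mu$ in $L^2(V_N;\mu)$ for all $\phi\in L^2(V_N;\mu)$. The chain is uniquely ergodic if it admits exactly one invariant probability measure (which is then ergodic). *)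

theory Defs
  imports "HOL-Probability.Probability"
begin

subsection \<open>The spaces \<open>H = L\<^sup>2(0,1)\<close> and \<open>V\<^sub>N\<close>\<close>

text \<open>Elements of \<open>H\<close> are represented by functions on the real line of which only the
  restriction to \<open>(0,1)\<close> matters, up to null sets.\<close>

definition L2 :: "(real \<Rightarrow> real) set" where
  "L2 = {u. u \<in> borel_measurable (lebesgue_on {0<..<1}) \<and>
            integrable (lebesgue_on {0<..<1}) (\<lambda>\<xi>. (u \<xi>)\<^sup>2)}"

definition L2_inner :: "(real \<Rightarrow> real) \<Rightarrow> (real \<Rightarrow> real) \<Rightarrow> real" where
  "L2_inner u v = (\<integral>\<xi>. u \<xi> * v \<xi> \<partial>(lebesgue_on {0<..<1}))"

definition L2_norm :: "(real \<Rightarrow> real) \<Rightarrow> real" where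
  "L2_norm u = sqrt (L2_inner u u)"

definition orthonormal_basis :: "(nat \<Rightarrow> real \<Rightarrow> real) \<Rightarrow> bool" where
  "orthonormal_basis b \<longleftrightarrow>
     (\<forall>k. b k \<in> L2) \<and>
     (\<forall>i j. L2_inner (b i) (b j) = (if i = j then 1 else 0)) \<and>
     (\<forall>h\<in>L2. (\<lambda>n. L2_norm (\<lambda>\<xi>. h \<xi> - (\<Sum>k<n. L2_inner h (b k) * b k \<xi>))) \<longlonglongrightarrow> 0)"

text \<open>The normalised Dirichlet eigenfunctions of the Laplacian on \<open>(0,1)\<close>, \<open>k \<ge> 1\<close>, with
  eigenvalues \<open>\<lambda>\<^sub>k = k\<^sup>2 \<pi>\<^sup>2\<close>.\<close>

definition eigenfun :: "nat \<Rightarrow> real \<Rightarrow> real" where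
  "eigenfun k \<xi> = sqrt 2 * sin (real k * pi * \<xi>)"

text \<open>The span of the first \<open>N\<close> eigenfunctions. The functions are kept on the whole line; a
  trigonometric polynomial is determined by its restriction to \<open>(0,1)\<close>, so the \<open>L\<^sup>2(0,1)\<close>
  distance is a genuine metric on this set.\<close>

definition VN :: "nat \<Rightarrow> (real \<Rightarrow> real) set" where
  "VN N = {u. \<exists>c. u = (\<lambda>\<xi>. \<Sum>k=1..N. c k * eigenfun k \<xi>)}"

definition VN_borel :: "nat \<Rightarrow> (real \<Rightarrow> real) measure" where
  "VN_borel N = sigma (VN N)
     {U. openin (Metric_space.mtopology (VN N) (\<lambda>u v. L2_norm (\<lambda>\<xi>. u \<xi> - v \<xi>))) U}"

text \<open>The element \<open>w\<close> of \<open>V\<^sub>N\<close> with \<open>\<langle>w, v\<rangle> = l v\<close> for all \<open>v\<close> in \<open>V\<^sub>N\<close>, for a linear functional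
  \<open>l\<close>. Applied to elements of the dual of \<open>H\<^sup>1\<^sub>0(0,1)\<close> this is the projection \<open>P\<^sub>N\<close>.\<close>

definition VN_dual_proj :: "nat \<Rightarrow> ((real \<Rightarrow> real) \<Rightarrow> real) \<Rightarrow> real \<Rightarrow> real" where
  "VN_dual_proj N l = (THE w. w \<in> VN N \<and> (\<forall>v\<in>VN N. L2_inner w v = l v))"

text \<open>\<open>P\<^sub>N\<close> on \<open>H\<close>, where \<open>u\<close> is identified with the functional \<open>v \<mapsto> \<langle>u, v\<rangle>\<close>.\<close>

definition PN :: "nat \<Rightarrow> (real \<Rightarrow> real) \<Rightarrow> real \<Rightarrow> real" where
  "PN N u = VN_dual_proj N (\<lambda>v. L2_inner u v)"

definition DeltaN :: "nat \<Rightarrow> (real \<Rightarrow> real) \<Rightarrow> real \<Rightarrow> real" where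
  "DeltaN N u = VN_dual_proj N (\<lambda>v. - L2_inner (deriv u) (deriv v))"


subsection \<open>The driving noise\<close>

definition complete_filtered_prob_space :: "'a measure \<Rightarrow> (real \<Rightarrow> 'a measure) \<Rightarrow> bool" where
  "complete_filtered_prob_space M F \<longleftrightarrow>
     prob_space M \<and> complete_measure M \<and>
     (\<forall>t\<ge>0. subalgebra M (F t)) \<and>
     (\<forall>s t. 0 \<le> s \<and> s \<le> t \<longrightarrow> sets (F s) \<subseteq> sets (F t)) \<and>
     null_sets M \<subseteq> sets (F 0)"

text \<open>A sequence of independent standard Brownian motions, jointly Brownian with respect to the
  filtration: the increments of the whole sequence after time \<open>s\<close> are independent of \<open>F s\<close>.\<close>

definition independent_brownian_motions ::
    "'a measure \<Rightarrow> (real \<Rightarrow> 'a measure) \<Rightarrow> (nat \<Rightarrow> real \<Rightarrow> 'a \<Rightarrow> real) \<Rightarrow> bool" where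
  "independent_brownian_motions M F \<beta> \<longleftrightarrow>
     (\<forall>k. AE \<omega> in M. \<beta> k 0 \<omega> = 0) \<and>
     (\<forall>k. AE \<omega> in M. continuous_on {0..} (\<lambda>t. \<beta> k t \<omega>)) \<and>
     (\<forall>k. \<forall>t\<ge>0. \<beta> k t \<in> borel_measurable (F t)) \<and>
     (\<forall>k s t. 0 \<le> s \<and> s < t \<longrightarrow>
        distributed M lborel (\<lambda>\<omega>. \<beta> k t \<omega> - \<beta> k s \<omega>) (normal_density 0 (sqrt (t - s)))) \<and>
     (\<forall>s t. 0 \<le> s \<and> s \<le> t \<longrightarrow>
        prob_space.indep_set M (sets (F s))
          (sets (vimage_algebra (space M) (\<lambda>\<omega> k. \<beta> k t \<omega> - \<beta> k s \<omega>) (\<Pi>\<^sub>M k\<in>UNIV. borel)))) \<and>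
     prob_space.indep_vars M (\<lambda>k. \<Pi>\<^sub>M t\<in>{0..}. borel) (\<lambda>k \<omega>. \<lambda>t\<in>{0..}. \<beta> k t \<omega>) UNIV"

text \<open>The formal series \<open>W(t) = \<Sum>\<^sub>k b\<^sub>k \<beta>\<^sub>k(t)\<close> is represented by the pair \<open>(b, \<beta>)\<close>.\<close>

definition cylindrical_wiener ::
    "'a measure \<Rightarrow> (real \<Rightarrow> 'a measure) \<Rightarrow> (nat \<Rightarrow> real \<Rightarrow> real) \<Rightarrow>
     (nat \<Rightarrow> real \<Rightarrow> 'a \<Rightarrow> real) \<Rightarrow> bool" where
  "cylindrical_wiener M F b \<beta> \<longleftrightarrow> orthonormal_basis b \<and> independent_brownian_motions M F \<beta>"

text \<open>\<open>\<eta>\<close> is \<open>P\<^sub>N G(Y) (W(t) - W(s))\<close> for the \<open>V\<^sub>N\<close>-valued random variable \<open>Y\<close>, i.e.\ the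
  limit in \<open>L\<^sup>2(\<Omega>; V\<^sub>N)\<close> of the partial sums of
  \<open>\<Sum>\<^sub>k P\<^sub>N(g(Y) b\<^sub>k) (\<beta>\<^sub>k(t) - \<beta>\<^sub>k(s))\<close>. The integral is the nonnegative one, so
  convergence to 0 includes finiteness of the second moments.\<close>

definition noise_increment ::
    "'a measure \<Rightarrow> (nat \<Rightarrow> real \<Rightarrow> real) \<Rightarrow> (nat \<Rightarrow> real \<Rightarrow> 'a \<Rightarrow> real) \<Rightarrow> (real \<Rightarrow> real) \<Rightarrow> nat \<Rightarrow>
     real \<Rightarrow> real \<Rightarrow> ('a \<Rightarrow> real \<Rightarrow> real) \<Rightarrow> ('a \<Rightarrow> real \<Rightarrow> real) \<Rightarrow> bool" where
  "noise_increment M b \<beta> g N s t Y \<eta> \<longleftrightarrow>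
     \<eta> \<in> measurable M (VN_borel N) \<and>
     (\<lambda>n. \<integral>\<^sup>+\<omega>. ennreal ((L2_norm (\<lambda>\<xi>.
          (\<Sum>k<n. PN N (\<lambda>\<zeta>. g (Y \<omega> \<zeta>) * b k \<zeta>) \<xi> * (\<beta> k t \<omega> - \<beta> k s \<omega>)) - \<eta> \<omega> \<xi>))\<^sup>2) \<partial>M)
       \<longlonglongrightarrow> 0"


subsection \<open>The drift-implicit Euler Galerkin scheme and its Markov kernel\<close>

definition euler_galerkin_chain ::
    "'a measure \<Rightarrow> (real \<Rightarrow> 'a measure) \<Rightarrow> (nat \<Rightarrow> real \<Rightarrow> real) \<Rightarrow> (nat \<Rightarrow> real \<Rightarrow> 'a \<Rightarrow> real) \<Rightarrow>
     (real \<Rightarrow> real) \<Rightarrow> (real \<Rightarrow> real) \<Rightarrow> nat \<Rightarrow> real \<Rightarrow> (nat \<Rightarrow> 'a \<Rightarrow> real \<Rightarrow> real) \<Rightarrow> bool" where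
  "euler_galerkin_chain M F b \<beta> f g N \<tau> X \<longleftrightarrow>
     (\<forall>j. X j \<in> measurable (F (real j * \<tau>)) (VN_borel N)) \<and>
     (\<forall>j. \<exists>\<eta>. noise_increment M b \<beta> g N (real j * \<tau>) (real (Suc j) * \<tau>) (X j) \<eta> \<and>
        (AE \<omega> in M. X (Suc j) \<omega> =
           (\<lambda>\<xi>. X j \<omega> \<xi> + \<tau> * DeltaN N (X (Suc j) \<omega>) \<xi>
                 + \<tau> * PN N (\<lambda>\<zeta>. f (X (Suc j) \<omega> \<zeta>)) \<xi> + \<eta> \<omega> \<xi>)))"

text \<open>\<open>\<kappa> x A = P(X\<^sub>n\<^sub>+\<^sub>1 \<in> A | X\<^sub>n = x)\<close>. A single chain determines its conditional
  probabilities only up to null sets of the law of \<open>X\<^sub>n\<close>. The kernel is therefore required to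
  serve the chains started from all initial values; deterministic initial values \<open>X\<^sub>0 = x\<close> are
  among these and determine \<open>\<kappa> x\<close> for every \<open>x\<close> in \<open>V\<^sub>N\<close>.\<close>

definition transition_kernel ::
    "'a measure \<Rightarrow> (real \<Rightarrow> 'a measure) \<Rightarrow> (nat \<Rightarrow> real \<Rightarrow> real) \<Rightarrow> (nat \<Rightarrow> real \<Rightarrow> 'a \<Rightarrow> real) \<Rightarrow>
     (real \<Rightarrow> real) \<Rightarrow> (real \<Rightarrow> real) \<Rightarrow> nat \<Rightarrow> real \<Rightarrow>
     ((real \<Rightarrow> real) \<Rightarrow> (real \<Rightarrow> real) measure) \<Rightarrow> bool" where
  "transition_kernel M F b \<beta> f g N \<tau> \<kappa> \<longleftrightarrow>
     \<kappa> \<in> measurable (VN_borel N) (prob_algebra (VN_borel N)) \<and>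
     (\<forall>X. euler_galerkin_chain M F b \<beta> f g N \<tau> X \<longrightarrow>
       (\<forall>n. \<forall>A\<in>sets (VN_borel N). AE \<omega> in M.
          real_cond_exp M (vimage_algebra (space M) (X n) (VN_borel N))
            (indicator {\<omega>' \<in> space M. X (Suc n) \<omega>' \<in> A}) \<omega> = measure (\<kappa> (X n \<omega>)) A))"

definition invariant_prob_measure ::
    "'b measure \<Rightarrow> ('b \<Rightarrow> 'b measure) \<Rightarrow> 'b measure \<Rightarrow> bool" where
  "invariant_prob_measure S \<kappa> \<mu> \<longleftrightarrow>
     sets \<mu> = sets S \<and> prob_space \<mu> \<and>
     (\<forall>A\<in>sets S. (\<integral>x. measure (\<kappa> x) A \<partial>\<mu>) = measure \<mu> A)"

definition uniquely_ergodic :: "'b measure \<Rightarrow> ('b \<Rightarrow> 'b measure) \<Rightarrow> bool" where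
  "uniquely_ergodic S \<kappa> \<longleftrightarrow> (\<exists>!\<mu>. invariant_prob_measure S \<kappa> \<mu>)"

end

theory Submission
  imports Defs
begin

text \<open>In the coordinates of the eigenbasis one step of the scheme is \<open>x \<mapsto> J\<^sup>-\<^sup>1 (x + \<Sum>\<^sub>k w\<^sub>k a\<^sub>k(x))\<close> with
  independent centred Gaussian \<open>w\<^sub>k\<close>, where \<open>J = 1 - \<tau> \<Delta>\<^sub>N - \<tau> P\<^sub>N F\<close> is strongly monotone by the
  step size condition, hence a bijection with Lipschitz inverse. The quartic term of the potential
  gives \<open>|J\<^sup>-\<^sup>1 z|\<^sup>2 \<le> |z|\<^sup>2 / 4 + C\<close>, so the squared norm is a Lyapunov function. Since \<open>g\<close> has no
  zero, finitely many of the vectors \<open>a\<^sub>k(x)\<close> span \<open>V\<^sub>N\<close>, uniformly for \<open>x\<close> in a ball, and the transition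
  kernel is minorised there by a fixed measure. Drift and minorisation together yield existence and
  uniqueness of the invariant probability measure.\<close>

subsection \<open>Kernels with a drift and a minorisation condition\<close>

text \<open>The step size condition only makes \<open>gap\<close> positive, possibly below 1, so
  monotonicity yields a Lipschitz inverse but no contraction; the decay at infinity has to come from
  the cubic term. The factor 1/4 is matched to |x + w|^2 <= 2|x|^2 + 2|w|^2, after which half of
  |x|^2 remains. The basis of the noise is arbitrary and the noise series converges only in mean
  square for each state, whereas a kernel requires one function measurable jointly in state and
  noise; this forces the state-dependent truncation \<open>cutoff\<close>. Existence sums the laws
  of the part that has not regenerated, instead of extracting weak limits, so the abstract argument
  involves no topology. Uniqueness uses the minorisation on every sublevel set, not just on one.
  Finally, a single chain determines its kernel only almost everywhere, so chains from every
  starting point are constructed in order to identify an arbitrary \<open>\<kappa>\<close> with the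
  explicit kernel.\<close>

lemma nn_integral_mono_emeasure:
  assumes "sets N = sets M" "\<And>X. X \<in> sets M \<Longrightarrow> emeasure N X \<le> emeasure M X"
    and "q \<in> borel_measurable M"
  shows "(\<integral>\<^sup>+x. q x \<partial>N) \<le> (\<integral>\<^sup>+x. q x \<partial>M)"
  using assms(3)
proof (induction q rule: borel_measurable_induct)
  case (cong f g)
  have "(\<integral>\<^sup>+x. f x \<partial>N) = (\<integral>\<^sup>+x. g x \<partial>N)"
    by (rule nn_integral_cong) (use cong sets_eq_imp_space_eq[OF assms(1)] in auto)
  moreover have "(\<integral>\<^sup>+x. f x \<partial>M) = (\<integral>\<^sup>+x. g x \<partial>M)"
    by (rule nn_integral_cong) (use cong in auto)
  ultimately show ?case using cong by simp
next
  case (set A)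
  then show ?case using assms by simp
next
  case (mult u c)
  then show ?case using assms(1)
    by (subst (1 2) nn_integral_cmult) (auto simp: measurable_cong_sets[OF assms(1) refl] intro: mult_left_mono)
next
  case (add u v)
  then show ?case using assms(1)
    by (subst (1 2) nn_integral_add) (auto simp: measurable_cong_sets[OF assms(1) refl] intro: add_mono)
next
  case (seq U)
  have "(\<integral>\<^sup>+x. (SUP i. U i) x \<partial>N) = (SUP i. \<integral>\<^sup>+x. U i x \<partial>N)"
    using seq unfolding SUP_apply
    by (subst nn_integral_monotone_convergence_SUP[symmetric]) (auto simp: measurable_cong_sets[OF assms(1) refl])
  also have "\<dots> \<le> (SUP i. \<integral>\<^sup>+x. U i x \<partial>M)" using seq by (intro SUP_mono bexI) auto
  also have "\<dots> = (\<integral>\<^sup>+x. (SUP i. U i) x \<partial>M)"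
    using seq unfolding SUP_apply by (subst nn_integral_monotone_convergence_SUP[symmetric]) auto
  finally show ?case .
qed

text \<open>Countable additivity is an exchange of two series of nonnegative terms, so the summands
  may be infinite. The sum serves as occupation measure in \<open>ex_invariant\<close> and, with a
  tail of zero measures, as a two-term sum in \<open>ex_step\<close>.\<close>

lemma ex_suminf_measure:
  fixes \<pi> :: "nat \<Rightarrow> 'b measure"
  assumes sets: "\<And>n. sets (\<pi> n) = sets S"
  obtains m where "sets m = sets S" "\<And>q. q \<in> borel_measurable S \<Longrightarrow> (\<integral>\<^sup>+x. q x \<partial>m) = (\<Sum>n. \<integral>\<^sup>+x. q x \<partial>\<pi> n)"
proof -
  define m where "m = measure_of (space S) (sets S) (\<lambda>A. \<Sum>n. emeasure (\<pi> n) A)"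
  have sm: "sets m = sets S" by (simp add: m_def)
  have msr: "measurable (\<pi> n) borel = measurable S borel" "measurable m borel = measurable S borel" for n
    using sets sm by (simp_all cong: measurable_cong_sets)
  have em: "emeasure m A = (\<Sum>n. emeasure (\<pi> n) A)" if "A \<in> sets S" for A
    unfolding m_def
  proof (rule emeasure_measure_of_sigma)
    show "sigma_algebra (space S) (sets S)" ..
    show "positive (sets S) (\<lambda>A. \<Sum>n. emeasure (\<pi> n) A)" by (simp add: positive_def)
    show "countably_additive (sets S) (\<lambda>A. \<Sum>n. emeasure (\<pi> n) A)"
    proof (rule countably_additiveI)
      fix A :: "nat \<Rightarrow> 'b set" assume A: "range A \<subseteq> sets S" "disjoint_family A"
      \<comment> \<open>The series over \<open>n\<close> is read as an integral over the counting
        measure, so that the exchange becomes \<open>nn_integral_suminf\<close>.\<close>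
      have "(\<Sum>i. \<Sum>n. emeasure (\<pi> n) (A i)) = (\<Sum>i. \<integral>\<^sup>+n. emeasure (\<pi> n) (A i) \<partial>count_space UNIV)"
        by (simp add: nn_integral_count_space_nat)
      also have "\<dots> = (\<integral>\<^sup>+n. (\<Sum>i. emeasure (\<pi> n) (A i)) \<partial>count_space UNIV)"
        by (subst nn_integral_suminf) auto
      also have "\<dots> = (\<Sum>n. emeasure (\<pi> n) (\<Union>i. A i))"
        using A by (subst nn_integral_count_space_nat) (auto intro!: suminf_cong suminf_emeasure simp: sets)
      finally show "(\<Sum>i. \<Sum>n. emeasure (\<pi> n) (A i)) = (\<Sum>n. emeasure (\<pi> n) (\<Union>i. A i))" .
    qed
  qed (use that in auto)
  have "(\<integral>\<^sup>+x. q x \<partial>m) = (\<Sum>n. \<integral>\<^sup>+x. q x \<partial>\<pi> n)" if "q \<in> borel_measurable S" for q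
    using that
  proof (induction q rule: borel_measurable_induct)
    case (cong f g)
    have "(\<integral>\<^sup>+x. f x \<partial>m) = (\<integral>\<^sup>+x. g x \<partial>m)"
      by (rule nn_integral_cong) (use cong sets_eq_imp_space_eq[OF sm] in auto)
    moreover have "(\<integral>\<^sup>+x. f x \<partial>\<pi> n) = (\<integral>\<^sup>+x. g x \<partial>\<pi> n)" for n
      by (rule nn_integral_cong) (use cong sets_eq_imp_space_eq[OF sets] in auto)
    ultimately show ?case using cong by simp
  next
    case (set A)
    then show ?case using em sm sets by simp
  next
    case (mult u c)
    then show ?case by (simp add: nn_integral_cmult msr)
  next
    case (add u v)
    then show ?case by (simp add: nn_integral_add msr suminf_add[OF summableI summableI])
  next
    case (seq U)
    have mono: "incseq (\<lambda>i. \<integral>\<^sup>+x. U i x \<partial>\<pi> n)" for n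
      using seq by (auto simp: incseq_def le_fun_def intro!: nn_integral_mono)
    have "(\<integral>\<^sup>+x. (SUP i. U i) x \<partial>m) = (SUP i. \<integral>\<^sup>+x. U i x \<partial>m)"
      using seq unfolding SUP_apply by (subst nn_integral_monotone_convergence_SUP[symmetric]) (auto simp: msr)
    also have "\<dots> = (SUP i. \<integral>\<^sup>+n. (\<integral>\<^sup>+x. U i x \<partial>\<pi> n) \<partial>count_space UNIV)"
      using seq by (simp add: nn_integral_count_space_nat)
    also have "\<dots> = (\<integral>\<^sup>+n. (SUP i. \<integral>\<^sup>+x. U i x \<partial>\<pi> n) \<partial>count_space UNIV)"
      using mono by (subst nn_integral_monotone_convergence_SUP) (auto simp: incseq_def le_fun_def)
    also have "\<dots> = (\<Sum>n. \<integral>\<^sup>+x. (SUP i. U i) x \<partial>\<pi> n)"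
      using seq unfolding SUP_apply by (auto simp: nn_integral_count_space_nat msr
          intro!: suminf_cong nn_integral_monotone_convergence_SUP[symmetric])
    finally show ?case .
  qed
  with sm show ?thesis by (rule that)
qed

text \<open>All later computations use nonnegative integrals, where no integrability has to be
  carried along. The Bochner form agrees because \<open>measure (\<kappa> x) A\<close> is at most 1
  and \<mu> is finite.\<close>

lemma invariant_prob_measure_nn:
  assumes \<kappa>: "\<kappa> \<in> S \<rightarrow>\<^sub>M prob_algebra S"
  shows "invariant_prob_measure S \<kappa> \<mu> \<longleftrightarrow> sets \<mu> = sets S \<and> prob_space \<mu> \<and>
     (\<forall>A\<in>sets S. (\<integral>\<^sup>+x. emeasure (\<kappa> x) A \<partial>\<mu>) = emeasure \<mu> A)"
proof -
  have "(\<integral>\<^sup>+x. emeasure (\<kappa> x) A \<partial>\<mu>) = emeasure \<mu> A \<longleftrightarrow> (\<integral>x. measure (\<kappa> x) A \<partial>\<mu>) = measure \<mu> A"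
    if s: "sets \<mu> = sets S" and "prob_space \<mu>" and A: "A \<in> sets S" for A
  proof -
    interpret prob_space \<mu> by fact
    have pr: "prob_space (\<kappa> x)" if "x \<in> space \<mu>" for x
      using measurable_space[OF \<kappa>, of x] that sets_eq_imp_space_eq[OF s] by (auto simp: space_prob_algebra)
    have m: "(\<lambda>x. measure (\<kappa> x) A) \<in> borel_measurable \<mu>"
      using measurable_compose[OF \<kappa> measurable_measure_prob_algebra[OF A]] by (simp add: measurable_cong_sets[OF s refl])
    have i: "integrable \<mu> (\<lambda>x. measure (\<kappa> x) A)"
      by (rule integrable_const_bound[where B=1]) (use m in \<open>auto intro!: AE_I2 prob_space.prob_le_1 pr\<close>)
    have "(\<integral>\<^sup>+x. emeasure (\<kappa> x) A \<partial>\<mu>) = (\<integral>\<^sup>+x. ennreal (measure (\<kappa> x) A) \<partial>\<mu>)"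
      by (intro nn_integral_cong) (auto simp: finite_measure.emeasure_eq_measure[OF prob_space.finite_measure[OF pr]])
    also have "\<dots> = ennreal (\<integral>x. measure (\<kappa> x) A \<partial>\<mu>)"
      by (rule nn_integral_eq_integral[OF i]) auto
    finally show ?thesis 
      by (simp add: emeasure_eq_measure ennreal_inj integral_nonneg_AE)
  qed
  then show ?thesis unfolding invariant_prob_measure_def by blast
qed

section \<open>Measures dominated on a set\<close>

lemma set_nn_integral_mono_emeasure:
  assumes dom: "\<And>X. X \<in> sets M \<Longrightarrow> X \<subseteq> A \<Longrightarrow> emeasure N X \<le> emeasure M X"
    and N: "sets N = sets M" and [measurable]: "A \<in> sets M" "r \<in> borel_measurable M"
  shows "(\<integral>\<^sup>+x. r x * indicator A x \<partial>N) \<le> (\<integral>\<^sup>+x. r x * indicator A x \<partial>M)"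
proof -
  note [measurable_cong] = N(1)
  have "(\<integral>\<^sup>+x. r x \<partial>density N (indicator A)) \<le> (\<integral>\<^sup>+x. r x \<partial>density M (indicator A))"
  proof (rule nn_integral_mono_emeasure)
    fix X assume "X \<in> sets (density M (indicator A))"
    then have [measurable]: "X \<in> sets M" by simp
    show "emeasure (density N (indicator A)) X \<le> emeasure (density M (indicator A)) X"
      using dom[of "A \<inter> X"] by (simp add: emeasure_density indicator_inter_arith[symmetric] N)
  qed (auto simp: N)
  then show ?thesis by (subst (asm) (1 2) nn_integral_density) (auto simp: mult.commute)
qed

text \<open>On \<open>A\<close> the function \<open>q\<close> splits into \<open>a\<close> times the
  indicator of \<open>C\<close> and a remainder \<open>r\<close>. The larger measure gives
  \<open>r\<close> at least as much integral, so equality of the full, finite integrals forces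
  \<open>M\<close> to have no more mass than \<open>N\<close> on \<open>A \<inter> C\<close>, unless
  \<open>a\<close> is 0.\<close>

lemma dominated_part_critical:
  assumes dom: "\<And>X. X \<in> sets M \<Longrightarrow> X \<subseteq> A \<Longrightarrow> emeasure N X \<le> emeasure M X"
    and N: "sets N = sets M" "finite_measure N" and M: "finite_measure M"
    and [measurable]: "A \<in> sets M" "C \<in> sets M" "q \<in> borel_measurable M"
    and q: "\<And>x. x \<in> A \<inter> C \<Longrightarrow> a \<le> q x"
    and eq: "(\<integral>\<^sup>+x. q x * indicator A x \<partial>M) = (\<integral>\<^sup>+x. q x * indicator A x \<partial>N)" "(\<integral>\<^sup>+x. q x * indicator A x \<partial>M) < \<top>"
    and a: "a < \<top>"
  shows "a = 0 \<or> emeasure M (A \<inter> C) = emeasure N (A \<inter> C)"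
proof -
  note [measurable_cong] = N(1)
  interpret M: finite_measure M by fact
  interpret N: finite_measure N by fact
  define r where "r x = q x - a * indicator C x" for x
  have [measurable]: "r \<in> borel_measurable M" by (simp add: r_def[abs_def])
  have dec: "q x * indicator A x = a * indicator (A \<inter> C) x + r x * indicator A x" for x
    using q[of x] by (cases "x \<in> A"; cases "x \<in> C") (auto simp: r_def add_diff_inverse_ennreal)
  have "(\<integral>\<^sup>+x. q x * indicator A x \<partial>M) = a * emeasure M (A \<inter> C) + (\<integral>\<^sup>+x. r x * indicator A x \<partial>M)"
    unfolding dec by (subst nn_integral_add) (auto simp: nn_integral_cmult_indicator)
  moreover have "(\<integral>\<^sup>+x. q x * indicator A x \<partial>N) = a * emeasure N (A \<inter> C) + (\<integral>\<^sup>+x. r x * indicator A x \<partial>N)"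
    unfolding dec by (subst nn_integral_add) (auto simp: nn_integral_cmult_indicator N(1))
  ultimately have s: "a * emeasure M (A \<inter> C) + (\<integral>\<^sup>+x. r x * indicator A x \<partial>M) = a * emeasure N (A \<inter> C) + (\<integral>\<^sup>+x. r x * indicator A x \<partial>N)"
    and f: "a * emeasure M (A \<inter> C) + (\<integral>\<^sup>+x. r x * indicator A x \<partial>M) < \<top>" using eq by auto
  have "a * emeasure M (A \<inter> C) + (\<integral>\<^sup>+x. r x * indicator A x \<partial>M) \<le> a * emeasure N (A \<inter> C) + (\<integral>\<^sup>+x. r x * indicator A x \<partial>M)"
    unfolding s using set_nn_integral_mono_emeasure[where r=r, OF dom N(1)] by (intro add_mono) auto
  then have "a * emeasure M (A \<inter> C) \<le> a * emeasure N (A \<inter> C)"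
    using f by (auto simp: ennreal_add_left_cancel_le add.commute[of "a * _"])
  moreover have "emeasure N (A \<inter> C) \<le> emeasure M (A \<inter> C)" by (rule dom) auto
  ultimately show ?thesis using a
    by (metis antisym ennreal_mult_le_mult_iff less_irrefl)
qed

lemma ennreal_summands_eq:
  fixes a b c d :: ennreal
  shows "d = a + b \<Longrightarrow> d = a + c \<Longrightarrow> d < \<top> \<Longrightarrow> b = c \<and> b < \<top>"
  by (auto simp: ennreal_add_left_cancel)

text \<open>The drift says that one step halves \<open>V\<close> up to K/2; it is multiplied by 2 to
  avoid division in \<open>ennreal\<close>. The constant \<alpha> and the measure \<nu> may depend
  on \<open>R\<close>: existence works with a single level, uniqueness exhausts the space with all
  of them.\<close>

locale drift_minorised_kernel =
  fixes S :: "'b measure" and \<kappa> :: "'b \<Rightarrow> 'b measure" and V :: "'b \<Rightarrow> ennreal" and K :: ennreal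
  assumes kernel: "\<kappa> \<in> S \<rightarrow>\<^sub>M prob_algebra S"
    and V_meas [measurable]: "V \<in> borel_measurable S"
    and V_fin: "x \<in> space S \<Longrightarrow> V x < \<top>"
    and K_fin: "K < \<top>"
    and ne: "space S \<noteq> {}"
    and drift: "x \<in> space S \<Longrightarrow> 2 * (\<integral>\<^sup>+y. V y \<partial>\<kappa> x) \<le> V x + K"
    and minor: "\<And>R::real. \<exists>\<alpha>>0. \<exists>\<nu>. \<alpha> < \<top> \<and> sets \<nu> = sets S \<and> prob_space \<nu> \<and>
      (\<forall>x\<in>space S. V x \<le> ennreal R \<longrightarrow> (\<forall>A\<in>sets S. (\<alpha>::ennreal) * emeasure \<nu> A \<le> emeasure (\<kappa> x) A))"
begin

lemma prob_kernel: "x \<in> space S \<Longrightarrow> prob_space (\<kappa> x)" "x \<in> space S \<Longrightarrow> sets (\<kappa> x) = sets S"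
  using measurable_space[OF kernel, of x] by (auto simp: space_prob_algebra)

lemma kernel_subprob [measurable]: "\<kappa> \<in> S \<rightarrow>\<^sub>M subprob_algebra S"
  by (rule measurable_prob_algebraD[OF kernel])

lemma kernel_emeasure [measurable]: "A \<in> sets S \<Longrightarrow> (\<lambda>x. emeasure (\<kappa> x) A) \<in> borel_measurable S"
  by (rule emeasure_measurable_subprob_algebra2) auto

text \<open>\<open>p'\<close> is the image of \<open>p\<close> under the kernel with the mass
  regenerated from \<open>C\<close> removed; the minorisation makes the difference nonnegative. The
  identity is stated as a sum because subtraction in \<open>ennreal\<close> is truncated.\<close>

lemma ex_step:
  assumes "sets p = sets S" "finite_measure p" "sets \<nu> = sets S" "prob_space \<nu>" "C \<in> sets S" "\<alpha> < \<top>"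
    and min: "\<And>x A. x \<in> C \<Longrightarrow> A \<in> sets S \<Longrightarrow> \<alpha> * emeasure \<nu> A \<le> emeasure (\<kappa> x) A"
  shows "\<exists>p'. sets p' = sets S \<and> finite_measure p' \<and> (\<forall>q\<in>borel_measurable S.
     (\<integral>\<^sup>+y. q y \<partial>p') + \<alpha> * emeasure p C * (\<integral>\<^sup>+y. q y \<partial>\<nu>) = (\<integral>\<^sup>+x. (\<integral>\<^sup>+y. q y \<partial>\<kappa> x) \<partial>p))"
proof -
  interpret p: finite_measure p by fact
  interpret nu: prob_space \<nu> by fact
  note [measurable_cong] = assms(1) assms(3)
  note [measurable] = assms(5)
  have sp: "space p = space S" "space \<nu> = space S" using assms sets_eq_imp_space_eq by blast+
  have k: "\<kappa> \<in> p \<rightarrow>\<^sub>M subprob_algebra S" by measurable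
  have ne': "space p \<noteq> {}" using ne sp by simp
  define b where "b = bind p \<kappa>"
  define s where "s = scale_measure (\<alpha> * emeasure p C) \<nu>"
  have sb: "sets b = sets S" unfolding b_def by (rule sets_bind[OF _ ne']) (use sp prob_kernel in auto)
  have ss: "sets s = sets S" using assms by (simp add: s_def)
  have eb: "emeasure b A = (\<integral>\<^sup>+x. emeasure (\<kappa> x) A \<partial>p)" if "A \<in> sets S" for A
    unfolding b_def by (rule emeasure_bind[OF ne' k that])
  \<comment> \<open>On \<open>C\<close> the kernel exceeds \<alpha> times \<nu>, so integration over
    \<open>p\<close> makes \<open>s\<close> a part of \<open>b\<close>.\<close>
  have le: "emeasure s A \<le> emeasure b A" if A: "A \<in> sets S" for A
  proof -
    have "emeasure s A = (\<integral>\<^sup>+x. (\<alpha> * emeasure \<nu> A) * indicator C x \<partial>p)"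
      using A by (subst nn_integral_cmult_indicator) (auto simp: s_def assms(1,5) mult.commute mult.left_commute)
    also have "\<dots> \<le> (\<integral>\<^sup>+x. emeasure (\<kappa> x) A \<partial>p)"
      by (intro nn_integral_mono) (auto simp: indicator_def intro: min A)
    finally show ?thesis using eb A by simp
  qed
  have finb: "finite_measure b"
  proof (rule finite_measureI)
    have "emeasure b (space b) = emeasure b (space S)" using sb sets_eq_imp_space_eq by metis
    also have "\<dots> \<le> (\<integral>\<^sup>+x. 1 \<partial>p)" unfolding eb[OF sets.top]
      using prob_kernel sp by (intro nn_integral_mono)
        (auto intro!: prob_space.measure_le_1[THEN order_trans[rotated]] simp: prob_space.measure_le_1)
    also have "\<dots> < \<top>" using p.emeasure_finite by (simp add: less_top[symmetric])
    finally show "emeasure b (space b) \<noteq> \<infinity>" by simp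
  qed
  have fins: "finite_measure s"
    by (rule finite_measureI) (use assms(6) p.emeasure_finite[of C] nu.emeasure_finite in
      \<open>auto simp: s_def ennreal_mult_eq_top_iff less_top[symmetric]\<close>)
  define d where "d = diff_measure b s"
  have ed: "emeasure d A = emeasure b A - emeasure s A" if "A \<in> sets S" for A
    unfolding d_def by (rule emeasure_diff_measure) (use finb fins sb ss le that in auto)
  have sd: "sets d = sets S" by (simp add: d_def sb)
  have find: "finite_measure d"
  proof (rule finite_measureI)
    have "emeasure d (space S) \<le> emeasure b (space S)" using ed by (simp add: diff_le_self_ennreal)
    then show "emeasure d (space d) \<noteq> \<infinity>"
      using finite_measure.emeasure_finite[OF finb] sets_eq_imp_space_eq[OF sd] by (auto simp: top_unique)
  qed
  \<comment> \<open>The sum of \<open>d\<close> and \<open>s\<close> is a series with zero tail. It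
    recovers \<open>b\<close>, which turns the setwise difference into an identity of
    integrals.\<close>
  define ds where "ds = (\<lambda>n::nat. if n = 0 then d else if n = 1 then s else null_measure S)"
  obtain m where m: "sets m = sets S" "\<And>q. q \<in> borel_measurable S \<Longrightarrow> (\<integral>\<^sup>+x. q x \<partial>m) = (\<Sum>n. \<integral>\<^sup>+x. q x \<partial>ds n)"
    by (rule ex_suminf_measure[of ds S]) (auto simp: ds_def sd ss)
  have m2: "(\<integral>\<^sup>+x. q x \<partial>m) = (\<integral>\<^sup>+x. q x \<partial>d) + (\<integral>\<^sup>+x. q x \<partial>s)" if "q \<in> borel_measurable S" for q
  proof -
    have "(\<Sum>n. \<integral>\<^sup>+x. q x \<partial>ds n) = (\<Sum>n\<in>{0,1}. \<integral>\<^sup>+x. q x \<partial>ds n)"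
      by (rule suminf_finite) (auto simp: ds_def nn_integral_null_measure)
    then show ?thesis using m that by (simp add: ds_def)
  qed
  have "m = b"
  proof (rule measure_eqI)
    fix A assume "A \<in> sets m"
    then have A: "A \<in> sets S" using m by simp
    have "emeasure m A = emeasure d A + emeasure s A"
      using m2[of "indicator A"] A m sd ss by simp
    then show "emeasure m A = emeasure b A" using ed[OF A] diff_add_cancel_ennreal[OF le[OF A]] by simp
  qed (simp add: m sb)
  then have "(\<integral>\<^sup>+y. q y \<partial>d) + \<alpha> * emeasure p C * (\<integral>\<^sup>+y. q y \<partial>\<nu>) = (\<integral>\<^sup>+x. (\<integral>\<^sup>+y. q y \<partial>\<kappa> x) \<partial>p)"
    if "q \<in> borel_measurable S" for q
    using m2[OF that] that nn_integral_bind[OF that k]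
    by (simp add: s_def nn_integral_scale_measure measurable_cong_sets[OF assms(3) refl] b_def)
  with sd find show ?thesis by blast
qed

text \<open>Once \<open>V\<close> exceeds \<open>K + 2\<close>, half of it pays for K/2 and for a
  decrease by 1; inside the ball the term \<open>K + 2\<close> covers the loss. The decrease by 1 is
  what makes the surviving mass summable in \<open>ex_invariant\<close>.\<close>

lemma drift_outside_ball:
  assumes x: "x \<in> space S" and R: "K + 2 \<le> ennreal R"
  shows "(\<integral>\<^sup>+y. V y \<partial>\<kappa> x) + 1 \<le> V x + (K + 2) * indicator {x\<in>space S. V x \<le> ennreal R} x"
proof -
  let ?I = "\<integral>\<^sup>+y. V y \<partial>\<kappa> x"
  have "2 * (?I + 1) = 2 * ?I + 2" by (simp add: distrib_left)
  also have "\<dots> \<le> V x + K + 2" using drift[OF x] by (intro add_mono) auto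
  also have "\<dots> \<le> 2 * (V x + (K + 2) * indicator {x\<in>space S. V x \<le> ennreal R} x)"
  proof (cases "V x \<le> ennreal R")
    case True
    have "V x + K + 2 = 1 * (V x + (K + 2))" by (simp add: add.assoc)
    also have "\<dots> \<le> 2 * (V x + (K + 2))" by (intro mult_right_mono) auto
    finally show ?thesis using True x by simp
  next
    case False
    then have "K + 2 \<le> V x" using R by auto
    then have "V x + (K + 2) \<le> V x + V x" by (intro add_mono) auto
    then show ?thesis using False by (simp add: mult_2 add.assoc)
  qed
  finally show ?thesis by (subst (asm) ennreal_mult_le_mult_iff) auto
qed

text \<open>Let \<open>p\<^sub>0 = \<nu>\<close> and \<open>p\<^sub>n\<^sub>+\<^sub>1 = p\<^sub>n \<kappa> - \<alpha> p\<^sub>n(C) \<nu>\<close>, the law at time \<open>n + 1\<close> of the part of the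
  chain that has not regenerated yet. The drift condition makes the sum of all \<open>p\<^sub>n\<close> finite, and
  this sum is invariant up to normalisation.\<close>

lemma ex_invariant: "\<exists>\<mu>. invariant_prob_measure S \<kappa> \<mu>"
proof -
  obtain x0 where x0: "x0 \<in> space S" using ne by blast
  \<comment> \<open>The level is high enough for \<open>drift_outside_ball\<close> and for
    \<open>C\<close> to contain a point \<open>x0\<close>, through which the integral of
    \<open>V\<close> over \<nu> is bounded.\<close>
  define R where "R = enn2real (max (V x0) (K + 2))"
  have R: "ennreal R = max (V x0) (K + 2)"
    unfolding R_def using V_fin[OF x0] K_fin by (intro ennreal_enn2real) (auto simp: max_def)
  obtain \<alpha> \<nu> where \<alpha>: "\<alpha> > 0" "\<alpha> < (\<top>::ennreal)" and nu: "sets \<nu> = sets S" "prob_space \<nu>"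
    and min: "\<And>x A. x \<in> space S \<Longrightarrow> V x \<le> ennreal R \<Longrightarrow> A \<in> sets S \<Longrightarrow> \<alpha> * emeasure \<nu> A \<le> emeasure (\<kappa> x) A"
    using minor[of R] by blast
  define C where "C = {x\<in>space S. V x \<le> ennreal R}"
  have [measurable]: "C \<in> sets S" by (simp add: C_def)
  have xC: "x0 \<in> C" using x0 R by (auto simp: C_def)
  interpret nu: prob_space \<nu> by fact
  define Q where "Q p p' \<longleftrightarrow> (\<forall>q\<in>borel_measurable S.
     (\<integral>\<^sup>+y. q y \<partial>p') + \<alpha> * emeasure p C * (\<integral>\<^sup>+y. q y \<partial>\<nu>) = (\<integral>\<^sup>+x. (\<integral>\<^sup>+y. q y \<partial>\<kappa> x) \<partial>p))" for p p'
  \<comment> \<open>The clause for \<open>n = 0\<close> pins the start of the chosen sequence to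
    \<nu>.\<close>
  have "\<exists>\<pi>. \<forall>n::nat. (sets (\<pi> n) = sets S \<and> finite_measure (\<pi> n) \<and> (n = 0 \<longrightarrow> \<pi> n = \<nu>)) \<and> Q (\<pi> n) (\<pi> (Suc n))"
  proof (rule dependent_nat_choice)
    show "\<exists>p. sets p = sets S \<and> finite_measure p \<and> ((0::nat) = 0 \<longrightarrow> p = \<nu>)" using nu nu.finite_measure_axioms by auto
    fix p and n :: nat assume "sets p = sets S \<and> finite_measure p \<and> (n = 0 \<longrightarrow> p = \<nu>)"
    then show "\<exists>p'. (sets p' = sets S \<and> finite_measure p' \<and> (Suc n = 0 \<longrightarrow> p' = \<nu>)) \<and> Q p p'"
      using ex_step[of p \<nu> C \<alpha>] nu min \<alpha> unfolding Q_def by (auto simp: C_def)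
  qed
  then obtain \<pi> where \<pi>: "\<And>n. sets (\<pi> n) = sets S" "\<And>n. finite_measure (\<pi> n)" "\<pi> 0 = \<nu>"
    and step: "\<And>n q. q \<in> borel_measurable S \<Longrightarrow>
     (\<integral>\<^sup>+y. q y \<partial>\<pi> (Suc n)) + \<alpha> * emeasure (\<pi> n) C * (\<integral>\<^sup>+y. q y \<partial>\<nu>) = (\<integral>\<^sup>+x. (\<integral>\<^sup>+y. q y \<partial>\<kappa> x) \<partial>\<pi> n)"
    unfolding Q_def by blast
  note [measurable_cong] = \<pi>(1) nu(1)
  have sp: "space (\<pi> n) = space S" "space \<nu> = space S" for n using \<pi>(1) nu(1) sets_eq_imp_space_eq by blast+
  define a where "a n = emeasure (\<pi> n) (space S)" for n
  define c where "c n = emeasure (\<pi> n) C" for n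
  define v where "v n = (\<integral>\<^sup>+x. V x \<partial>\<pi> n)" for n
  have a0: "a 0 = 1" using nu.emeasure_space_1 sp by (simp add: a_def \<pi>(3))
  \<comment> \<open>The recursion tested with the constant 1: the surviving mass drops by exactly
    the regenerated mass.\<close>
  have astep: "a (Suc n) + \<alpha> * c n = a n" for n
  proof -
    have "(\<integral>\<^sup>+x. (\<integral>\<^sup>+y. 1 \<partial>\<kappa> x) \<partial>\<pi> n) = (\<integral>\<^sup>+x. 1 \<partial>\<pi> n)"
      using prob_kernel(1) sp by (intro nn_integral_cong) (auto simp: prob_space.emeasure_space_1)
    then show ?thesis using step[of "\<lambda>_. 1" n] nu.emeasure_space_1 sp by (simp add: a_def c_def)
  qed
  \<comment> \<open>\<alpha> times \<nu> lies below \<open>\<kappa> x0\<close>, and the drift bounds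
    the integral of \<open>V\<close> over the latter.\<close>
  have v0: "v 0 < \<top>"
  proof -
    have "(\<integral>\<^sup>+x. V x \<partial>(scale_measure \<alpha> \<nu>)) \<le> (\<integral>\<^sup>+x. V x \<partial>\<kappa> x0)"
      by (rule nn_integral_mono_emeasure)
        (use nu prob_kernel(2)[OF x0] min xC in \<open>auto simp: C_def cong: measurable_cong_sets\<close>)
    then have "\<alpha> * v 0 \<le> (\<integral>\<^sup>+x. V x \<partial>\<kappa> x0)" by (simp add: nn_integral_scale_measure v_def \<pi>(3))
    also have "\<dots> \<le> 2 * (\<integral>\<^sup>+x. V x \<partial>\<kappa> x0)" using mult_right_mono[of 1 2 "\<integral>\<^sup>+x. V x \<partial>\<kappa> x0"] by simp
    also have "\<dots> \<le> V x0 + K" by (rule drift[OF x0])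
    also have "\<dots> < \<top>" using V_fin[OF x0] K_fin by simp
    finally show ?thesis using \<alpha> by (auto simp: ennreal_mult_less_top)
  qed
  have vstep: "v (Suc n) + a n \<le> v n + (K + 2) * c n" for n
  proof -
    have "v (Suc n) + a n \<le> (\<integral>\<^sup>+x. (\<integral>\<^sup>+y. V y \<partial>\<kappa> x) \<partial>\<pi> n) + (\<integral>\<^sup>+x. 1 \<partial>\<pi> n)"
      unfolding v_def a_def step[OF V_meas, symmetric] by (intro add_mono) (auto simp: sp)
    also have "\<dots> = (\<integral>\<^sup>+x. (\<integral>\<^sup>+y. V y \<partial>\<kappa> x) + 1 \<partial>\<pi> n)"
      by (subst nn_integral_add) auto
    also have "\<dots> \<le> (\<integral>\<^sup>+x. V x + (K + 2) * indicator C x \<partial>\<pi> n)"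
    proof (intro nn_integral_mono)
      have "K + 2 \<le> ennreal R" using R by simp
      then show "(\<integral>\<^sup>+y. V y \<partial>\<kappa> x) + 1 \<le> V x + (K + 2) * indicator C x" if "x \<in> space (\<pi> n)" for x
        using drift_outside_ball[of x R] that sp unfolding C_def by blast
    qed
    also have "\<dots> = v n + (K + 2) * c n"
      by (subst nn_integral_add) (auto simp: v_def c_def nn_integral_cmult_indicator)
    finally show ?thesis .
  qed
  \<comment> \<open>Regenerated and surviving mass add up to the initial mass 1. Hence the sum of
    all \<open>c n\<close> is at most 1/\<alpha>, and summing \<open>vstep\<close> bounds the sum of
    all \<open>a n\<close> by it.\<close>
  have csum: "\<alpha> * (\<Sum>n<m. c n) + a m = 1" for m
  proof (induction m)
    case (Suc m)
    then show ?case unfolding astep[of m, symmetric] by (simp add: distrib_left ac_simps)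
  qed (simp add: a0)
  have "v m + (\<Sum>n<m. a n) \<le> v 0 + (K + 2) * (\<Sum>n<m. c n)" for m
  proof (induction m)
    case (Suc m)
    have "v (Suc m) + (\<Sum>n<Suc m. a n) \<le> (v m + (K + 2) * c m) + (\<Sum>n<m. a n)"
      using add_mono[OF vstep[of m] order_refl[of "\<Sum>n<m. a n"]] by (simp add: ac_simps)
    also have "\<dots> \<le> (v 0 + (K + 2) * (\<Sum>n<m. c n)) + (K + 2) * c m"
      using add_mono[OF Suc order_refl[of "(K + 2) * c m"]] by (simp add: ac_simps)
    finally show ?case by (simp add: distrib_left ac_simps)
  qed simp
  moreover have "(\<Sum>n<m. c n) \<le> 1 / \<alpha>" for m
  proof -
    have "\<alpha> * (\<Sum>n<m. c n) \<le> 1" using csum[of m] by (metis le_iff_add)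
    then show ?thesis using \<alpha> by (subst ennreal_mult_le_mult_iff[of \<alpha>, symmetric])
      (auto simp: ennreal_times_divide ennreal_divide_self)
  qed
  ultimately have "(\<Sum>n<m. a n) \<le> v 0 + (K + 2) * (1 / \<alpha>)" for m
    by (meson add_increasing add_left_mono mult_left_mono order_trans zero_le order_refl le_add_same_cancel2 add_mono)
  then have "(\<Sum>n. a n) \<le> v 0 + (K + 2) * (1 / \<alpha>)" by (intro suminf_le_const summableI) auto
  moreover have "1 / \<alpha> \<noteq> \<top>" using \<alpha> by (auto simp: ennreal_divide_eq_top_iff)
  then have "v 0 + (K + 2) * (1 / \<alpha>) < \<top>"
    using v0 K_fin by (auto simp: ennreal_mult_eq_top_iff less_top[symmetric])
  ultimately have afin: "(\<Sum>n. a n) < \<top>" by (rule le_less_trans)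
  obtain m where m: "sets m = sets S" "\<And>q. q \<in> borel_measurable S \<Longrightarrow> (\<integral>\<^sup>+x. q x \<partial>m) = (\<Sum>n. \<integral>\<^sup>+x. q x \<partial>\<pi> n)"
    using ex_suminf_measure[of \<pi> S] \<pi>(1) by blast
  have em: "emeasure m A = (\<Sum>n. emeasure (\<pi> n) A)" if "A \<in> sets S" for A
    using m(2)[of "indicator A"] that m(1) \<pi>(1) by simp
  \<comment> \<open>Summing the recursion telescopes: the shifted series misses only
    \<open>\<pi> 0\<close>, which is \<nu>. This term is added on both sides to avoid
    subtraction.\<close>
  have inv: "(\<integral>\<^sup>+x. emeasure (\<kappa> x) A \<partial>m) + emeasure \<nu> A = emeasure m A + \<alpha> * emeasure m C * emeasure \<nu> A"
    if A[measurable]: "A \<in> sets S" for A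
  proof -
    have "(\<integral>\<^sup>+x. emeasure (\<kappa> x) A \<partial>m) = (\<Sum>n. \<integral>\<^sup>+x. emeasure (\<kappa> x) A \<partial>\<pi> n)" by (rule m(2)) measurable
    also have "\<dots> = (\<Sum>n. emeasure (\<pi> (Suc n)) A + \<alpha> * c n * emeasure \<nu> A)"
    proof (rule suminf_cong)
      fix n
      have "(\<integral>\<^sup>+x. emeasure (\<kappa> x) A \<partial>\<pi> n) = (\<integral>\<^sup>+x. (\<integral>\<^sup>+y. indicator A y \<partial>\<kappa> x) \<partial>\<pi> n)"
        by (intro nn_integral_cong) (use sp prob_kernel(2) A in auto)
      then show "(\<integral>\<^sup>+x. emeasure (\<kappa> x) A \<partial>\<pi> n) = emeasure (\<pi> (Suc n)) A + \<alpha> * c n * emeasure \<nu> A"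
        using step[of "indicator A" n] A \<pi>(1) nu by (simp add: c_def)
    qed
    also have "\<dots> = (\<Sum>n. emeasure (\<pi> (Suc n)) A) + \<alpha> * (\<Sum>n. c n) * emeasure \<nu> A"
      by (subst suminf_add[symmetric]) (auto intro!: summableI)
    finally have "(\<integral>\<^sup>+x. emeasure (\<kappa> x) A \<partial>m) + emeasure \<nu> A =
       (emeasure (\<pi> 0) A + (\<Sum>n. emeasure (\<pi> (Suc n)) A)) + \<alpha> * (\<Sum>n. c n) * emeasure \<nu> A"
      by (simp add: ac_simps \<pi>(3))
    also have "emeasure (\<pi> 0) A + (\<Sum>n. emeasure (\<pi> (Suc n)) A) = (\<Sum>n. emeasure (\<pi> n) A)"
      using suminf_offset[of "\<lambda>n. emeasure (\<pi> n) A" 1] by (simp add: summableI)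
    finally show ?thesis by (simp add: em c_def)
  qed
  have mfin: "emeasure m (space S) < \<top>" using afin by (simp add: em a_def)
  have spm: "space m = space S" using m(1) sets_eq_imp_space_eq by blast
  have "(\<integral>\<^sup>+x. emeasure (\<kappa> x) (space S) \<partial>m) = (\<integral>\<^sup>+x. 1 \<partial>m)"
  proof (intro nn_integral_cong)
    fix x assume "x \<in> space m"
    then show "emeasure (\<kappa> x) (space S) = 1"
      using prob_kernel[of x] prob_space.emeasure_space_1[of "\<kappa> x"] sets_eq_imp_space_eq[of "\<kappa> x" S] spm by simp
  qed
  then have "emeasure m (space S) + 1 = emeasure m (space S) + \<alpha> * emeasure m C"
    using inv[OF sets.top] nu.emeasure_space_1 sp by (simp add: spm)
  \<comment> \<open>With the whole space as test set the finite mass of \<open>m\<close> cancels: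
    regeneration happens with total probability 1, so the two terms with \<nu> in \<open>inv\<close>
    are equal.\<close>
  then have aC: "\<alpha> * emeasure m C = 1" using mfin
    by (simp only: ennreal_add_left_cancel) (auto simp: less_top[symmetric])
  have inv': "(\<integral>\<^sup>+x. emeasure (\<kappa> x) A \<partial>m) = emeasure m A" if "A \<in> sets S" for A
  proof -
    have "emeasure \<nu> A \<noteq> \<top>" by simp
    moreover have "emeasure \<nu> A + (\<integral>\<^sup>+x. emeasure (\<kappa> x) A \<partial>m) = emeasure \<nu> A + emeasure m A"
      using inv[OF that] unfolding aC by (simp only: mult_1 add.commute)
    ultimately show ?thesis by (simp only: ennreal_add_left_cancel infinity_ennreal_def) blast
  qed
  define z where "z = emeasure m (space S)"
  have z: "0 < z" "z < \<top>"
  proof -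
    have "1 \<le> z" unfolding z_def em[OF sets.top] using a0 sum_le_suminf[of a "{0}"] by (simp add: a_def[abs_def] summableI)
    then show "0 < z" by (simp add: order_less_le_trans[OF zero_less_one])
  qed (simp add: z_def mfin)
  define \<mu> where "\<mu> = scale_measure (inverse z) m"
  have "sets \<mu> = sets S" by (simp add: \<mu>_def m)
  moreover have "prob_space \<mu>"
  proof (rule prob_spaceI)
    have "space \<mu> = space S" using m(1) by (intro sets_eq_imp_space_eq) (simp add: \<mu>_def)
    moreover have "inverse z * z = 1" using z ennreal_divide_self[of z] by (simp add: divide_ennreal_def mult.commute)
    ultimately show "emeasure \<mu> (space \<mu>) = 1" by (simp add: \<mu>_def z_def)
  qed
  moreover have "(\<integral>\<^sup>+x. emeasure (\<kappa> x) A \<partial>\<mu>) = emeasure \<mu> A" if A[measurable]: "A \<in> sets S" for A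
    using inv'[OF A] m(1) by (simp add: \<mu>_def nn_integral_scale_measure measurable_cong_sets[OF m(1) refl])
  ultimately have "invariant_prob_measure S \<kappa> \<mu>" by (simp add: invariant_prob_measure_nn[OF kernel])
  then show ?thesis ..
qed

text \<open>On the two parts of a Hahn decomposition of \<open>M - N\<close> no mass can be exchanged, so the measure
  that minorises the kernel on a large ball would vanish on both parts.\<close>

lemma invariant_unique:
  assumes "invariant_prob_measure S \<kappa> M" "invariant_prob_measure S \<kappa> N"
  shows "M = N"
proof (rule ccontr)
  assume neq: "M \<noteq> N"
  have M: "sets M = sets S" "prob_space M" "\<And>A. A \<in> sets S \<Longrightarrow> (\<integral>\<^sup>+x. emeasure (\<kappa> x) A \<partial>M) = emeasure M A"
    and N: "sets N = sets S" "prob_space N" "\<And>A. A \<in> sets S \<Longrightarrow> (\<integral>\<^sup>+x. emeasure (\<kappa> x) A \<partial>N) = emeasure N A"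
    using assms unfolding invariant_prob_measure_nn[OF kernel] by auto
  interpret M: prob_space M by fact
  interpret N: prob_space N by fact
  note [measurable_cong] = M(1) N(1)
  have sp: "space M = space S" "space N = space S" using M(1) N(1) sets_eq_imp_space_eq by blast+
  obtain Y where Y[measurable]: "Y \<in> sets S"
    and Y1: "\<And>X. X \<in> sets S \<Longrightarrow> X \<subseteq> Y \<Longrightarrow> emeasure N X \<le> emeasure M X"
    and Y2: "\<And>X. X \<in> sets S \<Longrightarrow> X \<inter> Y = {} \<Longrightarrow> emeasure M X \<le> emeasure N X"
    using finite_unsigned_Hahn_decomposition[OF M.finite_measure_axioms N.finite_measure_axioms] M(1) N(1) by auto
  define Z where "Z = space S - Y"
  have Z[measurable]: "Z \<in> sets S" by (simp add: Z_def)
  have YZ: "Y \<inter> Z = {}" "Y \<union> Z = space S" "Y \<subseteq> space S" using sets.sets_into_space[OF Y] by (auto simp: Z_def)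
  have Y2': "emeasure M X \<le> emeasure N X" if "X \<in> sets S" "X \<subseteq> Z" for X
    using Y2[of X] that YZ by blast
  let ?p = "\<lambda>x. emeasure (\<kappa> x) Y" and ?q = "\<lambda>x. emeasure (\<kappa> x) Z"
  have pq: "?p x + ?q x = 1" if "x \<in> space S" for x
    using prob_kernel[OF that] prob_space.emeasure_space_1[of "\<kappa> x"] sets_eq_imp_space_eq[of "\<kappa> x" S] plus_emeasure[of Y "\<kappa> x" Z] YZ
    by simp
  \<comment> \<open>For a stationary law the flow from \<open>Y\<close> to \<open>Z\<close> equals
    the flow from \<open>Z\<close> to \<open>Y\<close>: each of them completes the mass that stays
    in \<open>Y\<close> to the mass of \<open>Y\<close>.\<close>
  have bal: "(\<integral>\<^sup>+x. ?q x * indicator Y x \<partial>P) = (\<integral>\<^sup>+x. ?p x * indicator Z x \<partial>P) \<and> (\<integral>\<^sup>+x. ?q x * indicator Y x \<partial>P) < \<top>"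
    if P: "sets P = sets S" "prob_space P" "(\<integral>\<^sup>+x. ?p x \<partial>P) = emeasure P Y" for P
  proof -
    interpret P: prob_space P by fact
    note [measurable_cong] = P(1)
    have spP: "space P = space S" using P(1) sets_eq_imp_space_eq by blast
    have "emeasure P Y = (\<integral>\<^sup>+x. ?p x * indicator Y x + ?q x * indicator Y x \<partial>P)"
    proof -
      have "emeasure P Y = (\<integral>\<^sup>+x. indicator Y x \<partial>P)" using P by simp
      also have "\<dots> = (\<integral>\<^sup>+x. ?p x * indicator Y x + ?q x * indicator Y x \<partial>P)"
        by (intro nn_integral_cong) (auto simp: indicator_def pq spP)
      finally show ?thesis .
    qed
    also have "\<dots> = (\<integral>\<^sup>+x. ?p x * indicator Y x \<partial>P) + (\<integral>\<^sup>+x. ?q x * indicator Y x \<partial>P)"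
      by (subst nn_integral_add) auto
    finally have 1: "emeasure P Y = (\<integral>\<^sup>+x. ?p x * indicator Y x \<partial>P) + (\<integral>\<^sup>+x. ?q x * indicator Y x \<partial>P)" .
    have "emeasure P Y = (\<integral>\<^sup>+x. ?p x * indicator Y x + ?p x * indicator Z x \<partial>P)"
      unfolding P(3)[symmetric] using YZ by (intro nn_integral_cong) (auto simp: indicator_def spP)
    also have "\<dots> = (\<integral>\<^sup>+x. ?p x * indicator Y x \<partial>P) + (\<integral>\<^sup>+x. ?p x * indicator Z x \<partial>P)"
      by (subst nn_integral_add) auto
    finally have 2: "emeasure P Y = (\<integral>\<^sup>+x. ?p x * indicator Y x \<partial>P) + (\<integral>\<^sup>+x. ?p x * indicator Z x \<partial>P)" .
    have f: "emeasure P Y < \<top>" by (simp add: less_top[symmetric])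
    show ?thesis by (rule ennreal_summands_eq[OF 1 2 f])
  qed
  note bM = bal[OF M(1,2) M(3)[OF Y]] and bN = bal[OF N(1,2) N(3)[OF Y]]
  have l1: "(\<integral>\<^sup>+x. ?q x * indicator Y x \<partial>N) \<le> (\<integral>\<^sup>+x. ?q x * indicator Y x \<partial>M)"
    by (rule set_nn_integral_mono_emeasure) (use Y1 M N in \<open>auto cong: measurable_cong_sets\<close>)
  have l2: "(\<integral>\<^sup>+x. ?p x * indicator Z x \<partial>M) \<le> (\<integral>\<^sup>+x. ?p x * indicator Z x \<partial>N)"
    by (rule set_nn_integral_mono_emeasure) (use Y2' M N in \<open>auto cong: measurable_cong_sets\<close>)
  \<comment> \<open>The flow out of \<open>Y\<close> is at least as large under \<open>M\<close>,
    the flow out of \<open>Z\<close> at least as large under \<open>N\<close>; the balance closes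
    this chain of inequalities into equalities.\<close>
  have eqs: "(\<integral>\<^sup>+x. ?q x * indicator Y x \<partial>M) = (\<integral>\<^sup>+x. ?q x * indicator Y x \<partial>N)"
    "(\<integral>\<^sup>+x. ?p x * indicator Z x \<partial>N) = (\<integral>\<^sup>+x. ?p x * indicator Z x \<partial>M)"
    using l1 l2 bM bN by auto
  define C where "C n = {x\<in>space S. V x \<le> ennreal (real n)}" for n :: nat
  have C[measurable]: "C n \<in> sets S" for n by (simp add: C_def)
  have Cmono: "C m \<subseteq> C n" if "m \<le> n" for m n
    using that by (auto simp: C_def intro: order_trans ennreal_leI)
  have Cun: "(\<Union>n. A \<inter> C n) = A" if "A \<subseteq> space S" for A
  proof -
    have "\<exists>n. x \<in> C n" if x: "x \<in> space S" for x
    proof -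
      obtain n where "enn2real (V x) \<le> real n" using real_arch_simple by blast
      then have "V x \<le> ennreal (real n)" using V_fin[OF x] ennreal_leI[of "enn2real (V x)" "real n"] by simp
      with x show ?thesis by (auto simp: C_def)
    qed
    with that show ?thesis by auto
  qed
  \<comment> \<open>From the ball \<open>C n\<close> each part is entered with probability at least
    \<alpha> times its \<nu>-mass, and \<nu> charges at least one part. Equal flows into a charged
    part force the two laws to agree on the ball inside the opposite part.\<close>
  have key: "emeasure M (Y \<inter> C n) = emeasure N (Y \<inter> C n) \<or> emeasure N (Z \<inter> C n) = emeasure M (Z \<inter> C n)" for n
  proof -
    obtain \<alpha> \<nu> where \<alpha>: "\<alpha> > 0" "\<alpha> < (\<top>::ennreal)" and nu: "sets \<nu> = sets S" "prob_space \<nu>"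
      and min: "\<And>x A. x \<in> space S \<Longrightarrow> V x \<le> ennreal (real n) \<Longrightarrow> A \<in> sets S \<Longrightarrow> \<alpha> * emeasure \<nu> A \<le> emeasure (\<kappa> x) A"
      using minor[of "real n"] by blast
    interpret nu: prob_space \<nu> by fact
    have fin: "\<alpha> * emeasure \<nu> A < \<top>" for A using \<alpha> by (auto simp: ennreal_mult_eq_top_iff less_top[symmetric])
    have "\<alpha> * emeasure \<nu> Z = 0 \<or> emeasure M (Y \<inter> C n) = emeasure N (Y \<inter> C n)"
      by (rule dominated_part_critical[where q="?q"])
        (use Y1 M N bM eqs fin min M.finite_measure_axioms N.finite_measure_axioms in \<open>auto simp: C_def cong: measurable_cong_sets\<close>)
    moreover have "\<alpha> * emeasure \<nu> Y = 0 \<or> emeasure N (Z \<inter> C n) = emeasure M (Z \<inter> C n)"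
      by (rule dominated_part_critical[where q="?p"])
        (use Y2' M N bM bN eqs fin min M.finite_measure_axioms N.finite_measure_axioms in \<open>auto simp: C_def cong: measurable_cong_sets\<close>)
    moreover have "\<not> (emeasure \<nu> Z = 0 \<and> emeasure \<nu> Y = 0)"
      using nu.emeasure_space_1 plus_emeasure[of Y \<nu> Z] YZ nu sets_eq_imp_space_eq[OF nu(1)] by auto
    ultimately show ?thesis using \<alpha> by auto
  qed
  \<comment> \<open>Domination on \<open>A\<close> with equal total mass leaves no room for a
    difference on a subset.\<close>
  have sub: "emeasure P A' = emeasure P' A'"
    if "\<And>X. X \<in> sets S \<Longrightarrow> X \<subseteq> A \<Longrightarrow> emeasure P X \<le> emeasure P' X" "A \<in> sets S" "A' \<in> sets S" "A' \<subseteq> A"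
      "emeasure P A = emeasure P' A" "sets P = sets S" "sets P' = sets S" "prob_space P'" for A A' P P'
  proof -
    interpret P': prob_space P' by fact
    have "emeasure P A' + emeasure P (A - A') = emeasure P' A' + emeasure P' (A - A')"
      using plus_emeasure[of A' P "A - A'"] plus_emeasure[of A' P' "A - A'"] that by (simp add: Un_absorb1)
    moreover have "emeasure P (A - A') \<le> emeasure P' (A - A')" "emeasure P A' \<le> emeasure P' A'" using that by auto
    ultimately have "emeasure P' (A - A') + emeasure P' A' \<le> emeasure P' (A - A') + emeasure P A'"
      by (metis add.commute add_left_mono)
    then have "emeasure P' A' \<le> emeasure P A'"
      using P'.emeasure_finite by (auto simp: ennreal_add_left_cancel_le)
    then show ?thesis using that by (intro antisym) auto
  qed
  have lim: "emeasure P A = emeasure P' A" if "\<And>n. emeasure P (A \<inter> C n) = emeasure P' (A \<inter> C n)" "A \<in> sets S"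
    "sets P = sets S" "sets P' = sets S" for P P' A
  proof -
    have inc: "incseq (\<lambda>n. A \<inter> C n)" unfolding incseq_def using Cmono by blast
    have "(\<lambda>n. emeasure P (A \<inter> C n)) \<longlonglongrightarrow> emeasure P A" "(\<lambda>n. emeasure P' (A \<inter> C n)) \<longlonglongrightarrow> emeasure P' A"
      using Lim_emeasure_incseq[of "\<lambda>n. A \<inter> C n" P] Lim_emeasure_incseq[of "\<lambda>n. A \<inter> C n" P']
        Cun[OF sets.sets_into_space[OF that(2)]] that(2-) inc
      by (simp_all add: image_subset_iff)
    then show ?thesis using that(1) LIMSEQ_unique by auto
  qed
  have YZeq: "emeasure M Y = emeasure N Y \<longleftrightarrow> emeasure M Z = emeasure N Z"
  proof -
    have "emeasure M Y + emeasure M Z = emeasure N Y + emeasure N Z"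
      using plus_emeasure[of Y M Z] plus_emeasure[of Y N Z] YZ M(1) N(1) M.emeasure_space_1 N.emeasure_space_1 sp by simp
    moreover have "a = c \<longleftrightarrow> b = d" if "a + b = c + d" "a \<noteq> \<top>" "b \<noteq> \<top>" "c \<noteq> \<top>" "d \<noteq> \<top>" for a b c d :: ennreal
      using that by (metis add.commute ennreal_add_left_cancel infinity_ennreal_def)
    ultimately show ?thesis by simp
  qed
  \<comment> \<open>Both laws have mass 1, so a difference on \<open>Y\<close> is matched by one on
    \<open>Z\<close>; agreement on both parts would give \<open>M = N\<close>.\<close>
  have "\<not> (emeasure M Y = emeasure N Y \<and> emeasure M Z = emeasure N Z)"
  proof
    assume e: "emeasure M Y = emeasure N Y \<and> emeasure M Z = emeasure N Z"
    have "M = N"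
    proof (rule measure_eqI)
      fix A assume "A \<in> sets M"
      then have A[measurable]: "A \<in> sets S" using M by simp
      have "emeasure N (A \<inter> Y) = emeasure M (A \<inter> Y)" by (rule sub[of Y]) (use Y1 e M N in auto)
      moreover have "emeasure M (A \<inter> Z) = emeasure N (A \<inter> Z)" by (rule sub[of Z]) (use Y2' e M N in auto)
      moreover have "A = (A \<inter> Y) \<union> (A \<inter> Z)" using sets.sets_into_space[OF A] YZ by auto
      ultimately show "emeasure M A = emeasure N A"
        using plus_emeasure[of "A \<inter> Y" M "A \<inter> Z"] plus_emeasure[of "A \<inter> Y" N "A \<inter> Z"] YZ(1) M(1) N(1) A Y Z
        by (metis inf_assoc inf_bot_right inf_left_commute sets.Int)
    qed (simp add: M N)
    with neq show False ..
  qed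
  then have "emeasure M Y \<noteq> emeasure N Y" "emeasure N Z \<noteq> emeasure M Z" using YZeq by auto
  then obtain n1 n2 where n: "emeasure M (Y \<inter> C n1) \<noteq> emeasure N (Y \<inter> C n1)" "emeasure N (Z \<inter> C n2) \<noteq> emeasure M (Z \<inter> C n2)"
    using lim[of M Y N] lim[of N Z M] M N by auto
  \<comment> \<open>By \<open>sub\<close>, differences on smaller balls persist on larger ones; on a
    common ball both occur, which \<open>key\<close> excludes.\<close>
  let ?n = "max n1 n2"
  have "emeasure M (Y \<inter> C ?n) \<noteq> emeasure N (Y \<inter> C ?n)"
    using n(1) sub[of "Y \<inter> C ?n" N M "Y \<inter> C n1"] Y1 M N Int_mono[OF subset_refl Cmono[of n1 ?n], of Y] by auto
  moreover have "emeasure N (Z \<inter> C ?n) \<noteq> emeasure M (Z \<inter> C ?n)"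
    using n(2) sub[of "Z \<inter> C ?n" M N "Z \<inter> C n2"] Y2' M N Int_mono[OF subset_refl Cmono[of n2 ?n], of Z] by auto
  ultimately show False using key[of ?n] by auto
qed

lemma uniquely_ergodic: "uniquely_ergodic S \<kappa>"
  unfolding uniquely_ergodic_def using ex_invariant invariant_unique by blast

end

subsection \<open>Trigonometric polynomials in \<open>L\<^sup>2(0,1)\<close>\<close>

abbreviation unit_lebesgue :: "real measure" where
  "unit_lebesgue \<equiv> lebesgue_on {0<..<1}"

lemma prob_space_unit_lebesgue: "prob_space unit_lebesgue"
  by (rule prob_spaceI) (simp add: space_restrict_space emeasure_restrict_space)

text \<open>The endpoints are null, which links the Lebesgue integral over the open interval to the
  Henstock-Kurzweil integral over the closed one, where the fundamental theorem and continuity in a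
  parameter are at hand.\<close>

lemma cont_unit:
  fixes u :: "real \<Rightarrow> real"
  assumes "continuous_on UNIV u"
  shows "u \<in> borel_measurable unit_lebesgue" "integrable unit_lebesgue u"
    "integral\<^sup>L unit_lebesgue u = integral {0..1} u"
proof -
  have c: "continuous_on S u" for S using assms continuous_on_subset by blast
  show m: "u \<in> borel_measurable unit_lebesgue"
    by (rule continuous_imp_measurable_on_sets_lebesgue[OF c]) auto
  have "integrable (lebesgue_on {0..1}) u"
    by (rule continuous_imp_integrable_real[OF c])
  then have "set_integrable lebesgue {0..1} u"
    by (simp add: integrable_restrict_space set_integrable_def)
  then have "set_integrable lebesgue {0<..<1} u" by (rule set_integrable_subset) auto
  then show i: "integrable unit_lebesgue u"
    by (simp add: integrable_restrict_space set_integrable_def)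
  then show "integral\<^sup>L unit_lebesgue u = integral {0..1} u"
    by (subst lebesgue_integral_eq_integral) (auto simp: integral_open_interval_real)
qed

lemma L2I_cont: "continuous_on UNIV u \<Longrightarrow> u \<in> L2"
  unfolding L2_def using cont_unit[of u] cont_unit(2)[of "\<lambda>x. (u x)\<^sup>2"] by (auto intro: continuous_intros)

lemma L2_mult_integrable:
  assumes "u \<in> L2" "v \<in> L2"
  shows "integrable unit_lebesgue (\<lambda>\<xi>. u \<xi> * v \<xi>)"
proof (rule Bochner_Integration.integrable_bound)
  show "integrable unit_lebesgue (\<lambda>\<xi>. (u \<xi>)\<^sup>2 + (v \<xi>)\<^sup>2)" using assms by (auto simp: L2_def)
  have [measurable]: "u \<in> borel_measurable unit_lebesgue" "v \<in> borel_measurable unit_lebesgue"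
    using assms by (auto simp: L2_def)
  show "(\<lambda>\<xi>. u \<xi> * v \<xi>) \<in> borel_measurable unit_lebesgue" by measurable
  have "\<bar>a * b\<bar> \<le> a\<^sup>2 + b\<^sup>2" for a b :: real
    using sum_squares_bound[of a b] sum_squares_bound[of a "- b"] zero_le_power2[of a] zero_le_power2[of b]
    by (auto simp: abs_if)
  then show "AE \<xi> in unit_lebesgue. norm (u \<xi> * v \<xi>) \<le> norm ((u \<xi>)\<^sup>2 + (v \<xi>)\<^sup>2)" by simp
qed

lemma L2_add: "u \<in> L2 \<Longrightarrow> v \<in> L2 \<Longrightarrow> (\<lambda>\<xi>. u \<xi> + v \<xi>) \<in> L2"
  using L2_mult_integrable[of u v] by (auto simp: L2_def power2_sum mult.assoc)

lemma L2_cmult: "u \<in> L2 \<Longrightarrow> (\<lambda>\<xi>. a * u \<xi>) \<in> L2"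
  by (auto simp: L2_def power_mult_distrib)

lemma L2_sum: "(\<And>k. k \<in> I \<Longrightarrow> u k \<in> L2) \<Longrightarrow> (\<lambda>\<xi>. \<Sum>k\<in>I. u k \<xi>) \<in> L2"
  by (induction I rule: infinite_finite_induct) (auto intro: L2_add L2I_cont)

lemma L2_bounded_mult:
  assumes "u \<in> L2" "c \<in> borel_measurable unit_lebesgue" "\<And>\<xi>. \<bar>c \<xi>\<bar> \<le> B"
  shows "(\<lambda>\<xi>. c \<xi> * u \<xi>) \<in> L2"
proof -
  have [measurable]: "u \<in> borel_measurable unit_lebesgue" and i: "integrable unit_lebesgue (\<lambda>\<xi>. (u \<xi>)\<^sup>2)"
    using assms by (auto simp: L2_def)
  note [measurable] = assms(2)
  have "integrable unit_lebesgue (\<lambda>\<xi>. (c \<xi> * u \<xi>)\<^sup>2)"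
  proof (rule Bochner_Integration.integrable_bound)
    show "integrable unit_lebesgue (\<lambda>\<xi>. B\<^sup>2 * (u \<xi>)\<^sup>2)" using i by simp
    have "(c \<xi>)\<^sup>2 \<le> B\<^sup>2" for \<xi> using assms(3)[of \<xi>] by (simp add: abs_le_square_iff[symmetric])
    then show "AE \<xi> in unit_lebesgue. norm ((c \<xi> * u \<xi>)\<^sup>2) \<le> norm (B\<^sup>2 * (u \<xi>)\<^sup>2)"
      by (simp add: power_mult_distrib mult_right_mono)
  qed measurable
  then show ?thesis by (simp add: L2_def)
qed

lemma L2_inner_commute: "L2_inner u v = L2_inner v u"
  by (simp add: L2_inner_def mult.commute)

lemma L2_inner_sum_left:
  assumes "\<And>k. k \<in> I \<Longrightarrow> u k \<in> L2" "v \<in> L2"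
  shows "L2_inner (\<lambda>\<xi>. \<Sum>k\<in>I. c k * u k \<xi>) v = (\<Sum>k\<in>I. c k * L2_inner (u k) v)"
proof -
  have "L2_inner (\<lambda>\<xi>. \<Sum>k\<in>I. c k * u k \<xi>) v = (\<integral>\<xi>. (\<Sum>k\<in>I. c k * (u k \<xi> * v \<xi>)) \<partial>unit_lebesgue)"
    by (simp add: L2_inner_def sum_distrib_right mult.assoc)
  also have "\<dots> = (\<Sum>k\<in>I. c k * L2_inner (u k) v)"
    using assms by (subst Bochner_Integration.integral_sum) (auto intro: L2_mult_integrable simp: L2_inner_def)
  finally show ?thesis .
qed

lemma L2_inner_diff_left:
  assumes "u \<in> L2" "v \<in> L2" "w \<in> L2"
  shows "L2_inner (\<lambda>\<xi>. u \<xi> - v \<xi>) w = L2_inner u w - L2_inner v w"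
  using L2_mult_integrable[OF assms(1,3)] L2_mult_integrable[OF assms(2,3)]
  by (simp add: L2_inner_def left_diff_distrib)

lemma L2_diff: "u \<in> L2 \<Longrightarrow> v \<in> L2 \<Longrightarrow> (\<lambda>\<xi>. u \<xi> - v \<xi>) \<in> L2"
  using L2_add[of u "\<lambda>\<xi>. - 1 * v \<xi>"] L2_cmult[of v "- 1"] by simp

lemma L2_inner_self_nonneg: "0 \<le> L2_inner u u"
  unfolding L2_inner_def by (rule Bochner_Integration.integral_nonneg) simp

lemma L2_norm_power2: "(L2_norm u)\<^sup>2 = L2_inner u u"
  by (simp add: L2_norm_def L2_inner_self_nonneg)

section \<open>Orthogonality of the eigenfunctions and of their derivatives\<close>

lemma integral_cos_int_pi: "integral {0..1} (\<lambda>x. cos (of_int n * pi * x)) = (if n = 0 then 1 else 0 :: real)"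
proof (cases "n = 0")
  case False
  have "((\<lambda>x. cos (of_int n * pi * x)) has_integral
      sin (of_int n * pi * 1) / (of_int n * pi) - sin (of_int n * pi * 0) / (of_int n * pi)) {0..1::real}"
    using False by (intro fundamental_theorem_of_calculus)
      (auto intro!: derivative_eq_intros simp: has_real_derivative_iff_has_vector_derivative[symmetric])
  then show ?thesis using False by (simp add: integral_unique sin_int_times_real mult.commute)
qed simp

lemma continuous_eigenfun [continuous_intros]:
  fixes f :: "'a::t2_space \<Rightarrow> real"
  shows "continuous_on S f \<Longrightarrow> continuous_on S (\<lambda>x. eigenfun k (f x))"
  unfolding eigenfun_def by (auto intro!: continuous_intros)

text \<open>Product-to-sum formulas. The frequency \<open>k + l\<close> is never 0 for positive
  indices; \<open>k - l\<close> may be negative, hence integer frequencies. The factor 2 is the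
  square of the normalisation \<open>sqrt 2\<close> in \<open>eigenfun\<close>.\<close>

lemma integral_cos_prod:
  assumes "k \<ge> 1" "l \<ge> 1"
  shows "(\<integral>x. 2 * (sin (real k * pi * x) * sin (real l * pi * x)) \<partial>unit_lebesgue) = (if k = l then 1 else 0)"
    "(\<integral>x. 2 * (cos (real k * pi * x) * cos (real l * pi * x)) \<partial>unit_lebesgue) = (if k = l then 1 else 0)"
proof -
  let ?m = "int k - int l" and ?p = "int k + int l"
  have ii: "(\<lambda>x. cos (of_int n * pi * x)) integrable_on {0..1::real}" for n
    by (intro integrable_continuous_real continuous_intros)
  have s: "2 * (sin (real k * pi * x) * sin (real l * pi * x)) = cos (of_int ?m * pi * x) - cos (of_int ?p * pi * x)"
    "2 * (cos (real k * pi * x) * cos (real l * pi * x)) = cos (of_int ?m * pi * x) + cos (of_int ?p * pi * x)" for x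
    by (simp_all add: left_diff_distrib distrib_right cos_add cos_diff)
  have "?p \<noteq> 0" using assms by simp
  then show "(\<integral>x. 2 * (sin (real k * pi * x) * sin (real l * pi * x)) \<partial>unit_lebesgue) = (if k = l then 1 else 0)"
    "(\<integral>x. 2 * (cos (real k * pi * x) * cos (real l * pi * x)) \<partial>unit_lebesgue) = (if k = l then 1 else 0)"
    unfolding s
    by (subst cont_unit(3), intro continuous_intros,
        simp only: Henstock_Kurzweil_Integration.integral_diff Henstock_Kurzweil_Integration.integral_add ii integral_cos_int_pi, simp)+
qed

lemma eigenfun_orthonormal:
  assumes "k \<ge> 1" "l \<ge> 1"
  shows "L2_inner (eigenfun k) (eigenfun l) = (if k = l then 1 else 0)"
proof -
  have "eigenfun k \<xi> * eigenfun l \<xi> = 2 * (sin (real k * pi * \<xi>) * sin (real l * pi * \<xi>))" for \<xi>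
    by (simp add: eigenfun_def)
  then show ?thesis using integral_cos_prod(1)[OF assms] by (simp add: L2_inner_def)
qed

lemma eigenfun_L2: "eigenfun k \<in> L2"
  by (intro L2I_cont continuous_intros)

lemma deriv_eigenfun_orthogonal:
  assumes "k \<ge> 1" "l \<ge> 1"
  shows "L2_inner (deriv (eigenfun k)) (deriv (eigenfun l)) = (if k = l then (real k * pi)\<^sup>2 else 0)"
proof -
  have d: "deriv (eigenfun k) = (\<lambda>\<xi>. sqrt 2 * (real k * pi) * cos (real k * pi * \<xi>))" for k
    unfolding eigenfun_def[abs_def]
    by (intro ext DERIV_imp_deriv) (auto intro!: derivative_eq_intros)
  have "(\<lambda>\<xi>. deriv (eigenfun k) \<xi> * deriv (eigenfun l) \<xi>) =
      (\<lambda>\<xi>. (real k * pi) * (real l * pi) * (2 * (cos (real k * pi * \<xi>) * cos (real l * pi * \<xi>))))"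
    by (auto simp: d fun_eq_iff)
  then show ?thesis unfolding L2_inner_def
    using integral_cos_prod(2)[OF assms] by (simp add: power2_eq_square del: mult_cancel_left)
qed

section \<open>Coordinates on V_N\<close>

text \<open>Coordinate vectors are functions on all naturals, of which only the entries 1 to N
  count. Their type carries a product topology and Borel sets independent of N, and it serves for
  noise sequences as well.\<close>

definition synth :: "nat \<Rightarrow> (nat \<Rightarrow> real) \<Rightarrow> real \<Rightarrow> real" where
  "synth N c \<xi> = (\<Sum>k=1..N. c k * eigenfun k \<xi>)"

definition coef :: "(real \<Rightarrow> real) \<Rightarrow> nat \<Rightarrow> real" where
  "coef u k = L2_inner u (eigenfun k)"

lemma VN_iff: "u \<in> VN N \<longleftrightarrow> (\<exists>c. u = synth N c)"
  by (simp add: VN_def synth_def[abs_def])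

lemma synth_in_VN [simp]: "synth N c \<in> VN N"
  by (auto simp: VN_iff)

lemma continuous_synth [continuous_intros]:
  fixes f :: "'a::t2_space \<Rightarrow> real"
  shows "continuous_on S f \<Longrightarrow> continuous_on S (\<lambda>x. synth N c (f x))"
  unfolding synth_def by (intro continuous_intros)

lemma synth_L2: "synth N c \<in> L2"
  by (intro L2I_cont continuous_intros)

lemma synth_cong: "(\<And>k. k \<in> {1..N} \<Longrightarrow> c k = d k) \<Longrightarrow> synth N c = synth N d"
  by (simp add: synth_def[abs_def])

lemma coef_synth: "coef (synth N c) k = (if k \<in> {1..N} then c k else 0)"
proof (cases "k = 0")
  \<comment> \<open>\<open>eigenfun 0\<close> is the zero function, so the index 0 falls under the
    default value without orthogonality.\<close>
  case True
  then show ?thesis by (simp add: coef_def L2_inner_def eigenfun_def)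
next
  case False
  have "coef (synth N c) k = (\<Sum>j=1..N. c j * L2_inner (eigenfun j) (eigenfun k))"
    unfolding coef_def synth_def[abs_def] by (rule L2_inner_sum_left) (auto intro: eigenfun_L2)
  also have "\<dots> = (\<Sum>j=1..N. if k = j then c j else 0)"
    using False by (intro sum.cong) (auto simp: eigenfun_orthonormal)
  finally show ?thesis by simp
qed

lemma synth_coef: "u \<in> VN N \<Longrightarrow> synth N (coef u) = u"
  by (auto simp: VN_iff coef_synth intro!: synth_cong)

lemma L2_inner_synth:
  assumes "v \<in> L2" shows "L2_inner (synth N c) v = (\<Sum>k=1..N. c k * coef v k)"
  unfolding synth_def[abs_def] by (subst L2_inner_sum_left) (auto intro: eigenfun_L2 assms simp: coef_def L2_inner_commute)

lemma L2_inner_synth_synth: "L2_inner (synth N c) (synth N d) = (\<Sum>k=1..N. c k * d k)"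
  by (subst L2_inner_synth[OF synth_L2]) (simp add: coef_synth)

lemma synth_diff: "(\<lambda>\<xi>. synth N c \<xi> - synth N d \<xi>) = synth N (\<lambda>k. c k - d k)"
  by (simp add: synth_def fun_eq_iff sum_subtractf left_diff_distrib)

lemma synth_add: "synth N c \<xi> + synth N d \<xi> = synth N (\<lambda>k. c k + d k) \<xi>"
  by (simp add: synth_def sum.distrib distrib_right)

lemma synth_cmult: "a * synth N c \<xi> = synth N (\<lambda>k. a * c k) \<xi>"
  by (simp add: synth_def sum_distrib_left mult.assoc)

lemma L2_norm_synth: "(L2_norm (synth N c))\<^sup>2 = (\<Sum>k=1..N. (c k)\<^sup>2)"
  unfolding L2_norm_power2 L2_inner_synth_synth by (simp add: power2_eq_square)

lemma if_mult_delta: "(if P then 1 else 0) * x = (if P then x else (0::real))"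
  by simp

text \<open>Testing with unit coordinate vectors determines the representing element, as the
  definite description requires. Both \<open>PN\<close> and \<open>DeltaN\<close> become explicit
  through this.\<close>

lemma VN_dual_proj_eq:
  assumes lin: "\<And>c. l (synth N c) = (\<Sum>k=1..N. c k * a k)"
  shows "VN_dual_proj N l = synth N a"
  unfolding VN_dual_proj_def
proof (rule the_equality)
  show "synth N a \<in> VN N \<and> (\<forall>v\<in>VN N. L2_inner (synth N a) v = l v)"
    by (auto simp: VN_iff[of _ N] L2_inner_synth_synth lin mult.commute)
next
  fix w assume w: "w \<in> VN N \<and> (\<forall>v\<in>VN N. L2_inner w v = l v)"
  then obtain c where c: "w = synth N c" by (auto simp: VN_iff)
  have "c j = a j" if j: "j \<in> {1..N}" for j
  proof -
    let ?d = "\<lambda>k. if k = j then 1 else 0 :: real"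
    have "L2_inner w (synth N ?d) = l (synth N ?d)" using w by simp
    then have "(\<Sum>k=1..N. if k = j then c k else 0) = (\<Sum>k=1..N. if k = j then a k else 0)"
      unfolding c L2_inner_synth_synth lin by (simp only: if_mult_delta mult.commute[of _ "if _ then _ else _"])
    then show ?thesis using j by simp
  qed
  then show "w = synth N a" unfolding c by (rule synth_cong)
qed

lemma PN_eq: "u \<in> L2 \<Longrightarrow> PN N u = synth N (coef u)"
  unfolding PN_def by (rule VN_dual_proj_eq) (simp add: L2_inner_commute[of u] L2_inner_synth)

text \<open>The derivatives of the eigenfunctions are orthogonal with squared norms (k pi)^2, so the
  weak Laplacian is diagonal in coordinates.\<close>

lemma DeltaN_synth: "DeltaN N (synth N c) = synth N (\<lambda>k. - (real k * pi)\<^sup>2 * c k)"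
  unfolding DeltaN_def
proof (rule VN_dual_proj_eq)
  have cd: "continuous_on UNIV (deriv (eigenfun k))" for k
  proof -
    have "deriv (eigenfun k) = (\<lambda>\<xi>. sqrt 2 * (real k * pi) * cos (real k * pi * \<xi>))"
      unfolding eigenfun_def[abs_def]
      by (intro ext DERIV_imp_deriv) (auto intro!: derivative_eq_intros)
    then show ?thesis by (auto intro!: continuous_intros)
  qed
  have D: "deriv (synth N c) = (\<lambda>\<xi>. \<Sum>k=1..N. c k * deriv (eigenfun k) \<xi>)" for c
  proof (rule ext, rule DERIV_imp_deriv)
    fix \<xi>
    have "(eigenfun k has_real_derivative deriv (eigenfun k) \<xi>) (at \<xi>)" for k
      unfolding DERIV_deriv_iff_real_differentiable eigenfun_def[abs_def]
      by (intro differentiableI) (auto intro!: derivative_eq_intros simp: has_field_derivative_def[symmetric])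
    then show "(synth N c has_real_derivative (\<Sum>k=1..N. c k * deriv (eigenfun k) \<xi>)) (at \<xi>)"
      unfolding synth_def[abs_def] by (intro DERIV_sum DERIV_cmult)
  qed
  fix d
  have "L2_inner (deriv (synth N c)) (deriv (synth N d)) = (\<Sum>k=1..N. c k * (\<Sum>l=1..N. d l * L2_inner (deriv (eigenfun k)) (deriv (eigenfun l))))"
    unfolding D
    by (subst L2_inner_sum_left, blast intro: L2I_cont[OF cd], intro L2_sum L2_cmult L2I_cont[OF cd])
      (intro sum.cong refl arg_cong2[where f="(*)"], subst L2_inner_commute, subst L2_inner_sum_left,
        auto intro: L2I_cont[OF cd] simp: L2_inner_commute)
  also have "\<dots> = (\<Sum>k=1..N. c k * (\<Sum>l=1..N. if k = l then d l * (real k * pi)\<^sup>2 else 0))"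
    by (intro sum.cong refl arg_cong2[where f="(*)"]) (auto simp: deriv_eigenfun_orthogonal)
  also have "\<dots> = (\<Sum>k=1..N. c k * (d k * (real k * pi)\<^sup>2))"
    by (intro sum.cong refl) simp
  finally show "- L2_inner (deriv (synth N c)) (deriv (synth N d)) = (\<Sum>k=1..N. d k * (- (real k * pi)\<^sup>2 * c k))"
    by (simp add: sum_negf[symmetric] mult_ac)
qed

section \<open>Metric and Borel structure of V_N\<close>

text \<open>In coordinates the distance is Euclidean, so the metric laws come from
  \<open>L2_set\<close>. The openness criterion for \<open>mtopology\<close> rests on this.\<close>

lemma Metric_space_VN: "Metric_space (VN N) (\<lambda>u v. L2_norm (\<lambda>\<xi>. u \<xi> - v \<xi>))"
proof
  have d: "L2_norm (\<lambda>\<xi>. synth N c \<xi> - synth N d \<xi>) = L2_set (\<lambda>k. c k - d k) {1..N}" for c d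
    unfolding L2_norm_def synth_diff L2_inner_synth_synth L2_set_def by (simp add: power2_eq_square)
  fix u v w
  show "0 \<le> L2_norm (\<lambda>\<xi>. u \<xi> - v \<xi>)" by (simp add: L2_norm_def L2_inner_self_nonneg)
  show "L2_norm (\<lambda>\<xi>. u \<xi> - v \<xi>) = L2_norm (\<lambda>\<xi>. v \<xi> - u \<xi>)"
    unfolding L2_norm_def L2_inner_def by (intro arg_cong[where f=sqrt] Bochner_Integration.integral_cong) (auto simp: algebra_simps)
  assume "u \<in> VN N" "v \<in> VN N"
  then obtain c d where uv: "u = synth N c" "v = synth N d" by (auto simp: VN_iff)
  show "(L2_norm (\<lambda>\<xi>. u \<xi> - v \<xi>) = 0) = (u = v)"
  proof
    assume "L2_norm (\<lambda>\<xi>. u \<xi> - v \<xi>) = 0"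
    then have "\<forall>k\<in>{1..N}. c k - d k = 0" unfolding uv d by (simp add: L2_set_eq_0_iff)
    then show "u = v" unfolding uv by (intro synth_cong) auto
  qed (simp add: L2_norm_def L2_inner_def)
  assume "w \<in> VN N"
  then obtain e where w: "w = synth N e" by (auto simp: VN_iff)
  have "L2_set (\<lambda>k. c k - e k) {1..N} = L2_set (\<lambda>k. (c k - d k) + (d k - e k)) {1..N}" by simp
  also have "\<dots> \<le> L2_set (\<lambda>k. c k - d k) {1..N} + L2_set (\<lambda>k. d k - e k) {1..N}" by (rule L2_set_triangle_ineq)
  finally show "L2_norm (\<lambda>\<xi>. u \<xi> - w \<xi>) \<le> L2_norm (\<lambda>\<xi>. u \<xi> - v \<xi>) + L2_norm (\<lambda>\<xi>. v \<xi> - w \<xi>)"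
    unfolding uv w d .
qed

lemma space_VN_borel [simp]: "space (VN_borel N) = VN N"
proof -
  interpret Metric_space "VN N" "\<lambda>u v. L2_norm (\<lambda>\<xi>. u \<xi> - v \<xi>)" by (rule Metric_space_VN)
  show ?thesis unfolding VN_borel_def by (rule space_measure_of) (use openin_subset[of mtopology] in auto)
qed

lemma sets_VN_borel: "sets (VN_borel N) = sigma_sets (VN N)
     {U. openin (Metric_space.mtopology (VN N) (\<lambda>u v. L2_norm (\<lambda>\<xi>. u \<xi> - v \<xi>))) U}"
proof -
  interpret Metric_space "VN N" "\<lambda>u v. L2_norm (\<lambda>\<xi>. u \<xi> - v \<xi>)" by (rule Metric_space_VN)
  show ?thesis unfolding VN_borel_def by (rule sets_measure_of) (use openin_subset[of mtopology] in auto)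
qed

text \<open>Together with \<open>measurable_coef\<close> this gives measurable passage between V_N
  and its coordinates in both directions, so that laws and kernels can be handled in
  coordinates.\<close>

lemma measurable_synth [measurable]: "synth N \<in> borel \<rightarrow>\<^sub>M VN_borel N"
proof (rule measurable_sigma_sets[OF sets_VN_borel])
  interpret Metric_space "VN N" "\<lambda>u v. L2_norm (\<lambda>\<xi>. u \<xi> - v \<xi>)" by (rule Metric_space_VN)
  show "{U. openin mtopology U} \<subseteq> Pow (VN N)" using openin_subset[of mtopology] by auto
  show "synth N \<in> space borel \<rightarrow> VN N" by simp
  fix U assume "U \<in> {U. openin mtopology U}"
  then have U: "openin mtopology U" by simp
  have "open (synth N -` U)"
  proof (subst open_subopen, rule ballI)
    fix c assume "c \<in> synth N -` U"
    then obtain r where r: "r > 0" "mball (synth N c) r \<subseteq> U" using U unfolding openin_mtopology by auto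
    let ?B = "{d. L2_set (\<lambda>k. c k - d k) {1..N} < r}"
    have "open ?B" unfolding L2_set_def
      by (intro open_Collect_less continuous_intros) auto
    moreover have "c \<in> ?B" using r by (simp add: L2_set_def)
    moreover have "?B \<subseteq> synth N -` U"
    proof (rule subsetI)
      fix d assume "d \<in> ?B"
      then have "sqrt (L2_inner (\<lambda>\<xi>. synth N c \<xi> - synth N d \<xi>) (\<lambda>\<xi>. synth N c \<xi> - synth N d \<xi>)) < r"
        unfolding synth_diff L2_inner_synth_synth by (simp add: L2_set_def power2_eq_square)
      then have "synth N d \<in> mball (synth N c) r" unfolding in_mball by (simp add: L2_norm_def)
      then show "d \<in> synth N -` U" using r by auto
    qed
    ultimately show "\<exists>T. open T \<and> c \<in> T \<and> T \<subseteq> synth N -` U" by blast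
  qed
  then show "synth N -` U \<inter> space borel \<in> sets borel" by simp
qed

lemma measurable_coef_component: "(\<lambda>u. coef u k) \<in> borel_measurable (VN_borel N)"
proof (rule borel_measurableI)
  interpret Metric_space "VN N" "\<lambda>u v. L2_norm (\<lambda>\<xi>. u \<xi> - v \<xi>)" by (rule Metric_space_VN)
  fix T :: "real set" assume T: "open T"
  have "openin mtopology ((\<lambda>u. coef u k) -` T \<inter> VN N)"
    unfolding openin_mtopology
  proof safe
    fix u assume u: "coef u k \<in> T" "u \<in> VN N"
    then obtain r where r: "r > 0" "ball (coef u k) r \<subseteq> T" using T open_contains_ball by blast
    have "mball u r \<subseteq> (\<lambda>u. coef u k) -` T \<inter> VN N"
    proof
      fix v assume v: "v \<in> mball u r"
      then have vV: "v \<in> VN N" by simp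
      obtain c d where cd: "u = synth N c" "v = synth N d" using u vV by (auto simp: VN_iff)
      have "\<bar>coef u k - coef v k\<bar> \<le> L2_set (\<lambda>k. c k - d k) {1..N}"
        unfolding cd coef_synth using member_le_L2_set[of "{1..N}" k "\<lambda>k. \<bar>c k - d k\<bar>"]
        by (auto simp: L2_set_def intro!: sum_nonneg)
      also have "\<dots> = sqrt (L2_inner (\<lambda>\<xi>. u \<xi> - v \<xi>) (\<lambda>\<xi>. u \<xi> - v \<xi>))"
        unfolding cd synth_diff L2_inner_synth_synth by (simp add: L2_set_def power2_eq_square)
      also have "\<dots> < r" using v unfolding in_mball by (simp add: L2_norm_def)
      finally show "v \<in> (\<lambda>u. coef u k) -` T \<inter> VN N" using r vV by (auto simp: dist_real_def subset_eq)
    qed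
    then show "\<exists>r>0. mball u r \<subseteq> (\<lambda>u. coef u k) -` T \<inter> VN N" using r by blast
  qed
  then show "(\<lambda>u. coef u k) -` T \<inter> space (VN_borel N) \<in> sets (VN_borel N)"
    by (auto simp: sets_VN_borel)
qed

lemma measurable_coef [measurable]: "coef \<in> VN_borel N \<rightarrow>\<^sub>M borel"
  by (rule measurable_coordinatewise_then_product) (rule measurable_coef_component)

section \<open>Bessel and Parseval identities\<close>

lemma L2_bessel:
  assumes b: "orthonormal_basis b" and h: "h \<in> L2"
  shows "(L2_norm (\<lambda>\<xi>. h \<xi> - (\<Sum>k<n. L2_inner h (b k) * b k \<xi>)))\<^sup>2 = L2_inner h h - (\<Sum>k<n. (L2_inner h (b k))\<^sup>2)"
proof -
  let ?s = "\<lambda>\<xi>. \<Sum>k<n. L2_inner h (b k) * b k \<xi>"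
  have bk: "b k \<in> L2" for k using b by (simp add: orthonormal_basis_def)
  have s: "?s \<in> L2" by (intro L2_sum L2_cmult bk)
  have sb: "L2_inner ?s (b k) = L2_inner h (b k)" if "k < n" for k
    using b that by (subst L2_inner_sum_left) (auto simp: bk orthonormal_basis_def if_distrib[of "\<lambda>x. _ * x"] cong: if_cong)
  have hs: "L2_inner ?s h = (\<Sum>k<n. (L2_inner h (b k))\<^sup>2)"
    by (subst L2_inner_sum_left) (auto simp: bk h L2_inner_commute[of "b _" h] power2_eq_square)
  have ss: "L2_inner ?s ?s = (\<Sum>k<n. (L2_inner h (b k))\<^sup>2)"
    by (subst L2_inner_sum_left) (auto simp: bk s L2_inner_commute[of "b _" ?s] sb power2_eq_square)
  have "(L2_norm (\<lambda>\<xi>. h \<xi> - ?s \<xi>))\<^sup>2 = L2_inner h (\<lambda>\<xi>. h \<xi> - ?s \<xi>) - L2_inner ?s (\<lambda>\<xi>. h \<xi> - ?s \<xi>)"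
    unfolding L2_norm_power2 by (rule L2_inner_diff_left) (auto intro: h s L2_diff)
  also have "L2_inner h (\<lambda>\<xi>. h \<xi> - ?s \<xi>) = L2_inner h h - L2_inner ?s h"
    using L2_inner_diff_left[OF h s h] by (simp only: L2_inner_commute[of h "\<lambda>\<xi>. h \<xi> - ?s \<xi>"])
  also have "L2_inner ?s (\<lambda>\<xi>. h \<xi> - ?s \<xi>) = L2_inner ?s h - L2_inner ?s ?s"
    using L2_inner_diff_left[OF h s s]
    by (simp only: L2_inner_commute[of ?s "\<lambda>\<xi>. h \<xi> - ?s \<xi>"] L2_inner_commute[of h ?s])
  finally show ?thesis using hs ss by simp
qed

text \<open>The Bessel remainder is the squared distance to the partial sums, which tends to 0 for
  an orthonormal basis.\<close>

lemma L2_parseval: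
  assumes b: "orthonormal_basis b" and h: "h \<in> L2"
  shows "(\<lambda>k. (L2_inner h (b k))\<^sup>2) sums L2_inner h h"
proof -
  have "(\<lambda>n. (L2_norm (\<lambda>\<xi>. h \<xi> - (\<Sum>k<n. L2_inner h (b k) * b k \<xi>)))\<^sup>2) \<longlonglongrightarrow> 0\<^sup>2"
    using b h by (intro tendsto_power) (auto simp: orthonormal_basis_def)
  then have "(\<lambda>n. L2_inner h h - (L2_inner h h - (\<Sum>k<n. (L2_inner h (b k))\<^sup>2))) \<longlonglongrightarrow> L2_inner h h - 0"
    unfolding L2_bessel[OF assms] by (intro tendsto_diff tendsto_const) simp
  then show ?thesis by (simp add: sums_def)
qed

subsection \<open>The implicit drift step\<close>

text \<open>Tychonoff for intervals on \<open>I\<close> and singletons {0} elsewhere. Fixing the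
  remaining coordinates is what makes the box compact in the infinite product.\<close>

lemma compact_box:
  "compact {c :: nat \<Rightarrow> real. \<forall>k. if k \<in> I then \<bar>c k\<bar> \<le> R else c k = 0}"
proof -
  let ?B = "PiE UNIV (\<lambda>k. if k \<in> I then {-R..R} else {0::real})"
  have "(x \<in> (if P then {-R..R} else {0})) = (if P then \<bar>x\<bar> \<le> R else x = 0)" for x P by auto
  then have "{c :: nat \<Rightarrow> real. \<forall>k. if k \<in> I then \<bar>c k\<bar> \<le> R else c k = 0} = ?B"
    by (auto simp: PiE_iff)
  moreover have "compactin (product_topology (\<lambda>_::nat. euclidean) UNIV) ?B"
    by (subst compactin_PiE) (auto simp: compactin_euclidean_iff)
  ultimately show ?thesis by (simp only: euclidean_product_topology compactin_euclidean_iff)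
qed

text \<open>Minimise \<Psi> minus the linear functional of \<open>z\<close> over a compact box.
  Coercivity puts the minimiser strictly inside, where each partial derivative vanishes. This solves
  the implicit step and also inverts the Gram form of the noise.\<close>

lemma coercive_gradient_surj:
  fixes \<Psi> :: "(nat \<Rightarrow> real) \<Rightarrow> real" and G :: "(nat \<Rightarrow> real) \<Rightarrow> nat \<Rightarrow> real"
  assumes cont: "continuous_on UNIV \<Psi>" and \<gamma>: "\<gamma> > 0" and I: "finite I"
    and \<Psi>0: "\<Psi> (\<lambda>_. 0) = 0"
    and coercive: "\<And>c. \<gamma> * (\<Sum>k\<in>I. (c k)\<^sup>2) \<le> \<Psi> c"
    and deriv: "\<And>c k. k \<in> I \<Longrightarrow> ((\<lambda>t. \<Psi> (c(k := t))) has_real_derivative G c k) (at (c k))"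
  shows "\<exists>c. (\<forall>k. k \<notin> I \<longrightarrow> c k = 0) \<and> (\<forall>k\<in>I. G c k = z k)"
proof -
  \<comment> \<open>At the minimiser \<gamma>|c|^2 <= z.c <= |z|^2/(2\<gamma>) + \<gamma>|c|^2/2,
    hence |c|^2 <= \<open>Q\<close>; and Q < (Q + 1)^2 keeps every coordinate strictly below
    \<open>R\<close>.\<close>
  define Q where "Q = (\<Sum>k\<in>I. (z k)\<^sup>2) / \<gamma>\<^sup>2"
  define R where "R = Q + 1"
  have Q0: "Q \<ge> 0" by (auto simp: Q_def intro!: divide_nonneg_nonneg sum_nonneg)
  define B where "B = {c :: nat \<Rightarrow> real. \<forall>k. if k \<in> I then \<bar>c k\<bar> \<le> R else c k = 0}"
  define \<Phi> where "\<Phi> c = \<Psi> c - (\<Sum>k\<in>I. z k * c k)" for c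
  have "compact B" unfolding B_def by (rule compact_box)
  moreover have zB: "(\<lambda>_. 0) \<in> B" using Q0 by (auto simp: B_def R_def)
  moreover have "continuous_on B \<Phi>"
    unfolding \<Phi>_def by (intro continuous_intros continuous_on_subset[OF cont] continuous_on_subset[OF continuous_on_product_coordinates]) auto
  ultimately obtain c where c: "c \<in> B" and min: "\<And>d. d \<in> B \<Longrightarrow> \<Phi> c \<le> \<Phi> d"
    using continuous_attains_inf[of B \<Phi>] by blast
  have "\<Phi> c \<le> 0" using min[OF zB] by (simp add: \<Phi>_def \<Psi>0)
  then have "\<gamma> * (\<Sum>k\<in>I. (c k)\<^sup>2) \<le> (\<Sum>k\<in>I. z k * c k)" using coercive[of c] by (simp add: \<Phi>_def)
  also have "\<dots> \<le> (\<Sum>k\<in>I. (z k)\<^sup>2 / (2 * \<gamma>) + \<gamma> / 2 * (c k)\<^sup>2)"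
  proof (intro sum_mono)
    fix k
    have "0 \<le> (z k - \<gamma> * c k)\<^sup>2 / (2 * \<gamma>)" using \<gamma> by simp
    also have "\<dots> = (z k)\<^sup>2 / (2 * \<gamma>) + \<gamma> / 2 * (c k)\<^sup>2 - z k * c k"
      using \<gamma> by (simp add: power2_diff field_simps power2_eq_square)
    finally show "z k * c k \<le> (z k)\<^sup>2 / (2 * \<gamma>) + \<gamma> / 2 * (c k)\<^sup>2" by simp
  qed
  also have "\<dots> = (\<Sum>k\<in>I. (z k)\<^sup>2) / (2 * \<gamma>) + \<gamma> / 2 * (\<Sum>k\<in>I. (c k)\<^sup>2)"
    by (simp add: sum.distrib sum_distrib_left sum_divide_distrib)
  finally have "\<gamma> / 2 * (\<Sum>k\<in>I. (c k)\<^sup>2) \<le> (\<Sum>k\<in>I. (z k)\<^sup>2) / (2 * \<gamma>)" by simp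
  then have cQ: "(\<Sum>k\<in>I. (c k)\<^sup>2) \<le> Q" using \<gamma> by (simp add: Q_def field_simps power2_eq_square)
  have "G c k = z k" if k: "k \<in> I" for k
  proof -
    have "(c k)\<^sup>2 \<le> (\<Sum>k\<in>I. (c k)\<^sup>2)" using k I by (intro member_le_sum) auto
    also have "\<dots> < (Q + 1)\<^sup>2" 
      unfolding power2_sum power_one mult_1_right using cQ Q0 zero_le_power2[of Q] by linarith
    finally have ck: "\<bar>c k\<bar> < R"
      using Q0 power2_less_imp_less[of "\<bar>c k\<bar>" "Q + 1"] by (simp add: R_def)
    have "((\<lambda>t. \<Phi> (c(k := t))) has_real_derivative G c k - z k) (at (c k))"
    proof -
      have "(\<Sum>j\<in>I. z j * (c(k := t)) j) = z k * t + (\<Sum>j\<in>I-{k}. z j * c j)" for t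
        using k I by (subst sum.remove[of _ k]) (auto intro!: sum.cong)
      then show ?thesis unfolding \<Phi>_def using deriv[OF k, of c] by (auto intro!: derivative_eq_intros)
    qed
    moreover have "\<Phi> (c(k := c k)) \<le> \<Phi> (c(k := y))" if y: "\<bar>c k - y\<bar> < R - \<bar>c k\<bar>" for y
    proof -
      have "c(k := y) \<in> B" using c y k unfolding B_def by (auto simp: fun_upd_def)
      then show ?thesis using min by simp
    qed
    ultimately have "G c k - z k = 0"
      using ck by (intro DERIV_local_min[where d="R - \<bar>c k\<bar>"]) auto
    then show ?thesis by simp
  qed
  moreover have "c k = 0" if "k \<notin> I" for k using c that unfolding B_def by auto
  ultimately show ?thesis by blast
qed

lemma continuous_synth_arg: "continuous_on UNIV (\<lambda>p. synth N (fst p) (snd p))"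
proof -
  have *: "continuous_on UNIV (\<lambda>p::(nat \<Rightarrow> real) \<times> real. fst p k)" for k
    using continuous_on_compose2[OF continuous_on_product_coordinates continuous_on_fst[OF continuous_on_id]] by auto
  show ?thesis unfolding synth_def by (intro continuous_intros *)
qed

lemma synth_upd: "k \<in> {1..N} \<Longrightarrow> synth N (c(k := t)) \<xi> = synth N c \<xi> + (t - c k) * eigenfun k \<xi>"
  unfolding synth_def
  by (subst (1 2) sum.remove[of _ k]) (auto intro!: sum.cong simp: algebra_simps)

section \<open>The implicit operator: monotonicity, growth and inverse\<close>

locale implicit_step =
  fixes f :: "real \<Rightarrow> real" and \<epsilon> \<tau> :: real and N :: nat
  assumes eps: "\<epsilon> > 0" and f: "\<And>\<xi>. f \<xi> = (1 / \<epsilon>\<^sup>2) * (\<xi> - \<xi> ^ 3)"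
    and tau: "0 < \<tau>" and step: "(1 / \<epsilon>\<^sup>2 - pi\<^sup>2) * \<tau> < 1"
begin

definition J :: "(nat \<Rightarrow> real) \<Rightarrow> nat \<Rightarrow> real" where
  "J c k = c k + \<tau> * (real k * pi)\<^sup>2 * c k - \<tau> * coef (\<lambda>\<xi>. f (synth N c \<xi>)) k"

text \<open>The monotonicity constant of the implicit operator; the step size condition says exactly
  that it is positive.\<close>

definition gap :: real where "gap = 1 + \<tau> * pi\<^sup>2 - \<tau> / \<epsilon>\<^sup>2"

lemma gap_pos: "gap > 0"
  using step by (simp add: gap_def left_diff_distrib field_simps)

lemma cont_f: "continuous_on S u \<Longrightarrow> continuous_on S (\<lambda>x. f (u x))"
  unfolding f by (intro continuous_intros)

lemma f_synth_L2: "(\<lambda>\<xi>. f (synth N c \<xi>)) \<in> L2"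
  by (intro L2I_cont cont_f continuous_intros)

lemma sum_coef_f: "(\<Sum>k=1..N. coef (\<lambda>\<xi>. f (synth N c \<xi>)) k * d k) = (\<integral>\<xi>. f (synth N c \<xi>) * synth N d \<xi> \<partial>unit_lebesgue)"
  using L2_inner_synth[OF f_synth_L2, of N d c] by (simp add: L2_inner_def mult.commute)

text \<open>The Poincare inequality on V_N, through which the first eigenvalue pi^2 enters the step
  size condition.\<close>

lemma dirichlet_energy: "pi\<^sup>2 * (\<Sum>k=1..N. (d k)\<^sup>2) \<le> (\<Sum>k=1..N. (real k * pi)\<^sup>2 * (d k)\<^sup>2)"
  unfolding sum_distrib_left
proof (intro sum_mono mult_right_mono)
  fix k assume "k \<in> {1..N}"
  then have "1 * pi \<le> real k * pi" by (intro mult_right_mono) auto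
  then show "pi\<^sup>2 \<le> (real k * pi)\<^sup>2" by (intro power_mono) auto
qed simp

lemma integrable_cont: "continuous_on UNIV u \<Longrightarrow> integrable unit_lebesgue (u :: real \<Rightarrow> real)"
  by (rule cont_unit(2))

lemma sum_power2_synth: "(\<Sum>k=1..N. (d k)\<^sup>2) = (\<integral>\<xi>. (synth N d \<xi>)\<^sup>2 \<partial>unit_lebesgue)"
  using L2_inner_synth_synth[of N d d] by (simp add: L2_inner_def power2_eq_square)

text \<open>\<open>f\<close> is one-sided Lipschitz with constant 1/\<epsilon>^2 because the cube is
  increasing, and the Laplacian contributes at least pi^2; \<open>gap\<close> collects the
  two.\<close>

lemma J_monotone: "gap * (\<Sum>k=1..N. (c k - d k)\<^sup>2) \<le> (\<Sum>k=1..N. (J c k - J d k) * (c k - d k))"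
proof -
  let ?e = "\<lambda>k. c k - d k"
  have "(\<Sum>k=1..N. (coef (\<lambda>\<xi>. f (synth N c \<xi>)) k - coef (\<lambda>\<xi>. f (synth N d \<xi>)) k) * ?e k)
      = (\<integral>\<xi>. f (synth N c \<xi>) * synth N ?e \<xi> - f (synth N d \<xi>) * synth N ?e \<xi> \<partial>unit_lebesgue)"
    unfolding left_diff_distrib[of _ _ "?e _"] sum_subtractf sum_coef_f
    by (subst Bochner_Integration.integral_diff) (auto intro!: integrable_cont continuous_intros cont_f)
  also have "\<dots> \<le> (\<integral>\<xi>. (1 / \<epsilon>\<^sup>2) * (synth N ?e \<xi>)\<^sup>2 \<partial>unit_lebesgue)"
  proof (intro integral_mono integrable_cont continuous_intros cont_f)
    fix \<xi>
    let ?a = "synth N c \<xi>" and ?b = "synth N d \<xi>"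
    have e: "synth N ?e \<xi> = ?a - ?b" using synth_diff[of N c d] by (metis)
    \<comment> \<open>The factor a^2 + a b + b^2 of a^3 - b^3 is written as a sum of squares, which
      gives the cubic contribution its sign.\<close>
    have "(?a - ?a ^ 3 - (?b - ?b ^ 3)) * (?a - ?b) = (?a - ?b)\<^sup>2 - (?a - ?b)\<^sup>2 * ((?a + ?b / 2)\<^sup>2 + 3 / 4 * ?b\<^sup>2)"
      by (simp add: power2_eq_square power3_eq_cube algebra_simps)
    also have "\<dots> \<le> (?a - ?b)\<^sup>2" by simp
    finally have "(1 / \<epsilon>\<^sup>2) * ((?a - ?a ^ 3 - (?b - ?b ^ 3)) * (?a - ?b)) \<le> (1 / \<epsilon>\<^sup>2) * (?a - ?b)\<^sup>2"
      by (intro mult_left_mono) auto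
    then show "f ?a * synth N ?e \<xi> - f ?b * synth N ?e \<xi> \<le> (1 / \<epsilon>\<^sup>2) * (synth N ?e \<xi>)\<^sup>2"
      unfolding e f by (simp only: left_diff_distrib right_diff_distrib mult.assoc)
  qed
  also have "\<dots> = (1 / \<epsilon>\<^sup>2) * (\<Sum>k=1..N. (?e k)\<^sup>2)"
    unfolding sum_power2_synth by simp
  finally have F: "(\<Sum>k=1..N. (coef (\<lambda>\<xi>. f (synth N c \<xi>)) k - coef (\<lambda>\<xi>. f (synth N d \<xi>)) k) * ?e k)
      \<le> (1 / \<epsilon>\<^sup>2) * (\<Sum>k=1..N. (?e k)\<^sup>2)" .
  have "(\<Sum>k=1..N. (J c k - J d k) * ?e k) = (\<Sum>k=1..N. (?e k)\<^sup>2) + \<tau> * (\<Sum>k=1..N. (real k * pi)\<^sup>2 * (?e k)\<^sup>2)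
      - \<tau> * (\<Sum>k=1..N. (coef (\<lambda>\<xi>. f (synth N c \<xi>)) k - coef (\<lambda>\<xi>. f (synth N d \<xi>)) k) * ?e k)"
    unfolding sum_distrib_left sum.distrib[symmetric] sum_subtractf[symmetric]
    by (intro sum.cong refl) (simp add: J_def power2_eq_square algebra_simps)
  moreover have "\<tau> * (pi\<^sup>2 * (\<Sum>k=1..N. (?e k)\<^sup>2)) \<le> \<tau> * (\<Sum>k=1..N. (real k * pi)\<^sup>2 * (?e k)\<^sup>2)"
    using dirichlet_energy tau by (intro mult_left_mono) auto
  moreover have "\<tau> * (\<Sum>k=1..N. (coef (\<lambda>\<xi>. f (synth N c \<xi>)) k - coef (\<lambda>\<xi>. f (synth N d \<xi>)) k) * ?e k)
      \<le> \<tau> * ((1 / \<epsilon>\<^sup>2) * (\<Sum>k=1..N. (?e k)\<^sup>2))"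
    using F tau by (intro mult_left_mono) auto
  ultimately show ?thesis by (simp add: gap_def algebra_simps)
qed

text \<open>The maximum of (1 + \<theta>) y - \<theta> y^2 over real y for \<theta> =
  \<tau>/\<epsilon>^2; in \<open>J_coercive\<close> the variable y is the square of a function
  value.\<close>

definition drift_const :: real where "drift_const = (1 + \<tau> / \<epsilon>\<^sup>2)\<^sup>2 / (4 * (\<tau> / \<epsilon>\<^sup>2))"

text \<open>The Dirichlet term is dropped. Pointwise, s^2 - \<tau> f(s) s = (1 - \<theta>) s^2 +
  \<theta> s^4 with \<theta> = \<tau>/\<epsilon>^2, and the quartic term lifts this above 2 s^2 up
  to a constant, which integrates to itself on an interval of length 1.\<close>

lemma J_coercive: "2 * (\<Sum>k=1..N. (c k)\<^sup>2) - drift_const \<le> (\<Sum>k=1..N. J c k * c k)"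
proof -
  let ?s = "synth N c" and ?\<theta> = "\<tau> / \<epsilon>\<^sup>2"
  have \<theta>: "?\<theta> > 0" using tau eps by simp
  have one: "measure unit_lebesgue {0<..<1} = 1"
    using prob_space.prob_space[OF prob_space_unit_lebesgue] by (simp add: space_restrict_space)
  have "2 * (\<Sum>k=1..N. (c k)\<^sup>2) - drift_const = (\<integral>\<xi>. 2 * (?s \<xi>)\<^sup>2 - drift_const \<partial>unit_lebesgue)"
    unfolding sum_power2_synth
    by (subst Bochner_Integration.integral_diff) (auto intro!: integrable_cont continuous_intros simp: one space_restrict_space)
  also have "\<dots> \<le> (\<integral>\<xi>. (?s \<xi>)\<^sup>2 - \<tau> * (f (?s \<xi>) * ?s \<xi>) \<partial>unit_lebesgue)"
  proof (intro integral_mono integrable_cont continuous_intros cont_f)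
    fix \<xi>
    have sq: "(2 * t * x - (1 + t))\<^sup>2 / (4 * t) = t * x\<^sup>2 - (1 + t) * x + (1 + t)\<^sup>2 / (4 * t)" if "t > 0" for t x :: real
      using that by (simp add: field_simps power2_eq_square)
    have "0 \<le> (2 * ?\<theta> * (?s \<xi>)\<^sup>2 - (1 + ?\<theta>))\<^sup>2 / (4 * ?\<theta>)" using \<theta> by (intro divide_nonneg_pos) auto
    also have "\<dots> = ?\<theta> * ((?s \<xi>)\<^sup>2)\<^sup>2 - (1 + ?\<theta>) * (?s \<xi>)\<^sup>2 + drift_const"
      unfolding drift_const_def by (rule sq[OF \<theta>])
    finally show "2 * (?s \<xi>)\<^sup>2 - drift_const \<le> (?s \<xi>)\<^sup>2 - \<tau> * (f (?s \<xi>) * ?s \<xi>)"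
      unfolding f by (simp add: algebra_simps power2_eq_square power3_eq_cube power4_eq_xxxx)
  qed
  also have "\<dots> = (\<Sum>k=1..N. (c k)\<^sup>2) - \<tau> * (\<Sum>k=1..N. coef (\<lambda>\<xi>. f (?s \<xi>)) k * c k)"
    unfolding sum_power2_synth sum_coef_f
    by (subst Bochner_Integration.integral_diff) (auto intro!: integrable_cont continuous_intros cont_f)
  also have "\<dots> \<le> (\<Sum>k=1..N. J c k * c k)"
  proof -
    have "(\<Sum>k=1..N. J c k * c k) = (\<Sum>k=1..N. (c k)\<^sup>2) + \<tau> * (\<Sum>k=1..N. (real k * pi)\<^sup>2 * (c k)\<^sup>2)
      - \<tau> * (\<Sum>k=1..N. coef (\<lambda>\<xi>. f (?s \<xi>)) k * c k)"
      unfolding sum_distrib_left sum.distrib[symmetric] sum_subtractf[symmetric]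
      by (intro sum.cong refl) (simp add: J_def power2_eq_square algebra_simps)
    moreover have "0 \<le> \<tau> * (\<Sum>k=1..N. (real k * pi)\<^sup>2 * (c k)\<^sup>2)"
      using tau by (intro mult_nonneg_nonneg sum_nonneg) auto
    ultimately show ?thesis by simp
  qed
  finally show ?thesis .
qed

text \<open>\<open>J\<close> is the gradient of the coercive discrete Allen--Cahn energy.\<close>

lemma J_surj: "\<exists>c. (\<forall>k. k \<notin> {1..N} \<longrightarrow> c k = 0) \<and> (\<forall>k\<in>{1..N}. J c k = z k)"
proof (rule coercive_gradient_surj)
  \<comment> \<open>\<open>?p\<close> is the primitive of \<open>f\<close> that vanishes at 0. Its
    quartic part enters \<Psi> with a favourable sign and is discarded in the coercivity
    bound.\<close>
  let ?p = "\<lambda>x. (1 / \<epsilon>\<^sup>2) * (x\<^sup>2 / 2 - x ^ 4 / 4) :: real"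
  define \<Psi> where "\<Psi> c = (\<Sum>k=1..N. (1 + \<tau> * (real k * pi)\<^sup>2) / 2 * (c k)\<^sup>2) - \<tau> * integral {0..1} (\<lambda>\<xi>. ?p (synth N c \<xi>))" for c
  have cp: "continuous_on UNIV (\<lambda>\<xi>. ?p (synth N c \<xi>))" for c
    by (intro continuous_intros) auto
  have ip: "integral {0..1} (\<lambda>\<xi>. ?p (synth N c \<xi>)) = (\<integral>\<xi>. ?p (synth N c \<xi>) \<partial>unit_lebesgue)" for c
    by (rule cont_unit(3)[OF cp, symmetric])
  have "continuous_on UNIV (\<lambda>c. integral (cbox 0 1) (\<lambda>\<xi>. ?p (synth N c \<xi>)))"
    by (rule integral_continuous_on_param)
      (use eps in \<open>auto simp: split_beta intro!: continuous_intros continuous_on_subset[OF continuous_synth_arg]\<close>)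
  then show "continuous_on UNIV \<Psi>"
    unfolding \<Psi>_def by (intro continuous_intros continuous_on_product_coordinates) (simp add: cbox_interval)
  show "gap / 2 > 0" using gap_pos by simp
  show "\<Psi> (\<lambda>_. 0) = 0" by (simp add: \<Psi>_def synth_def)
  show "gap / 2 * (\<Sum>k\<in>{1..N}. (c k)\<^sup>2) \<le> \<Psi> c" for c
  proof -
    have "integral {0..1} (\<lambda>\<xi>. ?p (synth N c \<xi>)) \<le> (\<integral>\<xi>. (1 / \<epsilon>\<^sup>2) / 2 * (synth N c \<xi>)\<^sup>2 \<partial>unit_lebesgue)"
      unfolding ip
    proof (intro integral_mono integrable_cont cp)
      show "continuous_on UNIV (\<lambda>\<xi>. (1 / \<epsilon>\<^sup>2) / 2 * (synth N c \<xi>)\<^sup>2)" by (intro continuous_intros)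
      have "?p x \<le> (1 / \<epsilon>\<^sup>2) * (x\<^sup>2 / 2)" for x by (intro mult_left_mono) auto
      then show "?p (synth N c \<xi>) \<le> (1 / \<epsilon>\<^sup>2) / 2 * (synth N c \<xi>)\<^sup>2" for \<xi> by (simp add: field_simps)
    qed
    also have "\<dots> = (1 / \<epsilon>\<^sup>2) / 2 * (\<Sum>k=1..N. (c k)\<^sup>2)" unfolding sum_power2_synth by simp
    finally have "\<tau> * integral {0..1} (\<lambda>\<xi>. ?p (synth N c \<xi>)) \<le> \<tau> * ((1 / \<epsilon>\<^sup>2) / 2 * (\<Sum>k=1..N. (c k)\<^sup>2))"
      using tau by (intro mult_left_mono) auto
    moreover have "(\<Sum>k=1..N. (1 + \<tau> * (real k * pi)\<^sup>2) / 2 * (c k)\<^sup>2) = (\<Sum>k=1..N. (c k)\<^sup>2) / 2 + \<tau> / 2 * (\<Sum>k=1..N. (real k * pi)\<^sup>2 * (c k)\<^sup>2)"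
      unfolding sum_distrib_left sum_divide_distrib sum.distrib[symmetric] by (intro sum.cong refl) (simp add: field_simps)
    moreover have "\<tau> / 2 * (pi\<^sup>2 * (\<Sum>k=1..N. (c k)\<^sup>2)) \<le> \<tau> / 2 * (\<Sum>k=1..N. (real k * pi)\<^sup>2 * (c k)\<^sup>2)"
      using dirichlet_energy tau by (intro mult_left_mono) auto
    ultimately show ?thesis by (simp add: \<Psi>_def gap_def field_simps)
  qed
  show "((\<lambda>t. \<Psi> (c(k := t))) has_real_derivative J c k) (at (c k))" if k: "k \<in> {1..N}" for c k
  proof -
    let ?s = "synth N c" and ?e = "eigenfun k"
    \<comment> \<open>Along one coordinate the integrand is a polynomial of degree 4 in
      \<open>t - c k\<close>, and \<open>u2\<close>, \<open>u3\<close>, \<open>u4\<close> are its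
      higher coefficients. The derivative is read off this expansion, without differentiation under
      the integral.\<close>
    define u2 where "u2 \<xi> = (1 / \<epsilon>\<^sup>2) * ((?e \<xi>)\<^sup>2 / 2 - 3 / 2 * (?s \<xi>)\<^sup>2 * (?e \<xi>)\<^sup>2)" for \<xi>
    define u3 where "u3 \<xi> = (1 / \<epsilon>\<^sup>2) * (- (?s \<xi>) * (?e \<xi>) ^ 3)" for \<xi>
    define u4 where "u4 \<xi> = (1 / \<epsilon>\<^sup>2) * (- ((?e \<xi>) ^ 4) / 4)" for \<xi>
    define A where "A u = (\<integral>\<xi>. u \<xi> \<partial>unit_lebesgue)" for u :: "real \<Rightarrow> real"
    have P: "integral {0..1} (\<lambda>\<xi>. ?p (synth N (c(k := t)) \<xi>)) = A (\<lambda>\<xi>. ?p (?s \<xi>)) + (t - c k) * A (\<lambda>\<xi>. f (?s \<xi>) * ?e \<xi>)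
        + (t - c k)\<^sup>2 * A u2 + (t - c k) ^ 3 * A u3 + (t - c k) ^ 4 * A u4" for t
    proof -
      have "?p (synth N (c(k := t)) \<xi>) = ?p (?s \<xi>) + (t - c k) * (f (?s \<xi>) * ?e \<xi>)
         + (t - c k)\<^sup>2 * u2 \<xi> + (t - c k) ^ 3 * u3 \<xi> + (t - c k) ^ 4 * u4 \<xi>" for \<xi>
      proof -
        have "r * ((s + h * e)\<^sup>2 / 2 - (s + h * e) ^ 4 / 4) = r * (s\<^sup>2 / 2 - s ^ 4 / 4) + h * (r * (s - s ^ 3) * e)
            + h\<^sup>2 * (r * (e\<^sup>2 / 2 - 3 / 2 * s\<^sup>2 * e\<^sup>2)) + h ^ 3 * (r * (- s * e ^ 3)) + h ^ 4 * (r * (- (e ^ 4) / 4))" for r s h e :: real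
          by (simp add: power2_eq_square power3_eq_cube power4_eq_xxxx field_simps)
        from this[of "1 / \<epsilon>\<^sup>2" "?s \<xi>" "t - c k" "?e \<xi>"] show ?thesis
          unfolding synth_upd[OF k] f u2_def u3_def u4_def .
      qed
      moreover have "continuous_on UNIV u2" "continuous_on UNIV u3" "continuous_on UNIV u4"
        "continuous_on UNIV (\<lambda>\<xi>. f (?s \<xi>) * ?e \<xi>)"
        unfolding u2_def u3_def u4_def using eps by (auto intro!: continuous_intros cont_f)
      ultimately show ?thesis unfolding ip A_def using cp[of c]
        by (simp only: Bochner_Integration.integral_add Bochner_Integration.integral_mult_right_zero
          Bochner_Integration.integrable_add Bochner_Integration.integrable_mult_right integrable_cont)
    qed
    have q: "(\<Sum>j=1..N. (1 + \<tau> * (real j * pi)\<^sup>2) / 2 * ((c(k := t)) j)\<^sup>2)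
       = (1 + \<tau> * (real k * pi)\<^sup>2) / 2 * t\<^sup>2 + (\<Sum>j\<in>{1..N}-{k}. (1 + \<tau> * (real j * pi)\<^sup>2) / 2 * (c j)\<^sup>2)" for t
      using k by (subst sum.remove[of _ k]) (auto intro!: sum.cong)
    have A1: "A (\<lambda>\<xi>. f (?s \<xi>) * ?e \<xi>) = coef (\<lambda>\<xi>. f (?s \<xi>)) k" by (simp add: A_def coef_def L2_inner_def)
    show ?thesis unfolding \<Psi>_def P q A1
      by (auto intro!: derivative_eq_intros simp: J_def field_simps)
  qed
qed auto

text \<open>Normalised to vanish outside 1 to N; by \<open>J_monotone\<close> the choice operator
  then selects the only solution.\<close>

definition Jinv :: "(nat \<Rightarrow> real) \<Rightarrow> nat \<Rightarrow> real" where
  "Jinv z = (SOME c. (\<forall>k. k \<notin> {1..N} \<longrightarrow> c k = 0) \<and> (\<forall>k\<in>{1..N}. J c k = z k))"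

lemma Jinv: "k \<notin> {1..N} \<Longrightarrow> Jinv z k = 0" "k \<in> {1..N} \<Longrightarrow> J (Jinv z) k = z k"
  using someI_ex[OF J_surj[of z], folded Jinv_def] by auto

text \<open>Monotonicity followed by Young's inequality, weighted with \<open>gap\<close> so that
  half of the left side absorbs the quadratic term.\<close>

lemma Jinv_lipschitz: "gap\<^sup>2 * (\<Sum>k=1..N. (Jinv z k - Jinv z' k)\<^sup>2) \<le> (\<Sum>k=1..N. (z k - z' k)\<^sup>2)"
proof -
  let ?c = "Jinv z" and ?d = "Jinv z'"
  have "2 * gap * (gap * (\<Sum>k=1..N. (?c k - ?d k)\<^sup>2)) \<le> 2 * gap * (\<Sum>k=1..N. (J ?c k - J ?d k) * (?c k - ?d k))"
    using J_monotone gap_pos by (intro mult_left_mono) auto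
  also have "\<dots> = (\<Sum>k=1..N. 2 * gap * ((z k - z' k) * (?c k - ?d k)))"
    unfolding sum_distrib_left by (intro sum.cong refl) (simp add: Jinv)
  also have "\<dots> \<le> (\<Sum>k=1..N. (z k - z' k)\<^sup>2 + gap\<^sup>2 * (?c k - ?d k)\<^sup>2)"
  proof (intro sum_mono)
    fix k
    have "0 \<le> ((z k - z' k) - gap * (?c k - ?d k))\<^sup>2" by simp
    then show "2 * gap * ((z k - z' k) * (?c k - ?d k)) \<le> (z k - z' k)\<^sup>2 + gap\<^sup>2 * (?c k - ?d k)\<^sup>2"
      unfolding power2_diff[of "z k - z' k"] power_mult_distrib by (simp only: mult_ac)
  qed
  also have "\<dots> = (\<Sum>k=1..N. (z k - z' k)\<^sup>2) + gap\<^sup>2 * (\<Sum>k=1..N. (?c k - ?d k)\<^sup>2)"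
    by (simp add: sum.distrib sum_distrib_left)
  finally show ?thesis by (simp add: power2_eq_square)
qed

lemma Jinv_cong:
  assumes "\<And>k. k \<in> {1..N} \<Longrightarrow> z k = z' k" shows "Jinv z = Jinv z'"
proof
  fix k
  have "gap\<^sup>2 * (\<Sum>k=1..N. (Jinv z k - Jinv z' k)\<^sup>2) \<le> 0"
    using Jinv_lipschitz[of z z'] assms by simp
  then have "(\<Sum>k=1..N. (Jinv z k - Jinv z' k)\<^sup>2) \<le> 0" using gap_pos by (simp add: mult_le_0_iff)
  then have "(\<Sum>k=1..N. (Jinv z k - Jinv z' k)\<^sup>2) = 0" by (intro antisym sum_nonneg) auto
  then show "Jinv z k = Jinv z' k" by (cases "k \<in> {1..N}") (auto simp: sum_nonneg_eq_0_iff Jinv)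
qed

lemma Jinv_unique:
  assumes "\<And>k. k \<notin> {1..N} \<Longrightarrow> c k = 0" "\<And>k. k \<in> {1..N} \<Longrightarrow> J c k = z k"
  shows "Jinv z = c"
proof
  fix k
  have "gap * (\<Sum>k=1..N. (Jinv z k - c k)\<^sup>2) \<le> 0"
    using J_monotone[of "Jinv z" c] assms Jinv by simp
  then have "(\<Sum>k=1..N. (Jinv z k - c k)\<^sup>2) \<le> 0" using gap_pos by (simp add: mult_le_0_iff)
  then have "(\<Sum>k=1..N. (Jinv z k - c k)\<^sup>2) = 0" by (intro antisym sum_nonneg) auto
  then show "Jinv z k = c k" by (cases "k \<in> {1..N}") (auto simp: sum_nonneg_eq_0_iff Jinv assms)
qed

text \<open>\<open>J_coercive\<close> at the solution, with z.c bounded by |z|^2/4 + |c|^2; the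
  coefficient 2 in \<open>J_coercive\<close> leaves one |c|^2 on the left.\<close>

lemma Jinv_growth: "(\<Sum>k=1..N. (Jinv z k)\<^sup>2) \<le> (\<Sum>k=1..N. (z k)\<^sup>2) / 4 + drift_const"
proof -
  let ?c = "Jinv z"
  have "2 * (\<Sum>k=1..N. (?c k)\<^sup>2) - drift_const \<le> (\<Sum>k=1..N. z k * ?c k)"
    using J_coercive[of ?c] by (simp add: Jinv)
  also have "\<dots> \<le> (\<Sum>k=1..N. (z k)\<^sup>2 / 4 + (?c k)\<^sup>2)"
  proof (intro sum_mono)
    fix k
    have "0 \<le> (z k / 2 - ?c k)\<^sup>2" by simp
    then show "z k * ?c k \<le> (z k)\<^sup>2 / 4 + (?c k)\<^sup>2" by (simp add: power2_diff power_divide)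
  qed
  also have "\<dots> = (\<Sum>k=1..N. (z k)\<^sup>2) / 4 + (\<Sum>k=1..N. (?c k)\<^sup>2)" by (simp add: sum.distrib sum_divide_distrib)
  finally show ?thesis by simp
qed

text \<open>Each coordinate is continuous: the Lipschitz bound depends on finitely many coordinates
  of the argument and is thus continuous in the product topology.\<close>

lemma measurable_Jinv [measurable]: "Jinv \<in> borel \<rightarrow>\<^sub>M borel"
proof (rule measurable_coordinatewise_then_product, rule borel_measurable_continuous_onI)
  fix k
  show "continuous_on UNIV (\<lambda>z. Jinv z k)"
    unfolding continuous_on_def
  proof (rule ballI)
    fix z
    have "((\<lambda>z'. sqrt (\<Sum>k=1..N. (z' k - z k)\<^sup>2) / gap) \<longlongrightarrow> sqrt (\<Sum>k=1..N. (z k - z k)\<^sup>2) / gap) (at z within UNIV)"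
    proof -
      have "continuous_on UNIV (\<lambda>z'. sqrt (\<Sum>k=1..N. (z' k - z k)\<^sup>2) / gap)"
        using gap_pos by (intro continuous_intros continuous_on_product_coordinates) auto
      then show ?thesis unfolding continuous_on_def by blast
    qed
    then have "((\<lambda>z'. sqrt (\<Sum>k=1..N. (z' k - z k)\<^sup>2) / gap) \<longlongrightarrow> 0) (at z within UNIV)" by simp
    moreover have "norm (Jinv z' k - Jinv z k) \<le> norm (sqrt (\<Sum>k=1..N. (z' k - z k)\<^sup>2) / gap) * 1" for z'
    proof (cases "k \<in> {1..N}")
      case True
      have "(Jinv z' k - Jinv z k)\<^sup>2 \<le> (\<Sum>k=1..N. (Jinv z' k - Jinv z k)\<^sup>2)"
        using True by (intro member_le_sum) auto
      also have "\<dots> \<le> (\<Sum>k=1..N. (z' k - z k)\<^sup>2) / gap\<^sup>2"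
        using Jinv_lipschitz[of z' z] gap_pos by (simp add: field_simps)
      finally have "sqrt ((Jinv z' k - Jinv z k)\<^sup>2) \<le> sqrt ((\<Sum>k=1..N. (z' k - z k)\<^sup>2) / gap\<^sup>2)"
        by (rule real_sqrt_le_mono)
      then show ?thesis using gap_pos by (simp add: real_sqrt_divide sum_nonneg)
    qed (simp add: Jinv)
    ultimately have "((\<lambda>z'. Jinv z' k - Jinv z k) \<longlongrightarrow> 0) (at z within UNIV)"
      by (rule tendsto_0_le[OF _ always_eventually[OF allI]])
    then show "((\<lambda>z'. Jinv z' k) \<longlongrightarrow> Jinv z k) (at z within UNIV)" by (simp add: LIM_zero_iff)
  qed
qed

end

subsection \<open>The Gaussian increments\<close>

text \<open>\<sigma> is the standard deviation. For \<sigma> = sqrt \<tau> this is the law of the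
  whole sequence of Brownian increments over one time step (\<open>distr_\<delta>\<close>).\<close>

definition white_noise :: "real \<Rightarrow> (nat \<Rightarrow> real) measure" where
  "white_noise \<sigma> = (\<Pi>\<^sub>M k\<in>UNIV. density lborel (normal_density 0 \<sigma>))"

lemma sets_white_noise [measurable_cong, simp]: "sets (white_noise \<sigma>) = sets borel"
proof -
  have "sets (white_noise \<sigma>) = sets (\<Pi>\<^sub>M k\<in>(UNIV::nat set). (borel :: real measure))"
    unfolding white_noise_def by (rule sets_PiM_cong) auto
  then show ?thesis by (simp add: sets_PiM_equal_borel)
qed

lemma space_white_noise [simp]: "space (white_noise \<sigma>) = UNIV"
  using sets_eq_imp_space_eq[OF sets_white_noise] by simp

lemma measurable_coordinate [measurable]: "(\<lambda>w::nat \<Rightarrow> real. w k) \<in> borel_measurable borel"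
  by (rule borel_measurable_continuous_onI) simp

locale gaussian_noise =
  fixes \<sigma> :: real
  assumes sigma: "\<sigma> > 0"
begin

lemma prob_normal: "prob_space (density lborel (normal_density 0 \<sigma>))"
  using prob_space_normal_density[OF sigma] by simp

sublocale W: product_prob_space "\<lambda>_::nat. density lborel (normal_density 0 \<sigma>)" UNIV
  by (simp add: product_prob_space_def product_prob_space_axioms_def product_sigma_finite_def prob_normal prob_space_imp_sigma_finite)

sublocale prob_space "white_noise \<sigma>"
  unfolding white_noise_def by (rule prob_space_PiM) (rule prob_normal)

lemma distr_coordinate: "distr (white_noise \<sigma>) borel (\<lambda>w. w k) = density lborel (normal_density 0 \<sigma>)"
  using W.PiM_component[of k] unfolding white_noise_def
  by (metis UNIV_I distr_cong sets_density sets_lborel)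

lemma coordinate_moments:
  "integrable (white_noise \<sigma>) (\<lambda>w. (w k) ^ j)"
  "(\<integral>w. w k \<partial>white_noise \<sigma>) = 0" "(\<integral>w. (w k)\<^sup>2 \<partial>white_noise \<sigma>) = \<sigma>\<^sup>2"
proof -
  have "integrable (distr (white_noise \<sigma>) borel (\<lambda>w. w k)) (\<lambda>x. x ^ j)"
    unfolding distr_coordinate by (subst integrable_density) (use integrable_normal_moment[OF sigma, of 0 j] in auto)
  then show "integrable (white_noise \<sigma>) (\<lambda>w. (w k) ^ j)" by (subst (asm) integrable_distr_eq) auto
  have "(\<integral>w. w k \<partial>white_noise \<sigma>) = (\<integral>x. x \<partial>distr (white_noise \<sigma>) borel (\<lambda>w. w k))"
    by (subst integral_distr) auto
  also have "\<dots> = 0" unfolding distr_coordinate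
    by (subst integral_density) (use integral_normal_moment_nz_1[OF sigma, of 0] in auto)
  finally show "(\<integral>w. w k \<partial>white_noise \<sigma>) = 0" .
  have "(\<integral>w. (w k)\<^sup>2 \<partial>white_noise \<sigma>) = (\<integral>x. x\<^sup>2 \<partial>distr (white_noise \<sigma>) borel (\<lambda>w. w k))"
    by (subst integral_distr) auto
  also have "\<dots> = \<sigma>\<^sup>2" unfolding distr_coordinate
    by (subst integral_density) (use integral_normal_moment_even[OF sigma, of 0 1] in \<open>auto simp: fact_numeral\<close>)
  finally show "(\<integral>w. (w k)\<^sup>2 \<partial>white_noise \<sigma>) = \<sigma>\<^sup>2" .
qed

lemma coordinate_cross_moment:
  assumes "j \<noteq> k"
  shows "integrable (white_noise \<sigma>) (\<lambda>w. w j * w k)" "(\<integral>w. w j * w k \<partial>white_noise \<sigma>) = 0"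
proof -
  have "indep_vars (\<lambda>_. borel) (\<lambda>k w. w k) UNIV"
  proof (subst indep_vars_iff_distr_eq_PiM)
    have "distr (white_noise \<sigma>) (\<Pi>\<^sub>M i\<in>UNIV. borel) (\<lambda>w. \<lambda>i\<in>UNIV. w i) = distr (white_noise \<sigma>) (white_noise \<sigma>) (\<lambda>w. w)"
      by (rule distr_cong) (auto simp: sets_PiM_equal_borel)
    also have "\<dots> = white_noise \<sigma>" by simp
    finally show "distr (white_noise \<sigma>) (\<Pi>\<^sub>M i\<in>UNIV. borel) (\<lambda>w. \<lambda>i\<in>UNIV. w i) = (\<Pi>\<^sub>M i\<in>UNIV. distr (white_noise \<sigma>) borel (\<lambda>w. w i))"
      unfolding distr_coordinate by (simp add: white_noise_def)
  qed (auto intro: measurable_coordinate)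
  then have i: "indep_vars (\<lambda>_. borel) (\<lambda>k w. w k) {j, k}"
    by (rule indep_vars_subset) simp
  have int: "integrable (white_noise \<sigma>) (\<lambda>w. w l)" for l
    using coordinate_moments(1)[of l 1] by simp
  show "integrable (white_noise \<sigma>) (\<lambda>w. w j * w k)"
    using indep_vars_integrable[OF _ i int] assms by simp
  show "(\<integral>w. w j * w k \<partial>white_noise \<sigma>) = 0"
    using indep_vars_lebesgue_integral[OF _ i int] assms coordinate_moments(2) by simp
qed

text \<open>Cross moments vanish, so only the diagonal of the double sum survives; this is the Ito
  isometry for finite sums.\<close>

lemma second_moment:
  assumes "finite K"
  shows "(\<integral>\<^sup>+w. ennreal ((\<Sum>k\<in>K. a k * w k)\<^sup>2) \<partial>white_noise \<sigma>) = ennreal (\<sigma>\<^sup>2 * (\<Sum>k\<in>K. (a k)\<^sup>2))"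
proof -
  have e: "(\<Sum>k\<in>K. a k * w k)\<^sup>2 = (\<Sum>j\<in>K. \<Sum>k\<in>K. a j * a k * (w j * w k))" for w :: "nat \<Rightarrow> real"
    unfolding power2_eq_square sum_product by (intro sum.cong refl) simp
  have ii: "integrable (white_noise \<sigma>) (\<lambda>w. w j * w k)" for j k
    using coordinate_cross_moment(1)[of j k] coordinate_moments(1)[of j 2] by (cases "j = k") (auto simp: power2_eq_square)
  have v: "(\<integral>w. w j * w k \<partial>white_noise \<sigma>) = (if j = k then \<sigma>\<^sup>2 else 0)" for j k
    using coordinate_cross_moment(2)[of j k] coordinate_moments(3)[of j] by (auto simp: power2_eq_square)
  have int: "integrable (white_noise \<sigma>) (\<lambda>w. (\<Sum>k\<in>K. a k * w k)\<^sup>2)"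
    unfolding e by (intro Bochner_Integration.integrable_sum integrable_mult_right ii)
  have "(\<integral>w. (\<Sum>k\<in>K. a k * w k)\<^sup>2 \<partial>white_noise \<sigma>) = (\<Sum>j\<in>K. \<Sum>k\<in>K. a j * a k * (if j = k then \<sigma>\<^sup>2 else 0))"
    unfolding e v[symmetric]
    by (simp add: Bochner_Integration.integral_sum ii integrable_mult_right Bochner_Integration.integrable_sum)
  also have "\<dots> = \<sigma>\<^sup>2 * (\<Sum>k\<in>K. (a k)\<^sup>2)"
    using assms unfolding sum_distrib_left
    by (intro sum.cong refl) (auto simp: if_distrib[of "\<lambda>x. _ * x"] power2_eq_square cong: if_cong)
  finally show ?thesis using nn_integral_eq_integral[OF int] by simp
qed

end

section \<open>Coefficients and energy of the multiplicative noise\<close>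

locale noise_coefficients = gaussian_noise \<sigma> for \<sigma> :: real +
  fixes b :: "nat \<Rightarrow> real \<Rightarrow> real" and g :: "real \<Rightarrow> real" and K6 :: real and N :: nat
  assumes basis: "orthonormal_basis b" and g_cont: "continuous_on UNIV g"
    and g_bound: "\<And>\<xi>. 0 \<noteq> \<bar>g \<xi>\<bar> \<and> \<bar>g \<xi>\<bar> \<le> K6"
begin

text \<open>Coordinate \<open>i\<close> of P_N G(x) b_k, the vector that multiplies the k-th
  Brownian increment (\<open>PN_term\<close>).\<close>

definition noise_coef :: "nat \<Rightarrow> (nat \<Rightarrow> real) \<Rightarrow> nat \<Rightarrow> real" where
  "noise_coef k x i = coef (\<lambda>\<zeta>. g (synth N x \<zeta>) * b k \<zeta>) i"

text \<open>By Parseval this is the sum over all k of the squared noise coefficients; the integral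
  form gives continuity in the state and the bound by \<open>K6\<close>.\<close>

definition noise_energy :: "(nat \<Rightarrow> real) \<Rightarrow> nat \<Rightarrow> real" where
  "noise_energy x i = (\<integral>\<xi>. (g (synth N x \<xi>) * eigenfun i \<xi>)\<^sup>2 \<partial>unit_lebesgue)"

lemma cont_g: "continuous_on T u \<Longrightarrow> continuous_on T (\<lambda>x. g (u x))"
  by (rule continuous_on_compose2[OF g_cont]) auto

lemma b_L2: "b k \<in> L2"
  using basis by (simp add: orthonormal_basis_def)

lemma K6_nonneg: "K6 \<ge> 0"
  using g_bound[of 0] by linarith

lemma gb_L2: "(\<lambda>\<zeta>. g (synth N x \<zeta>) * b k \<zeta>) \<in> L2"
  by (rule L2_bounded_mult[OF b_L2, where B=K6]) (auto intro!: cont_unit(1) cont_g continuous_intros simp: g_bound)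

lemma gv_L2: "continuous_on UNIV v \<Longrightarrow> (\<lambda>\<xi>. g (synth N x \<xi>) * v \<xi>) \<in> L2"
  by (intro L2I_cont continuous_intros cont_g)

text \<open>Multiplication by \<open>g\<close> is symmetric, so the inner sum is the k-th Fourier
  coefficient of g(u) times the combination of eigenfunctions, and Parseval applies.\<close>

lemma noise_coef_sums: "(\<lambda>k. (\<Sum>i\<in>I. v i * noise_coef k x i)\<^sup>2) sums (\<integral>\<xi>. (g (synth N x \<xi>) * (\<Sum>i\<in>I. v i * eigenfun i \<xi>))\<^sup>2 \<partial>unit_lebesgue)"
proof -
  let ?v = "\<lambda>\<xi>. \<Sum>i\<in>I. v i * eigenfun i \<xi>"
  have cv: "continuous_on UNIV ?v" by (intro continuous_intros)
  have "L2_inner (\<lambda>\<xi>. g (synth N x \<xi>) * ?v \<xi>) (b k) = (\<Sum>i\<in>I. v i * noise_coef k x i)" for k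
  proof -
    have "L2_inner (\<lambda>\<xi>. g (synth N x \<xi>) * ?v \<xi>) (b k) = L2_inner ?v (\<lambda>\<zeta>. g (synth N x \<zeta>) * b k \<zeta>)"
      by (simp add: L2_inner_def mult_ac)
    also have "\<dots> = (\<Sum>i\<in>I. v i * L2_inner (eigenfun i) (\<lambda>\<zeta>. g (synth N x \<zeta>) * b k \<zeta>))"
      by (rule L2_inner_sum_left) (auto intro: eigenfun_L2 gb_L2)
    finally show ?thesis by (simp add: noise_coef_def coef_def L2_inner_commute)
  qed
  with L2_parseval[OF basis gv_L2[OF cv, of x]] show ?thesis
    by (simp add: L2_inner_def power2_eq_square)
qed

lemma noise_coef_sums_noise_energy: "(\<lambda>k. (noise_coef k x i)\<^sup>2) sums noise_energy x i"
  using noise_coef_sums[where v="\<lambda>_. 1" and I="{i}" and x=x] by (simp add: noise_energy_def)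

lemma noise_coef_le_noise_energy: "finite I \<Longrightarrow> (\<Sum>k\<in>I. (noise_coef k x i)\<^sup>2) \<le> noise_energy x i"
  using sum_le_suminf[of "\<lambda>k. (noise_coef k x i)\<^sup>2" I] noise_coef_sums_noise_energy[of x i] by (auto simp: sums_iff)

lemma noise_energy_le: "noise_energy x i \<le> K6\<^sup>2"
proof (cases "i = 0")
  case True
  then show ?thesis by (simp add: noise_energy_def eigenfun_def)
next
  case False
  have "noise_energy x i \<le> (\<integral>\<xi>. K6\<^sup>2 * (eigenfun i \<xi> * eigenfun i \<xi>) \<partial>unit_lebesgue)"
    unfolding noise_energy_def
  proof (intro integral_mono cont_unit(2) continuous_intros cont_g)
    fix \<xi>
    have "(g (synth N x \<xi>))\<^sup>2 \<le> K6\<^sup>2"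
      using g_bound[of "synth N x \<xi>"] K6_nonneg by (simp add: abs_le_square_iff[symmetric])
    then show "(g (synth N x \<xi>) * eigenfun i \<xi>)\<^sup>2 \<le> K6\<^sup>2 * (eigenfun i \<xi> * eigenfun i \<xi>)"
      unfolding power_mult_distrib power2_eq_square[of "eigenfun i \<xi>"] by (rule mult_right_mono) simp
  qed
  also have "\<dots> = K6\<^sup>2" using False eigenfun_orthonormal[of i i] by (simp add: L2_inner_def)
  finally show ?thesis .
qed

lemma continuous_noise_energy: "continuous_on UNIV (\<lambda>x. noise_energy x i)"
proof -
  have "noise_energy x i = integral (cbox 0 1) (\<lambda>\<xi>. (g (synth N x \<xi>) * eigenfun i \<xi>)\<^sup>2)" for x
    unfolding noise_energy_def cbox_interval by (intro cont_unit(3) continuous_intros cont_g)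
  moreover have "continuous_on UNIV (\<lambda>x. integral (cbox 0 1) (\<lambda>\<xi>. (g (synth N x \<xi>) * eigenfun i \<xi>)\<^sup>2))"
  proof (rule integral_continuous_on_param)
    have "continuous_on UNIV (\<lambda>p. synth N (fst p) (snd p))" by (rule continuous_synth_arg)
    then show "continuous_on (UNIV \<times> cbox 0 1) (\<lambda>(x, t). (g (synth N x t) * eigenfun i t)\<^sup>2)"
      unfolding split_beta by (intro continuous_intros cont_g) (rule continuous_on_subset, auto)
  qed
  ultimately show ?thesis by simp
qed

text \<open>\<open>b k\<close> is only square integrable, so the state is varied by dominated
  convergence with the bound \<open>K6\<close>; sequences suffice in the metrisable product
  space.\<close>

lemma continuous_noise_coef: "continuous_on UNIV (\<lambda>x. noise_coef k x i)"
proof (rule continuous_on_sequentiallyI)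
  fix u :: "nat \<Rightarrow> nat \<Rightarrow> real" and a assume u: "u \<longlonglongrightarrow> a"
  have [measurable]: "b k \<in> borel_measurable unit_lebesgue" using b_L2[of k] by (simp add: L2_def)
  have [measurable]: "eigenfun i \<in> borel_measurable unit_lebesgue" by (intro cont_unit(1) continuous_intros)
  have [measurable]: "(\<lambda>\<xi>. g (synth N x \<xi>)) \<in> borel_measurable unit_lebesgue" for x
    by (intro cont_unit(1) continuous_intros cont_g)
  have "(\<lambda>n. \<integral>\<xi>. g (synth N (u n) \<xi>) * b k \<xi> * eigenfun i \<xi> \<partial>unit_lebesgue)
     \<longlonglongrightarrow> (\<integral>\<xi>. g (synth N a \<xi>) * b k \<xi> * eigenfun i \<xi> \<partial>unit_lebesgue)"
  proof (rule integral_dominated_convergence)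
    show "integrable unit_lebesgue (\<lambda>\<xi>. K6 * \<bar>b k \<xi> * eigenfun i \<xi>\<bar>)"
      using L2_mult_integrable[OF b_L2[of k] eigenfun_L2[of i]] by simp
    show "AE \<xi> in unit_lebesgue. (\<lambda>n. g (synth N (u n) \<xi>) * b k \<xi> * eigenfun i \<xi>) \<longlonglongrightarrow> g (synth N a \<xi>) * b k \<xi> * eigenfun i \<xi>"
    proof (rule AE_I2)
      fix \<xi>
      have "continuous_on UNIV (\<lambda>x. g (synth N x \<xi>))"
        unfolding synth_def by (intro cont_g continuous_intros continuous_on_product_coordinates)
      then have "(\<lambda>n. g (synth N (u n) \<xi>)) \<longlonglongrightarrow> g (synth N a \<xi>)"
        by (rule continuous_on_tendsto_compose[OF _ u]) auto
      then show "(\<lambda>n. g (synth N (u n) \<xi>) * b k \<xi> * eigenfun i \<xi>) \<longlonglongrightarrow> g (synth N a \<xi>) * b k \<xi> * eigenfun i \<xi>"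
        by (intro tendsto_intros)
    qed
    show "AE \<xi> in unit_lebesgue. norm (g (synth N (u n) \<xi>) * b k \<xi> * eigenfun i \<xi>) \<le> K6 * \<bar>b k \<xi> * eigenfun i \<xi>\<bar>" for n
      using g_bound by (auto simp: abs_mult mult.assoc intro!: mult_right_mono AE_I2)
  qed measurable
  then show "(\<lambda>n. noise_coef k (u n) i) \<longlonglongrightarrow> noise_coef k a i" by (simp add: noise_coef_def coef_def L2_inner_def)
qed

lemma measurable_noise_coef [measurable]: "(\<lambda>x. noise_coef k x i) \<in> borel_measurable borel"
  and measurable_noise_energy [measurable]: "(\<lambda>x. noise_energy x i) \<in> borel_measurable borel"
  by (auto intro: borel_measurable_continuous_onI continuous_noise_coef continuous_noise_energy)

section \<open>Truncation and pathwise convergence of the noise series\<close>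

text \<open>The energy beyond the first \<open>n\<close> noise terms; times \<sigma>^2 it bounds the
  mean square truncation error of each coordinate.\<close>

definition tail :: "nat \<Rightarrow> (nat \<Rightarrow> real) \<Rightarrow> real" where
  "tail n x = (\<Sum>i=1..N. noise_energy x i - (\<Sum>k<n. (noise_coef k x i)\<^sup>2))"

lemma tail_term_nonneg: "0 \<le> noise_energy x i - (\<Sum>k<n. (noise_coef k x i)\<^sup>2)"
  using noise_coef_le_noise_energy[of "{..<n}" x i] by simp

lemma tail_nonneg: "0 \<le> tail n x"
  unfolding tail_def by (intro sum_nonneg tail_term_nonneg)

lemma tail_le: "tail n x \<le> real N * K6\<^sup>2"
proof -
  have "tail n x \<le> (\<Sum>i=1..N. K6\<^sup>2)"
    unfolding tail_def
  proof (intro sum_mono)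
    fix i show "noise_energy x i - (\<Sum>k<n. (noise_coef k x i)\<^sup>2) \<le> K6\<^sup>2"
      using noise_energy_le[of x i] sum_nonneg[of "{..<n}" "\<lambda>k. (noise_coef k x i)\<^sup>2"] by simp
  qed
  then show ?thesis by simp
qed

lemma tail_antimono: "m \<le> n \<Longrightarrow> tail n x \<le> tail m x"
  unfolding tail_def by (intro sum_mono diff_left_mono sum_mono2) auto

lemma tail_tendsto: "(\<lambda>n. tail n x) \<longlonglongrightarrow> 0"
proof -
  have "(\<lambda>n. \<Sum>i=1..N. noise_energy x i - (\<Sum>k<n. (noise_coef k x i)\<^sup>2)) \<longlonglongrightarrow> (\<Sum>i=1..N. noise_energy x i - noise_energy x i)"
    by (intro tendsto_intros) (use noise_coef_sums_noise_energy in \<open>simp add: sums_def\<close>)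
  then show ?thesis by (simp add: tail_def[abs_def])
qed

lemma block_le_tail:
  assumes "i \<in> {1..N}" "finite I" "I \<inter> {..<n} = {}"
  shows "(\<Sum>k\<in>I. (noise_coef k x i)\<^sup>2) \<le> tail n x"
proof -
  have "(\<Sum>k\<in>I. (noise_coef k x i)\<^sup>2) + (\<Sum>k<n. (noise_coef k x i)\<^sup>2) \<le> noise_energy x i"
    using noise_coef_le_noise_energy[of "I \<union> {..<n}" x i] assms(2,3) by (simp add: sum.union_disjoint)
  moreover have "noise_energy x i - (\<Sum>k<n. (noise_coef k x i)\<^sup>2) \<le> tail n x"
    unfolding tail_def using assms(1) by (intro member_le_sum tail_term_nonneg) auto
  ultimately show ?thesis by simp
qed

lemma measurable_tail [measurable]: "tail n \<in> borel_measurable borel"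
  unfolding tail_def[abs_def] by measurable

text \<open>The rate 8^-m beats the weight 2^m used in \<open>AE_convergent\<close>. The added
  \<open>m\<close> makes the cutoff unbounded, so that a shift of finitely many noise coordinates is
  eventually seen in full (\<open>noise_sum_shift\<close>).\<close>

definition cutoff :: "nat \<Rightarrow> (nat \<Rightarrow> real) \<Rightarrow> nat" where
  "cutoff m x = m + (LEAST n. tail n x \<le> (1/8) ^ m)"

lemma tail_cutoff: "tail (cutoff m x) x \<le> (1/8) ^ m"
proof -
  have "eventually (\<lambda>n. tail n x < (1/8) ^ m) sequentially"
    using tail_tendsto by (rule order_tendstoD) simp
  then obtain n where "tail n x \<le> (1/8) ^ m" by (auto simp: eventually_sequentially intro: less_imp_le)
  then have "tail (LEAST n. tail n x \<le> (1/8) ^ m) x \<le> (1/8) ^ m" by (rule LeastI)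
  moreover have "tail (cutoff m x) x \<le> tail (LEAST n. tail n x \<le> (1/8) ^ m) x"
    unfolding cutoff_def by (rule tail_antimono) simp
  ultimately show ?thesis by simp
qed

lemma cutoff_ge: "m \<le> cutoff m x"
  by (simp add: cutoff_def)

lemma cutoff_mono: "cutoff m x \<le> cutoff (Suc m) x"
proof -
  have "eventually (\<lambda>n. tail n x < (1/8) ^ Suc m) sequentially"
    using tail_tendsto by (rule order_tendstoD) simp
  then obtain n where "tail n x \<le> (1/8) ^ Suc m" by (auto simp: eventually_sequentially intro: less_imp_le)
  then have "tail (LEAST n. tail n x \<le> (1/8) ^ Suc m) x \<le> (1/8) ^ Suc m" by (rule LeastI)
  also have "\<dots> \<le> (1/8) ^ m" by simp
  finally have "(LEAST n. tail n x \<le> (1/8) ^ m) \<le> (LEAST n. tail n x \<le> (1/8) ^ Suc m)" by (rule Least_le)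
  then show ?thesis by (simp add: cutoff_def)
qed

lemma measurable_cutoff [measurable]: "cutoff m \<in> borel \<rightarrow>\<^sub>M count_space UNIV"
  unfolding cutoff_def by measurable

definition psum :: "nat \<Rightarrow> (nat \<Rightarrow> real) \<Rightarrow> (nat \<Rightarrow> real) \<Rightarrow> nat \<Rightarrow> real" where
  "psum n x w i = (\<Sum>k<n. noise_coef k x i * w k)"

text \<open>The series is summed along a subsequence that depends on \<open>x\<close>, fast enough for almost sure
  convergence; this makes the sum jointly measurable in the state and the noise.\<close>

definition noise_sum :: "(nat \<Rightarrow> real) \<Rightarrow> (nat \<Rightarrow> real) \<Rightarrow> nat \<Rightarrow> real" where
  "noise_sum x w i = lim (\<lambda>m. psum (cutoff m x) x w i)"

lemma measurable_psum [measurable]: "(\<lambda>p. psum n (fst p) (snd p) i) \<in> borel_measurable (borel \<Otimes>\<^sub>M borel)"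
  unfolding psum_def by measurable

text \<open>The state-dependent number of terms takes countably many values, each on a measurable
  set of states.\<close>

lemma measurable_psum_cutoff [measurable]: "(\<lambda>p. psum (cutoff m (fst p)) (fst p) (snd p) i) \<in> borel_measurable (borel \<Otimes>\<^sub>M borel)"
  by (rule measurable_compose_countable[where f="\<lambda>n p. psum n (fst p) (snd p) i"]) measurable

lemma measurable_noise_sum_component: "(\<lambda>p. noise_sum (fst p) (snd p) i) \<in> borel_measurable (borel \<Otimes>\<^sub>M borel)"
  unfolding noise_sum_def by (rule borel_measurable_lim_metric) measurable

lemma measurable_noise_sum [measurable]: "(\<lambda>p. noise_sum (fst p) (snd p)) \<in> borel \<Otimes>\<^sub>M borel \<rightarrow>\<^sub>M borel"
  by (rule measurable_coordinatewise_then_product) (rule measurable_noise_sum_component)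

lemma psum_moment:
  assumes i: "i \<in> {1..N}"
  shows "(\<integral>\<^sup>+w. ennreal ((psum n x w i - psum m x w i)\<^sup>2) \<partial>white_noise \<sigma>) \<le> ennreal (\<sigma>\<^sup>2 * tail (min n m) x)"
proof -
  have *: "(\<integral>\<^sup>+w. ennreal ((psum n x w i - psum m x w i)\<^sup>2) \<partial>white_noise \<sigma>) \<le> ennreal (\<sigma>\<^sup>2 * tail m x)"
    if "m \<le> n" for n m
  proof -
    have "psum n x w i - psum m x w i = (\<Sum>k\<in>{m..<n}. noise_coef k x i * w k)" for w
      using that unfolding psum_def lessThan_atLeast0 by (subst sum_diff_nat_ivl) auto
    then have "(\<integral>\<^sup>+w. ennreal ((psum n x w i - psum m x w i)\<^sup>2) \<partial>white_noise \<sigma>) = ennreal (\<sigma>\<^sup>2 * (\<Sum>k\<in>{m..<n}. (noise_coef k x i)\<^sup>2))"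
      by (simp add: second_moment)
    also have "\<dots> \<le> ennreal (\<sigma>\<^sup>2 * tail m x)"
      by (intro ennreal_leI mult_left_mono block_le_tail i) auto
    finally show ?thesis .
  qed
  show ?thesis
  proof (cases "m \<le> n")
    case True
    then show ?thesis using * by (simp add: min_def)
  next
    case False
    then show ?thesis using *[of n m] by (simp add: min_def power2_commute[of "psum n x _ i"])
  qed
qed

text \<open>The expected sum of 2^m times the squared block increments is dominated by a geometric
  series of ratio 1/4. So the weighted sum is almost surely finite, which makes the increments
  absolutely summable.\<close>

lemma AE_convergent:
  assumes i: "i \<in> {1..N}"
  shows "AE w in white_noise \<sigma>. convergent (\<lambda>m. psum (cutoff m x) x w i)"
proof -
  define \<Delta> where "\<Delta> m w = psum (cutoff (Suc m) x) x w i - psum (cutoff m x) x w i" for m w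
  have [measurable]: "\<Delta> m \<in> borel_measurable borel" for m
    unfolding \<Delta>_def psum_def by measurable
  have "(\<integral>\<^sup>+w. (\<Sum>m. ennreal (2 ^ m * (\<Delta> m w)\<^sup>2)) \<partial>white_noise \<sigma>) = (\<Sum>m. \<integral>\<^sup>+w. ennreal (2 ^ m * (\<Delta> m w)\<^sup>2) \<partial>white_noise \<sigma>)"
    by (rule nn_integral_suminf) measurable
  also have "\<dots> \<le> (\<Sum>m. ennreal (\<sigma>\<^sup>2 * (1/4) ^ m))"
  proof (intro suminf_le summableI allI)
    fix m
    have "(\<integral>\<^sup>+w. ennreal (2 ^ m * (\<Delta> m w)\<^sup>2) \<partial>white_noise \<sigma>) = 2 ^ m * (\<integral>\<^sup>+w. ennreal ((\<Delta> m w)\<^sup>2) \<partial>white_noise \<sigma>)"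
      by (subst nn_integral_cmult[symmetric]) (auto simp: ennreal_mult ennreal_power[symmetric])
    also have "\<dots> \<le> 2 ^ m * ennreal (\<sigma>\<^sup>2 * (1/8) ^ m)"
    proof (rule mult_left_mono)
      have "(\<integral>\<^sup>+w. ennreal ((\<Delta> m w)\<^sup>2) \<partial>white_noise \<sigma>) \<le> ennreal (\<sigma>\<^sup>2 * tail (cutoff m x) x)"
        using psum_moment[OF i, of "cutoff (Suc m) x" x "cutoff m x"] cutoff_mono[of m x] by (simp add: \<Delta>_def min.absorb2)
      also have "\<dots> \<le> ennreal (\<sigma>\<^sup>2 * (1/8) ^ m)" by (intro ennreal_leI mult_left_mono tail_cutoff) auto
      finally show "(\<integral>\<^sup>+w. ennreal ((\<Delta> m w)\<^sup>2) \<partial>white_noise \<sigma>) \<le> ennreal (\<sigma>\<^sup>2 * (1/8) ^ m)" .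
    qed simp
    also have "\<dots> = ennreal (2 ^ m * (\<sigma>\<^sup>2 * (1/8) ^ m))" by (subst ennreal_mult) (auto simp: ennreal_power[symmetric])
    also have "2 ^ m * (\<sigma>\<^sup>2 * (1/8) ^ m) = \<sigma>\<^sup>2 * (1/4) ^ m"
    proof -
      have "(2::real) ^ m * (1/8) ^ m = (1/4) ^ m" by (simp add: power_mult_distrib[symmetric])
      then show ?thesis by (simp add: mult.left_commute)
    qed
    finally show "(\<integral>\<^sup>+w. ennreal (2 ^ m * (\<Delta> m w)\<^sup>2) \<partial>white_noise \<sigma>) \<le> ennreal (\<sigma>\<^sup>2 * (1/4) ^ m)" .
  qed
  also have "\<dots> < \<top>"
    by (subst suminf_ennreal2) (auto intro!: summable_mult summable_geometric)
  finally have "AE w in white_noise \<sigma>. (\<Sum>m. ennreal (2 ^ m * (\<Delta> m w)\<^sup>2)) \<noteq> \<infinity>"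
    by (intro nn_integral_noteq_infinite) auto
  then show ?thesis
  proof eventually_elim
    case (elim w)
    have s: "summable (\<lambda>m. 2 ^ m * (\<Delta> m w)\<^sup>2)"
      by (rule summable_suminf_not_top) (use elim in auto)
    have "summable (\<lambda>m. \<Delta> m w)"
    proof (rule summable_comparison_test')
      show "summable (\<lambda>m. (1/2) ^ m + 2 ^ m * (\<Delta> m w)\<^sup>2)"
        by (intro summable_add s) (auto intro: summable_geometric)
      fix m
      \<comment> \<open>Applied to y = 2^m |\<open>\<Delta> m w\<close>| and divided by 2^m, this
        bounds the increment by the terms of two convergent series.\<close>
      have "y \<le> 1 + y\<^sup>2" if "0 \<le> y" for y :: real
        using sum_squares_bound[of 1 y] that by simp
      then have "2 ^ m * \<bar>\<Delta> m w\<bar> \<le> 1 + (2 ^ m * \<bar>\<Delta> m w\<bar>)\<^sup>2" by simp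
      then have "(1/2) ^ m * (2 ^ m * \<bar>\<Delta> m w\<bar>) \<le> (1/2) ^ m * (1 + (2 ^ m * \<bar>\<Delta> m w\<bar>)\<^sup>2)"
        by (intro mult_left_mono) auto
      also have "(1/2) ^ m * (2 ^ m * \<bar>\<Delta> m w\<bar>) = \<bar>\<Delta> m w\<bar>"
        by (simp add: power_one_over)
      also have "(1/2) ^ m * (1 + (2 ^ m * \<bar>\<Delta> m w\<bar>)\<^sup>2) = (1/2) ^ m + 2 ^ m * (\<Delta> m w)\<^sup>2"
        by (simp add: power_mult_distrib distrib_left power_one_over power2_eq_square)
      finally show "norm (\<Delta> m w) \<le> (1/2) ^ m + 2 ^ m * (\<Delta> m w)\<^sup>2" by simp
    qed
    then have "convergent (\<lambda>m. \<Sum>j<m. \<Delta> j w)" by (simp add: summable_iff_convergent)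
    then have "convergent (\<lambda>m. psum (cutoff 0 x) x w i + (\<Sum>j<m. \<Delta> j w))" by (intro convergent_add convergent_const)
    moreover have "psum (cutoff 0 x) x w i + (\<Sum>j<m. \<Delta> j w) = psum (cutoff m x) x w i" for m
      by (induction m) (auto simp: \<Delta>_def)
    ultimately show ?case by simp
  qed
qed

text \<open>Fatou along the almost surely convergent subsequence. The cutoffs may lie below
  \<open>n\<close>, which costs an extra 8^-m that disappears in the limit.\<close>

lemma noise_sum_moment:
  assumes i: "i \<in> {1..N}"
  shows "(\<integral>\<^sup>+w. ennreal ((psum n x w i - noise_sum x w i)\<^sup>2) \<partial>white_noise \<sigma>) \<le> ennreal (\<sigma>\<^sup>2 * tail n x)"
proof -
  have [measurable]: "(\<lambda>w. psum n x w i) \<in> borel_measurable borel" for n unfolding psum_def by measurable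
  have "(\<integral>\<^sup>+w. ennreal ((psum n x w i - noise_sum x w i)\<^sup>2) \<partial>white_noise \<sigma>)
     = (\<integral>\<^sup>+w. liminf (\<lambda>m. ennreal ((psum n x w i - psum (cutoff m x) x w i)\<^sup>2)) \<partial>white_noise \<sigma>)"
  proof (rule nn_integral_cong_AE)
    show "AE w in white_noise \<sigma>. ennreal ((psum n x w i - noise_sum x w i)\<^sup>2) = liminf (\<lambda>m. ennreal ((psum n x w i - psum (cutoff m x) x w i)\<^sup>2))"
      using AE_convergent[OF i, of x]
    proof eventually_elim
      case (elim w)
      then have "(\<lambda>m. psum (cutoff m x) x w i) \<longlonglongrightarrow> noise_sum x w i" unfolding noise_sum_def by (simp add: convergent_LIMSEQ_iff)
      then have "(\<lambda>m. ennreal ((psum n x w i - psum (cutoff m x) x w i)\<^sup>2)) \<longlonglongrightarrow> ennreal ((psum n x w i - noise_sum x w i)\<^sup>2)"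
        by (intro tendsto_intros)
      then show ?case by (intro lim_imp_Liminf[symmetric]) auto
    qed
  qed
  also have "\<dots> \<le> liminf (\<lambda>m. \<integral>\<^sup>+w. ennreal ((psum n x w i - psum (cutoff m x) x w i)\<^sup>2) \<partial>white_noise \<sigma>)"
    by (rule nn_integral_liminf) measurable
  also have "\<dots> \<le> liminf (\<lambda>m. ennreal (\<sigma>\<^sup>2 * (tail n x + (1/8) ^ m)))"
  proof (intro Liminf_mono always_eventually allI)
    fix m
    have "tail (min n (cutoff m x)) x \<le> tail n x + (1/8) ^ m"
      using tail_cutoff[of m x] tail_nonneg[of n x] by (auto simp: min_def add_increasing)
    then show "(\<integral>\<^sup>+w. ennreal ((psum n x w i - psum (cutoff m x) x w i)\<^sup>2) \<partial>white_noise \<sigma>) \<le> ennreal (\<sigma>\<^sup>2 * (tail n x + (1/8) ^ m))"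
      by (intro order_trans[OF psum_moment[OF i]] ennreal_leI mult_left_mono) auto
  qed
  also have "\<dots> = ennreal (\<sigma>\<^sup>2 * (tail n x + 0))"
    by (intro lim_imp_Liminf tendsto_ennrealI tendsto_intros) (auto intro: LIMSEQ_power_zero)
  finally show ?thesis by simp
qed

lemma noise_sum_second_moment:
  assumes i: "i \<in> {1..N}"
  shows "(\<integral>\<^sup>+w. ennreal ((noise_sum x w i)\<^sup>2) \<partial>white_noise \<sigma>) \<le> ennreal (\<sigma>\<^sup>2 * (real N * K6\<^sup>2))"
proof -
  have "(\<integral>\<^sup>+w. ennreal ((noise_sum x w i)\<^sup>2) \<partial>white_noise \<sigma>) \<le> ennreal (\<sigma>\<^sup>2 * tail 0 x)"
    using noise_sum_moment[OF i, of 0 x] by (simp add: psum_def)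
  also have "\<dots> \<le> ennreal (\<sigma>\<^sup>2 * (real N * K6\<^sup>2))" by (intro ennreal_leI mult_left_mono tail_le) auto
  finally show ?thesis .
qed

end

subsection \<open>Minorisation of the noise\<close>

context gaussian_noise
begin

text \<open>Overwriting one coordinate by an independent normal variable preserves the law; this
  exposes a one-dimensional Lebesgue integral in that coordinate.\<close>

lemma nn_integral_resample:
  assumes [measurable]: "\<phi> \<in> borel_measurable borel"
  shows "(\<integral>\<^sup>+w. \<phi> w \<partial>white_noise \<sigma>) = (\<integral>\<^sup>+w. (\<integral>\<^sup>+x. ennreal (normal_density 0 \<sigma> x) * \<phi> (w(k := x)) \<partial>lborel) \<partial>white_noise \<sigma>)"
proof -
  let ?n = "density lborel (normal_density 0 \<sigma>)"
  interpret n: prob_space ?n by (rule prob_normal)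
  interpret p: pair_sigma_finite ?n "white_noise \<sigma>" ..
  have m: "(\<lambda>(x, w). w(k := x)) \<in> borel \<Otimes>\<^sub>M borel \<rightarrow>\<^sub>M (borel :: (nat \<Rightarrow> real) measure)"
    by (rule measurable_coordinatewise_then_product) (simp add: split_beta fun_upd_def)
  have "distr (?n \<Otimes>\<^sub>M white_noise \<sigma>) (white_noise \<sigma>) (\<lambda>(x, w). w(k := x)) = white_noise \<sigma>"
    using distr_pair_PiM_eq_PiM[of UNIV "\<lambda>_. ?n" k] prob_normal by (simp add: white_noise_def)
  then have "(\<integral>\<^sup>+w. \<phi> w \<partial>white_noise \<sigma>) = (\<integral>\<^sup>+w. \<phi> w \<partial>distr (?n \<Otimes>\<^sub>M white_noise \<sigma>) (white_noise \<sigma>) (\<lambda>(x, w). w(k := x)))"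
    by simp
  also have "\<dots> = (\<integral>\<^sup>+p. \<phi> ((snd p)(k := fst p)) \<partial>(?n \<Otimes>\<^sub>M white_noise \<sigma>))"
    using m by (subst nn_integral_distr) (auto simp: split_beta cong: measurable_cong_sets)
  also have "\<dots> = (\<integral>\<^sup>+w. (\<integral>\<^sup>+x. \<phi> (w(k := x)) \<partial>?n) \<partial>white_noise \<sigma>)"
    using measurable_compose[OF m, of \<phi>] by (subst p.nn_integral_snd[symmetric]) (auto simp: split_beta cong: measurable_cong_sets)
  also have "\<dots> = (\<integral>\<^sup>+w. (\<integral>\<^sup>+x. ennreal (normal_density 0 \<sigma> x) * \<phi> (w(k := x)) \<partial>lborel) \<partial>white_noise \<sigma>)"
  proof (intro nn_integral_cong nn_integral_density)
    fix w :: "nat \<Rightarrow> real"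
    have "(\<lambda>x. (x, w)) \<in> borel \<rightarrow>\<^sub>M borel \<Otimes>\<^sub>M borel" by simp
    from measurable_compose[OF this measurable_compose[OF m assms]]
    show "(\<lambda>x. \<phi> (w(k := x))) \<in> borel_measurable lborel" by simp
  qed simp
  finally show ?thesis .
qed

text \<open>Translation invariance of Lebesgue measure in the exposed coordinate; the exponential is
  the quotient of the shifted and the original normal density.\<close>

lemma nn_integral_shift_one:
  assumes [measurable]: "\<phi> \<in> borel_measurable borel"
  shows "(\<integral>\<^sup>+w. \<phi> w \<partial>white_noise \<sigma>) =
    (\<integral>\<^sup>+w. \<phi> (w(k := s + w k)) * ennreal (exp (- (s * w k / \<sigma>\<^sup>2 + s\<^sup>2 / (2 * \<sigma>\<^sup>2)))) \<partial>white_noise \<sigma>)"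
proof -
  have upd [measurable]: "(\<lambda>x. w(k := x)) \<in> borel \<rightarrow>\<^sub>M (borel :: (nat \<Rightarrow> real) measure)" for w
    by (rule measurable_coordinatewise_then_product) (simp add: fun_upd_def)
  have upd' [measurable]: "(\<lambda>w. w(k := s + w k)) \<in> borel \<rightarrow>\<^sub>M (borel :: (nat \<Rightarrow> real) measure)"
    by (rule measurable_coordinatewise_then_product) (simp add: fun_upd_def)
  have dens: "normal_density 0 \<sigma> (s + x) = normal_density 0 \<sigma> x * exp (- (s * x / \<sigma>\<^sup>2 + s\<^sup>2 / (2 * \<sigma>\<^sup>2)))" for x
    unfolding normal_density_def mult.assoc exp_add[symmetric] using sigma
    by (intro arg_cong2[where f="(*)"] refl arg_cong[where f=exp]) (simp add: field_simps power2_eq_square)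
  let ?\<psi> = "\<lambda>w. \<phi> (w(k := s + w k)) * ennreal (exp (- (s * w k / \<sigma>\<^sup>2 + s\<^sup>2 / (2 * \<sigma>\<^sup>2))))"
  have "(\<integral>\<^sup>+x. ennreal (normal_density 0 \<sigma> x) * \<phi> (w(k := x)) \<partial>lborel) = (\<integral>\<^sup>+x. ennreal (normal_density 0 \<sigma> x) * ?\<psi> (w(k := x)) \<partial>lborel)" for w
    by (subst nn_integral_real_affine[where c=1 and t=s])
      (auto simp: dens ennreal_mult mult_ac intro!: nn_integral_cong)
  then show ?thesis
    by (subst (1 2) nn_integral_resample[where k=k]) auto
qed

definition shift :: "nat \<Rightarrow> (nat \<Rightarrow> real) \<Rightarrow> (nat \<Rightarrow> real) \<Rightarrow> nat \<Rightarrow> real" where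
  "shift n h w = (\<lambda>k. w k + (if k < n then h k else 0))"

lemma measurable_shift [measurable]: "shift n h \<in> borel \<rightarrow>\<^sub>M borel"
  by (rule measurable_coordinatewise_then_product) (simp add: shift_def)

text \<open>Induction over the shifted coordinates, one at a time; this is the Cameron-Martin
  formula for finitely supported shifts.\<close>

lemma nn_integral_shift:
  assumes "\<phi> \<in> borel_measurable borel"
  shows "(\<integral>\<^sup>+w. \<phi> w \<partial>white_noise \<sigma>) =
    (\<integral>\<^sup>+w. \<phi> (shift n h w) * ennreal (exp (- (\<Sum>k<n. h k * w k / \<sigma>\<^sup>2 + (h k)\<^sup>2 / (2 * \<sigma>\<^sup>2)))) \<partial>white_noise \<sigma>)"
proof (induction n)
  case 0
  then show ?case by (simp add: shift_def)
next
  case (Suc n)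
  note [measurable] = assms
  let ?\<psi> = "\<lambda>w. \<phi> (shift n h w) * ennreal (exp (- (\<Sum>k<n. h k * w k / \<sigma>\<^sup>2 + (h k)\<^sup>2 / (2 * \<sigma>\<^sup>2))))"
  have "shift n h (w(n := h n + w n)) = shift (Suc n) h w" for w
    by (auto simp: shift_def fun_eq_iff less_Suc_eq)
  moreover have "?\<psi> \<in> borel_measurable borel" by measurable
  ultimately show ?case unfolding Suc
    by (subst nn_integral_shift_one[where k=n and s="h n"])
      (auto simp: mult.assoc ennreal_mult[symmetric] exp_add[symmetric] algebra_simps intro!: nn_integral_cong)
qed

text \<open>Where the shifted coordinates are bounded, the Cameron-Martin density has a positive
  lower bound; the integral outside \<open>D\<close> is discarded.\<close>

lemma nn_integral_shift_ge:
  assumes [measurable]: "\<phi> \<in> borel_measurable borel" "D \<in> sets borel"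
    and h: "\<And>k. k < n \<Longrightarrow> \<bar>h k\<bar> \<le> H" and D: "\<And>w k. w \<in> D \<Longrightarrow> k < n \<Longrightarrow> \<bar>w k\<bar> \<le> B"
  shows "ennreal (exp (- (real n * (H * B / \<sigma>\<^sup>2 + H\<^sup>2 / (2 * \<sigma>\<^sup>2))))) * (\<integral>\<^sup>+w. \<phi> (shift n h w) * indicator D w \<partial>white_noise \<sigma>)
    \<le> (\<integral>\<^sup>+w. \<phi> w \<partial>white_noise \<sigma>)"
proof -
  let ?c = "exp (- (real n * (H * B / \<sigma>\<^sup>2 + H\<^sup>2 / (2 * \<sigma>\<^sup>2))))"
  have "ennreal ?c * (\<integral>\<^sup>+w. \<phi> (shift n h w) * indicator D w \<partial>white_noise \<sigma>) = (\<integral>\<^sup>+w. ennreal ?c * (\<phi> (shift n h w) * indicator D w) \<partial>white_noise \<sigma>)"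
    by (subst nn_integral_cmult) auto
  also have "\<dots> \<le> (\<integral>\<^sup>+w. \<phi> (shift n h w) * ennreal (exp (- (\<Sum>k<n. h k * w k / \<sigma>\<^sup>2 + (h k)\<^sup>2 / (2 * \<sigma>\<^sup>2)))) \<partial>white_noise \<sigma>)"
  proof (intro nn_integral_mono)
    fix w :: "nat \<Rightarrow> real"
    show "ennreal ?c * (\<phi> (shift n h w) * indicator D w) \<le> \<phi> (shift n h w) * ennreal (exp (- (\<Sum>k<n. h k * w k / \<sigma>\<^sup>2 + (h k)\<^sup>2 / (2 * \<sigma>\<^sup>2))))"
    proof (cases "w \<in> D")
      case True
      have "(\<Sum>k<n. h k * w k / \<sigma>\<^sup>2 + (h k)\<^sup>2 / (2 * \<sigma>\<^sup>2)) \<le> (\<Sum>k<n. H * B / \<sigma>\<^sup>2 + H\<^sup>2 / (2 * \<sigma>\<^sup>2))"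
      proof (intro sum_mono add_mono divide_right_mono)
        fix k assume "k \<in> {..<n}"
        then have k: "\<bar>h k\<bar> \<le> H" "\<bar>w k\<bar> \<le> B" using h D True by auto
        have "h k * w k \<le> \<bar>h k\<bar> * \<bar>w k\<bar>" by (simp add: abs_mult[symmetric])
        also have "\<dots> \<le> H * B" using k by (intro mult_mono) auto
        finally show "h k * w k \<le> H * B" .
        show "(h k)\<^sup>2 \<le> H\<^sup>2" using k by (simp add: abs_le_square_iff[symmetric])
      qed auto
      then have "ennreal ?c \<le> ennreal (exp (- (\<Sum>k<n. h k * w k / \<sigma>\<^sup>2 + (h k)\<^sup>2 / (2 * \<sigma>\<^sup>2))))"
        by (intro ennreal_leI) simp
      then show ?thesis using True by (simp add: mult.commute mult_left_mono)
    qed simp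
  qed
  finally show ?thesis by (simp add: nn_integral_shift[OF assms(1), of n h, symmetric])
qed

end

section \<open>Lebesgue measure on finitely many coordinates\<close>

interpretation lborel_product: product_sigma_finite "\<lambda>_::nat. lborel :: real measure"
  by (simp add: product_sigma_finite_def sigma_finite_lborel)

abbreviation lborel_on :: "nat set \<Rightarrow> (nat \<Rightarrow> real) measure" where
  "lborel_on I \<equiv> (\<Pi>\<^sub>M i\<in>I. lborel)"

text \<open>Members of the product space equal \<open>undefined\<close> outside \<open>I\<close>, so
  their remaining coordinates are constant functions.\<close>

lemma measurable_lborel_on_id: "(\<lambda>v. v) \<in> lborel_on I \<rightarrow>\<^sub>M (borel :: (nat \<Rightarrow> real) measure)"
proof (rule measurable_coordinatewise_then_product)
  fix i
  show "(\<lambda>v. v i) \<in> borel_measurable (lborel_on I)"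
  proof (cases "i \<in> I")
    case False
    then have "(\<lambda>v. v i) \<in> borel_measurable (lborel_on I) \<longleftrightarrow> (\<lambda>v. undefined :: real) \<in> borel_measurable (lborel_on I)"
      by (intro measurable_cong) (auto simp: space_PiM PiE_def extensional_def)
    then show ?thesis by simp
  qed (use measurable_component_singleton[of i I "\<lambda>_. lborel"] in simp)
qed

text \<open>A product measure is determined on boxes, where the claim is one-dimensional translation
  invariance in each factor. The restriction to \<open>I\<close> keeps shifted vectors in the
  product space.\<close>

lemma lborel_on_translate:
  assumes I: "finite I" and [measurable]: "\<phi> \<in> borel_measurable (lborel_on I)"
  shows "(\<integral>\<^sup>+v. \<phi> v \<partial>lborel_on I) = (\<integral>\<^sup>+v. \<phi> (\<lambda>i\<in>I. z i + v i) \<partial>lborel_on I)"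
proof -
  let ?T = "\<lambda>v. \<lambda>i\<in>I. z i + v i"
  have T [measurable]: "?T \<in> lborel_on I \<rightarrow>\<^sub>M lborel_on I"
  proof (rule measurable_restrict)
    fix i assume i: "i \<in> I"
    have "(\<lambda>v. v i) \<in> borel_measurable (lborel_on I)"
      using measurable_component_singleton[OF i, of "\<lambda>_. lborel :: real measure"] by simp
    then show "(\<lambda>v. z i + v i) \<in> lborel_on I \<rightarrow>\<^sub>M lborel" by simp
  qed
  have "lborel_on I = distr (lborel_on I) (lborel_on I) ?T"
  proof (rule lborel_product.PiM_eqI[OF I, symmetric])
    fix A :: "nat \<Rightarrow> real set" assume A: "\<And>i. i \<in> I \<Longrightarrow> A i \<in> sets lborel"
    have "?T -` Pi\<^sub>E I A \<inter> space (lborel_on I) = Pi\<^sub>E I (\<lambda>i. (+) (z i) -` A i)"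
      by (auto simp: space_PiM PiE_iff extensional_def)
    moreover have "(+) (z i) -` A i \<in> sets lborel" if "i \<in> I" for i
      using measurable_sets[of "(+) (z i)" lborel lborel "A i"] A[OF that] by simp
    moreover have "emeasure lborel ((+) (z i) -` A i) = emeasure lborel (A i)" if "i \<in> I" for i
    proof -
      have "emeasure lborel (A i) = emeasure (distr lborel borel ((+) (z i))) (A i)" by (simp add: lborel_distr_plus)
      also have "\<dots> = emeasure lborel ((+) (z i) -` A i)" using A[OF that] by (subst emeasure_distr) auto
      finally show ?thesis ..
    qed
    ultimately show "emeasure (distr (lborel_on I) (lborel_on I) ?T) (Pi\<^sub>E I A) = (\<Prod>i\<in>I. emeasure lborel (A i))"
      using A I by (subst emeasure_distr[OF T]) (auto intro!: sets_PiM_I_finite simp: lborel_product.emeasure_PiM)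
  qed simp
  then have "(\<integral>\<^sup>+v. \<phi> v \<partial>lborel_on I) = (\<integral>\<^sup>+v. \<phi> v \<partial>distr (lborel_on I) (lborel_on I) ?T)" by simp
  then show ?thesis by (subst (asm) nn_integral_distr) auto
qed

section \<open>Nondegeneracy of the noise and a lower bound for its law\<close>

context noise_coefficients
begin

text \<open>The quadratic form of A A^T, where A is the N by n matrix of the first n noise
  coefficients at the state \<open>x\<close>.\<close>

definition gram :: "nat \<Rightarrow> (nat \<Rightarrow> real) \<Rightarrow> (nat \<Rightarrow> real) \<Rightarrow> real" where
  "gram n x v = (\<Sum>k<n. (\<Sum>i=1..N. v i * noise_coef k x i)\<^sup>2)"

lemma noise_coef_cong: "(\<And>i. i \<in> {1..N} \<Longrightarrow> x i = y i) \<Longrightarrow> noise_coef k x = noise_coef k y"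
  using synth_cong[of N x y] by (simp add: noise_coef_def fun_eq_iff)

text \<open>A Dini argument: the forms increase in \<open>n\<close> to the integral of the square of
  g(u) times \<open>synth N v\<close>, which is bounded below by the positive minimum of g^2 on a
  compact interval. The sets \<open>O' n\<close> where half of this is exceeded are open and cover a
  compact set of states and unit vectors.\<close>

lemma gram_lower_bound:
  assumes "R \<ge> 0"
  shows "\<exists>n \<delta>. \<delta> > 0 \<and> (\<forall>x v. (\<forall>i\<in>{1..N}. \<bar>x i\<bar> \<le> R) \<longrightarrow> \<delta> * (\<Sum>i=1..N. (v i)\<^sup>2) \<le> gram n x v)"
proof -
  define B where "B r = {c :: nat \<Rightarrow> real. \<forall>k. if k \<in> {1..N} then \<bar>c k\<bar> \<le> r else c k = 0}" for r
  define U where "U = B 1 \<inter> {v. (\<Sum>i=1..N. (v i)\<^sup>2) = 1}"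
  have cU: "compact U" unfolding U_def B_def
    by (intro compact_Int_closed compact_box closed_Collect_eq continuous_intros continuous_on_product_coordinates)
  have cP: "compact (B R \<times> U)" unfolding B_def by (intro compact_Times compact_box cU)
  \<comment> \<open>Each eigenfunction is bounded by sqrt 2, so \<open>r\<close> bounds the values
    of all functions with coordinates up to \<open>R\<close>, and \<open>g\<close> is examined on
    {-r..r} only.\<close>
  define r where "r = real N * (R * sqrt 2)"
  have sy: "\<bar>synth N x \<xi>\<bar> \<le> r" if "\<forall>i\<in>{1..N}. \<bar>x i\<bar> \<le> R" for x \<xi>
  proof -
    have "\<bar>synth N x \<xi>\<bar> \<le> (\<Sum>k=1..N. \<bar>x k * eigenfun k \<xi>\<bar>)" unfolding synth_def by (rule sum_abs)
    also have "\<dots> \<le> (\<Sum>k=1..N. R * sqrt 2)"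
    proof (rule sum_mono)
      fix k assume k: "k \<in> {1..N}"
      have "\<bar>x k * eigenfun k \<xi>\<bar> = \<bar>x k\<bar> * (sqrt 2 * \<bar>sin (real k * pi * \<xi>)\<bar>)" by (simp add: eigenfun_def abs_mult)
      also have "\<dots> \<le> R * (sqrt 2 * 1)" using that k assms by (intro mult_mono) auto
      finally show "\<bar>x k * eigenfun k \<xi>\<bar> \<le> R * sqrt 2" by simp
    qed
    finally show ?thesis by (simp add: r_def)
  qed
  have r0: "r \<ge> 0" using assms by (simp add: r_def)
  obtain y0 where y0: "y0 \<in> {-r..r}" "\<And>y. y \<in> {-r..r} \<Longrightarrow> (g y0)\<^sup>2 \<le> (g y)\<^sup>2"
  proof -
    have "continuous_on {-r..r} (\<lambda>y. (g y)\<^sup>2)" by (intro continuous_intros continuous_on_subset[OF g_cont]) auto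
    then have "\<exists>y0\<in>{-r..r}. \<forall>y\<in>{-r..r}. (g y0)\<^sup>2 \<le> (g y)\<^sup>2"
      using r0 by (intro continuous_attains_inf) auto
    with that show ?thesis by blast
  qed
  define d where "d = (g y0)\<^sup>2"
  have d: "d > 0" using g_bound[of y0] by (simp add: d_def)
  have lim: "d * (\<Sum>i=1..N. (v i)\<^sup>2) \<le> (\<integral>\<xi>. (g (synth N x \<xi>) * (\<Sum>i\<in>{1..N}. v i * eigenfun i \<xi>))\<^sup>2 \<partial>unit_lebesgue)"
    if "\<forall>i\<in>{1..N}. \<bar>x i\<bar> \<le> R" for x v
  proof -
    have "(\<Sum>i=1..N. (v i)\<^sup>2) = (\<integral>\<xi>. (synth N v \<xi>)\<^sup>2 \<partial>unit_lebesgue)"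
      using L2_inner_synth_synth[of N v v] by (simp add: L2_inner_def power2_eq_square)
    then have "d * (\<Sum>i=1..N. (v i)\<^sup>2) = (\<integral>\<xi>. d * (synth N v \<xi>)\<^sup>2 \<partial>unit_lebesgue)" by simp
    also have "\<dots> \<le> (\<integral>\<xi>. (g (synth N x \<xi>) * synth N v \<xi>)\<^sup>2 \<partial>unit_lebesgue)"
    proof (intro integral_mono cont_unit(2) continuous_intros cont_g)
      fix \<xi>
      have "d \<le> (g (synth N x \<xi>))\<^sup>2" unfolding d_def using sy[OF that, of \<xi>] by (intro y0(2)) (auto simp: abs_le_iff)
      then show "d * (synth N v \<xi>)\<^sup>2 \<le> (g (synth N x \<xi>) * synth N v \<xi>)\<^sup>2"
        unfolding power_mult_distrib by (rule mult_right_mono) simp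
    qed
    finally show ?thesis by (simp add: synth_def)
  qed
  define O' where "O' n = {p. d / 2 < gram n (fst p) (snd p)}" for n
  have "open (O' n)" for n
  proof -
    have fs: "continuous_on UNIV (\<lambda>p::(nat \<Rightarrow> real) \<times> (nat \<Rightarrow> real). noise_coef k (fst p) i)"
      "continuous_on UNIV (\<lambda>p::(nat \<Rightarrow> real) \<times> (nat \<Rightarrow> real). snd p i)" for k i
      using continuous_on_compose2[OF continuous_noise_coef continuous_on_fst[OF continuous_on_id]]
        continuous_on_compose2[OF continuous_on_product_coordinates continuous_on_snd[OF continuous_on_id]] by auto
    show ?thesis unfolding O'_def gram_def by (intro open_Collect_less continuous_intros fs)
  qed
  moreover have "B R \<times> U \<subseteq> (\<Union>n\<in>UNIV. O' n)"
  proof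
    fix p assume p: "p \<in> B R \<times> U"
    obtain x v where [simp]: "p = (x, v)" by (cases p)
    have x: "\<forall>i\<in>{1..N}. \<bar>x i\<bar> \<le> R" and v: "(\<Sum>i=1..N. (v i)\<^sup>2) = 1"
      using p by (auto simp: B_def U_def split: if_splits)
    have "d \<le> (\<integral>\<xi>. (g (synth N x \<xi>) * (\<Sum>i\<in>{1..N}. v i * eigenfun i \<xi>))\<^sup>2 \<partial>unit_lebesgue)"
      using lim[OF x, of v] unfolding v by simp
    moreover have "(\<lambda>n. gram n x v) \<longlonglongrightarrow> (\<integral>\<xi>. (g (synth N x \<xi>) * (\<Sum>i\<in>{1..N}. v i * eigenfun i \<xi>))\<^sup>2 \<partial>unit_lebesgue)"
      using noise_coef_sums[where v=v and x=x and I="{1..N}"] unfolding gram_def sums_def .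
    ultimately have "eventually (\<lambda>n. d / 2 < gram n x v) sequentially"
      using d by (intro order_tendstoD(1)) auto
    then show "p \<in> (\<Union>n\<in>UNIV. O' n)" by (auto simp: O'_def eventually_sequentially)
  qed
  ultimately obtain C where C: "finite C" "B R \<times> U \<subseteq> (\<Union>n\<in>C. O' n)"
    using compactE_image[OF cP, of UNIV O'] by (metis UNIV_I)
  define n where "n = Max (insert 0 C)"
  have gm: "gram m x v \<le> gram n x v" if "m \<in> C" for m x v
    unfolding gram_def using that C by (intro sum_mono2) (auto simp: n_def intro: less_le_trans)
  have unit: "d / 2 \<le> gram n x v" if "x \<in> B R" "v \<in> U" for x v
  proof -
    have "(x, v) \<in> (\<Union>n\<in>C. O' n)" using that C by blast
    then obtain m where "m \<in> C" "d / 2 < gram m x v" by (auto simp: O'_def)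
    with gm[of m x v] show ?thesis by simp
  qed
  have "d / 2 * (\<Sum>i=1..N. (v i)\<^sup>2) \<le> gram n x v" if x: "\<forall>i\<in>{1..N}. \<bar>x i\<bar> \<le> R" for x v
  proof -
    \<comment> \<open>The form sees only the entries 1 to N and is homogeneous of degree 2 in
      \<open>v\<close>; zeroing the other entries and scaling \<open>v\<close> moves the pair into
      the compact set.\<close>
    define x' where "x' i = (if i \<in> {1..N} then x i else 0)" for i
    define s where "s = sqrt (\<Sum>i=1..N. (v i)\<^sup>2)"
    have s2: "s\<^sup>2 = (\<Sum>i=1..N. (v i)\<^sup>2)" by (simp add: s_def sum_nonneg)
    show ?thesis
    proof (cases "s = 0")
      case True
      then have "(\<Sum>i=1..N. (v i)\<^sup>2) = 0" using s2 by simp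
      then show ?thesis by (simp add: gram_def sum_nonneg)
    next
      case False
      then have s: "s > 0" by (simp add: s_def order_less_le sum_nonneg)
      define v' where "v' i = (if i \<in> {1..N} then v i / s else 0)" for i
      have v1: "(\<Sum>i=1..N. (v' i)\<^sup>2) = 1"
      proof -
        have "(\<Sum>i=1..N. (v' i)\<^sup>2) = (\<Sum>i=1..N. (v i)\<^sup>2) / s\<^sup>2"
          unfolding sum_divide_distrib by (intro sum.cong) (auto simp: v'_def power_divide)
        then show ?thesis unfolding s2[symmetric] using s by simp
      qed
      have "\<bar>v' i\<bar> \<le> 1" if "i \<in> {1..N}" for i
      proof -
        have "(v' i)\<^sup>2 \<le> 1\<^sup>2" using member_le_sum[of i "{1..N}" "\<lambda>i. (v' i)\<^sup>2"] that v1 by simp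
        then show ?thesis using abs_le_square_iff[of "v' i" 1] by simp
      qed
      moreover have "v' i = 0" if "i \<notin> {1..N}" for i using that unfolding v'_def by (rule if_not_P)
      ultimately have "v' \<in> U" using v1 by (auto simp: U_def B_def)
      moreover have "x' \<in> B R" using x by (auto simp: B_def x'_def)
      ultimately have "d / 2 \<le> gram n x' v'" using unit by blast
      also have "gram n x' v' = gram n x v / s\<^sup>2"
      proof -
        have "noise_coef k x' = noise_coef k x" for k by (rule noise_coef_cong) (simp add: x'_def)
        moreover have "(\<Sum>i=1..N. v' i * a i) = (\<Sum>i=1..N. v i * a i) / s" for a
          unfolding sum_divide_distrib by (intro sum.cong) (auto simp: v'_def)
        ultimately have "gram n x' v' = (\<Sum>k<n. (\<Sum>i=1..N. v i * noise_coef k x i)\<^sup>2 / s\<^sup>2)"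
          by (simp only: gram_def power_divide)
        then show ?thesis by (simp only: gram_def sum_divide_distrib)
      qed
      finally show ?thesis unfolding s2[symmetric] using s by (simp add: field_simps)
    qed
  qed
  with d show ?thesis by (intro exI[of _ n] exI[of _ "d / 2"]) auto
qed

text \<open>The minimum-norm preimage h = A^T a, where A A^T a is the l-th unit vector. Then |h|^2 =
  \<open>gram n x a\<close> = \<open>a l\<close>, while \<delta> (a l)^2 <= \<open>a l\<close> by
  coercivity. So |h|^2 <= 1/\<delta> independently of the state, and 1 + 1/\<delta> avoids a square
  root.\<close>

lemma ex_right_inverse:
  assumes \<delta>: "\<delta> > 0" and gram: "\<And>v. \<delta> * (\<Sum>i=1..N. (v i)\<^sup>2) \<le> gram n x v" and l: "l \<in> {1..N}"
  shows "\<exists>h. (\<forall>j\<in>{1..N}. (\<Sum>k<n. noise_coef k x j * h k) = (if j = l then 1 else 0)) \<and> (\<forall>k<n. \<bar>h k\<bar> \<le> 1 + 1 / \<delta>)"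
proof -
  let ?h = "\<lambda>a k. \<Sum>i=1..N. a i * noise_coef k x i"
  let ?G = "\<lambda>a j. \<Sum>k<n. noise_coef k x j * ?h a k"
  have "\<exists>a. (\<forall>k. k \<notin> {1..N} \<longrightarrow> a k = 0) \<and> (\<forall>j\<in>{1..N}. ?G a j = (if j = l then 1 else 0))"
  proof (rule coercive_gradient_surj[where \<Psi>="\<lambda>a. gram n x a / 2" and \<gamma>="\<delta> / 2"])
    show "continuous_on UNIV (\<lambda>a. gram n x a / 2)"
      unfolding gram_def by (intro continuous_intros continuous_on_product_coordinates) auto
    show "\<delta> / 2 * (\<Sum>k\<in>{1..N}. (c k)\<^sup>2) \<le> gram n x c / 2" for c using gram[of c] by simp
    show "((\<lambda>t. gram n x (c(j := t)) / 2) has_real_derivative ?G c j) (at (c j))" if j: "j \<in> {1..N}" for c j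
    proof -
      have e: "?h (c(j := t)) k = ?h c k + (t - c j) * noise_coef k x j" for t k
        using j by (subst (1 2) sum.remove[of _ j]) (auto intro!: sum.cong simp: algebra_simps)
      show ?thesis unfolding gram_def e
        by (auto intro!: derivative_eq_intros sum.cong simp: sum_distrib_left sum_divide_distrib mult_ac)
    qed
  qed (use \<delta> in \<open>auto simp: gram_def\<close>)
  then obtain a where a: "\<And>j. j \<in> {1..N} \<Longrightarrow> ?G a j = (if j = l then 1 else 0)" by blast
  have "gram n x a = (\<Sum>j=1..N. a j * ?G a j)"
  proof -
    have "gram n x a = (\<Sum>k<n. \<Sum>j=1..N. a j * (noise_coef k x j * ?h a k))"
      unfolding gram_def by (intro sum.cong refl) (simp add: power2_eq_square sum_distrib_right mult.assoc)
    also have "\<dots> = (\<Sum>j=1..N. a j * ?G a j)" by (subst sum.swap) (simp add: sum_distrib_left)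
    finally show ?thesis .
  qed
  also have "\<dots> = (\<Sum>j=1..N. if j = l then a j else 0)"
  proof (intro sum.cong refl)
    fix j assume "j \<in> {1..N}"
    then show "a j * ?G a j = (if j = l then a j else 0)" by (simp only: a) simp
  qed
  also have "\<dots> = a l" using l by simp
  finally have ga: "gram n x a = a l" .
  have al0: "0 \<le> a l" unfolding ga[symmetric] gram_def by (intro sum_nonneg) auto
  have "\<delta> * (a l)\<^sup>2 \<le> \<delta> * (\<Sum>i=1..N. (a i)\<^sup>2)"
    using \<delta> l by (intro mult_left_mono member_le_sum) auto
  also have "\<dots> \<le> a l" using gram[of a] ga by simp
  finally have "\<delta> * a l * a l \<le> 1 * a l" by (simp add: power2_eq_square)
  then have al: "a l \<le> 1 / \<delta>" using al0 \<delta> by (cases "a l = 0") (auto simp: field_simps)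
  have "\<bar>?h a k\<bar> \<le> 1 + 1 / \<delta>" if "k < n" for k
  proof -
    have "(?h a k)\<^sup>2 \<le> gram n x a" unfolding gram_def using that by (intro member_le_sum) auto
    also have "\<dots> \<le> 1 / \<delta>" using ga al by simp
    also have "y \<le> (1 + y)\<^sup>2" if "0 \<le> y" for y :: real
      using that zero_le_power2[of y] by (simp add: power2_sum)
    then have "1 / \<delta> \<le> (1 + 1 / \<delta>)\<^sup>2" using \<delta> by simp
    finally have "(?h a k)\<^sup>2 \<le> (1 + 1 / \<delta>)\<^sup>2" .
    then show ?thesis using \<delta> abs_le_square_iff[of "?h a k" "1 + 1 / \<delta>"] by simp
  qed
  with a show ?thesis by (intro exI[of _ "?h a"]) auto
qed

text \<open>Since \<open>cutoff m x\<close> is at least \<open>m\<close>, all shifted terms are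
  included from some \<open>m\<close> on. Convergence is assumed because \<open>lim\<close> is
  unspecified otherwise.\<close>

lemma noise_sum_shift:
  assumes "convergent (\<lambda>m. psum (cutoff m x) x w i)"
  shows "noise_sum x (shift n h w) i = noise_sum x w i + (\<Sum>k<n. noise_coef k x i * h k)"
proof -
  have "(\<lambda>m. psum (cutoff m x) x w i) \<longlonglongrightarrow> noise_sum x w i"
    using assms unfolding noise_sum_def by (simp add: convergent_LIMSEQ_iff)
  then have "(\<lambda>m. psum (cutoff m x) x w i + (\<Sum>k<n. noise_coef k x i * h k)) \<longlonglongrightarrow> noise_sum x w i + (\<Sum>k<n. noise_coef k x i * h k)"
    by (intro tendsto_intros)
  moreover have "eventually (\<lambda>m. psum (cutoff m x) x (shift n h w) i = psum (cutoff m x) x w i + (\<Sum>k<n. noise_coef k x i * h k)) sequentially"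
    using eventually_ge_at_top[of n]
  proof eventually_elim
    case (elim m)
    then have "n \<le> cutoff m x" using cutoff_ge[of m x] by simp
    then have "(\<Sum>k<cutoff m x. if k < n then noise_coef k x i * h k else 0) = (\<Sum>k<n. noise_coef k x i * h k)"
      by (intro sum.mono_neutral_cong_right) auto
    then show ?case by (simp add: psum_def shift_def distrib_left sum.distrib if_distrib[of "\<lambda>y. _ * y"] cong: if_cong)
  qed
  ultimately have "(\<lambda>m. psum (cutoff m x) x (shift n h w) i) \<longlonglongrightarrow> noise_sum x w i + (\<Sum>k<n. noise_coef k x i * h k)"
    by (subst tendsto_cong) auto
  then show ?thesis unfolding noise_sum_def[of x "shift n h w"] by (rule limI)
qed

lemma measurable_noise_sum_right: "(\<lambda>w. noise_sum x w i) \<in> borel_measurable borel"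
  using measurable_compose[OF _ measurable_noise_sum_component, of "\<lambda>w. (x, w)"] by simp

lemma measurable_noise_sum_sets:
  "{w. \<bar>noise_sum x w i\<bar> \<le> \<rho>} \<in> sets borel" "{w. convergent (\<lambda>m. psum (cutoff m x) x w i)} \<in> sets borel"
proof -
  note [measurable] = measurable_noise_sum_right
  have "{w \<in> space borel. \<bar>noise_sum x w i\<bar> \<le> \<rho>} \<in> sets borel" by measurable
  then show "{w. \<bar>noise_sum x w i\<bar> \<le> \<rho>} \<in> sets borel" by simp
  have [measurable]: "(\<lambda>w. psum n x w i) \<in> borel_measurable borel" for n unfolding psum_def by measurable
  have "{w \<in> space borel. convergent (\<lambda>m. psum (cutoff m x) x w i)} \<in> sets borel"
    unfolding Cauchy_convergent_iff[symmetric] by (rule sets_Collect_Cauchy) measurable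
  then show "{w. convergent (\<lambda>m. psum (cutoff m x) x w i)} \<in> sets borel" by simp
qed

text \<open>Shifting the noise by the finitely supported preimage of a vector \<open>v\<close> under \<open>w \<mapsto> noise_sum x w\<close> shifts
  \<open>noise_sum\<close> by \<open>v\<close>. Averaging over \<open>v\<close> in a box with respect to Lebesgue measure then bounds the law
  of \<open>x + noise_sum x w\<close> from below by Lebesgue measure, without computing a Gaussian density.\<close>

lemma noise_minorisation:
  assumes R: "R \<ge> 0"
  shows "\<exists>\<alpha>>0. \<forall>x \<phi>. (\<forall>i\<in>{1..N}. \<bar>x i\<bar> \<le> R) \<longrightarrow> \<phi> \<in> borel_measurable borel \<longrightarrow>
    (\<forall>y y'. (\<forall>i\<in>{1..N}. y i = y' i) \<longrightarrow> \<phi> y = \<phi> y') \<longrightarrow>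
    ennreal \<alpha> * (\<integral>\<^sup>+v. \<phi> v * indicator (Pi\<^sub>E {1..N} (\<lambda>_. {0..1})) v \<partial>lborel_on {1..N})
      \<le> (\<integral>\<^sup>+w. \<phi> (\<lambda>i. x i + noise_sum x w i) \<partial>white_noise \<sigma>)"
proof -
  let ?I = "{1..N}"
  obtain n \<delta> where \<delta>: "\<delta> > 0" and gram: "\<And>x v. (\<forall>i\<in>?I. \<bar>x i\<bar> \<le> R) \<Longrightarrow> \<delta> * (\<Sum>i=1..N. (v i)\<^sup>2) \<le> gram n x v"
    using gram_lower_bound[OF R] by blast
  \<comment> \<open>Chebyshev levels: some |w k| exceeds \<open>B\<close> with probability at most
    1/4, and likewise some |noise_sum| exceeds \<open>\<rho>\<close>. The form 1 + 4y has both value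
    at least 1 and square at least 4y.\<close>
  define B where "B = 1 + 4 * real n * \<sigma>\<^sup>2"
  define q2 where "q2 = \<sigma>\<^sup>2 * (real N * K6\<^sup>2)"
  define \<rho> where "\<rho> = 1 + 4 * real N * q2"
  have q2: "q2 \<ge> 0" by (simp add: q2_def)
  have B: "B \<ge> 1" "4 * (real n * \<sigma>\<^sup>2) \<le> B\<^sup>2" and \<rho>: "\<rho> \<ge> 1" "4 * (real N * q2) \<le> \<rho>\<^sup>2"
  proof -
    show B1: "B \<ge> 1" by (simp add: B_def)
    show r1: "\<rho> \<ge> 1" using q2 by (simp add: \<rho>_def)
    have "4 * (real n * \<sigma>\<^sup>2) \<le> B * 1" by (simp add: B_def)
    also have "\<dots> \<le> B\<^sup>2" unfolding power2_eq_square using B1 by (intro mult_left_mono) auto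
    finally show "4 * (real n * \<sigma>\<^sup>2) \<le> B\<^sup>2" .
    have "4 * (real N * q2) \<le> \<rho> * 1" by (simp add: \<rho>_def)
    also have "\<dots> \<le> \<rho>\<^sup>2" unfolding power2_eq_square using r1 by (intro mult_left_mono) auto
    finally show "4 * (real N * q2) \<le> \<rho>\<^sup>2" .
  qed
  \<comment> \<open>A shift that carries x + noise into the unit cube has entries of size at most R
    + \<rho> + 1, so it lies in the box of half-width \<open>r\<close>.\<close>
  define r where "r = R + \<rho> + 1"
  have r: "r \<ge> 1" using R \<rho> by (simp add: r_def)
  define H where "H = real N * (r * (1 + 1 / \<delta>))"
  define c where "c = exp (- (real n * (H * B / \<sigma>\<^sup>2 + H\<^sup>2 / (2 * \<sigma>\<^sup>2))))"
  \<comment> \<open>\<open>c\<close> is the lower bound of the shift density, 1/2 that of the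
    probability of the good event \<open>D\<close>, and (2r)^N is the volume of the box of
    shifts.\<close>
  define \<alpha> where "\<alpha> = c / 2 / (2 * r) ^ N"
  have \<alpha>: "\<alpha> > 0" using r by (simp add: \<alpha>_def c_def)
  have "ennreal \<alpha> * (\<integral>\<^sup>+v. \<phi> v * indicator (Pi\<^sub>E ?I (\<lambda>_. {0..1})) v \<partial>lborel_on ?I)
      \<le> (\<integral>\<^sup>+w. \<phi> (\<lambda>i. x i + noise_sum x w i) \<partial>white_noise \<sigma>)"
    if x: "\<forall>i\<in>?I. \<bar>x i\<bar> \<le> R" and \<phi>: "\<phi> \<in> borel_measurable borel"
      and loc: "\<forall>y y'. (\<forall>i\<in>?I. y i = y' i) \<longrightarrow> \<phi> y = \<phi> y'" for x and \<phi> :: "(nat \<Rightarrow> real) \<Rightarrow> ennreal"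
  proof -
    note [measurable] = \<phi>
    have "\<forall>l\<in>?I. \<exists>h. (\<forall>j\<in>?I. (\<Sum>k<n. noise_coef k x j * h k) = (if j = l then 1 else 0)) \<and> (\<forall>k<n. \<bar>h k\<bar> \<le> 1 + 1 / \<delta>)"
      using ex_right_inverse[OF \<delta> gram[OF x]] by blast
    then obtain d where d: "\<And>l j. l \<in> ?I \<Longrightarrow> j \<in> ?I \<Longrightarrow> (\<Sum>k<n. noise_coef k x j * d l k) = (if j = l then 1 else 0)"
      and dle: "\<And>l k. l \<in> ?I \<Longrightarrow> k < n \<Longrightarrow> \<bar>d l k\<bar> \<le> 1 + 1 / \<delta>"
      by (metis bchoice)
    define h where "h v k = (\<Sum>l=1..N. v l * d l k)" for v k
    have hA: "(\<Sum>k<n. noise_coef k x j * h v k) = v j" if j: "j \<in> ?I" for v j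
    proof -
      have "(\<Sum>k<n. noise_coef k x j * h v k) = (\<Sum>l=1..N. v l * (\<Sum>k<n. noise_coef k x j * d l k))"
        unfolding h_def sum_distrib_left by (subst sum.swap) (simp add: mult_ac)
      also have "\<dots> = (\<Sum>l=1..N. if l = j then v l else 0)"
      proof (intro sum.cong refl)
        fix l assume "l \<in> ?I"
        then show "v l * (\<Sum>k<n. noise_coef k x j * d l k) = (if l = j then v l else 0)" by (simp only: d[OF _ j]) simp
      qed
      finally show ?thesis using j by simp
    qed
    \<comment> \<open>The good event: bounded noise and noise sum, together with the convergence
      that \<open>noise_sum_shift\<close> requires.\<close>
    define D where "D = (\<Inter>k\<in>{..<n}. {w. \<bar>w k\<bar> \<le> B}) \<inter> (\<Inter>i\<in>?I. {w. \<bar>noise_sum x w i\<bar> \<le> \<rho>} \<inter> {w. convergent (\<lambda>m. psum (cutoff m x) x w i)})"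
    have D [measurable]: "D \<in> sets borel"
    proof -
      have 1: "{w :: nat \<Rightarrow> real. \<bar>w k\<bar> \<le> B} \<in> sets borel" for k
      proof -
        have "{w :: nat \<Rightarrow> real. \<bar>w k\<bar> \<le> B} = {w \<in> space borel. \<bar>w k\<bar> \<le> B}" by simp
        then show ?thesis by simp
      qed
      have "(\<Inter>k\<in>{..<n}. {w. \<bar>w k\<bar> \<le> B}) = (\<Inter>k\<in>{..<n}. {w. \<bar>w k\<bar> \<le> B}) \<inter> (UNIV :: (nat \<Rightarrow> real) set)" by simp
      also have "\<dots> \<in> sets borel" using 1 sets.countable_INT'[of "{..<n}" "\<lambda>k. {w :: nat \<Rightarrow> real. \<bar>w k\<bar> \<le> B}" borel]
        by (cases "n = 0") auto
      finally have 2: "(\<Inter>k\<in>{..<n}. {w :: nat \<Rightarrow> real. \<bar>w k\<bar> \<le> B}) \<in> sets borel" .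
      have 3: "(\<Inter>i\<in>?I. {w. \<bar>noise_sum x w i\<bar> \<le> \<rho>} \<inter> {w. convergent (\<lambda>m. psum (cutoff m x) x w i)}) \<in> sets borel"
        using measurable_noise_sum_sets by (cases "?I = {}") (auto intro!: sets.finite_INT)
      show ?thesis unfolding D_def by (rule sets.Int[OF 2 3])
    qed
    have PD: "1 / 2 \<le> emeasure (white_noise \<sigma>) D"
    proof -
      \<comment> \<open>Off \<open>D\<close> some summand of \<open>?X\<close> is almost surely at
        least 1, so integrating 1 <= 1_D + X bounds the probability of \<open>D\<close> from
        below.\<close>
      let ?X = "\<lambda>w. (\<Sum>k<n. ennreal ((w k)\<^sup>2 / B\<^sup>2)) + (\<Sum>i=1..N. ennreal ((noise_sum x w i)\<^sup>2 / \<rho>\<^sup>2))"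
      note [measurable] = measurable_noise_sum_right
      have "1 = (\<integral>\<^sup>+w. 1 \<partial>white_noise \<sigma>)" using emeasure_space_1 by simp
      also have "\<dots> \<le> (\<integral>\<^sup>+w. indicator D w + ?X w \<partial>white_noise \<sigma>)"
      proof (rule nn_integral_mono_AE)
        have "AE w in white_noise \<sigma>. \<forall>i\<in>?I. convergent (\<lambda>m. psum (cutoff m x) x w i)"
          using AE_convergent by (subst AE_finite_all) auto
        then show "AE w in white_noise \<sigma>. 1 \<le> indicator D w + ?X w"
        proof eventually_elim
          case (elim w)
          show ?case
          proof (cases "w \<in> D")
            case False
            then consider k where "k < n" "B < \<bar>w k\<bar>" | i where "i \<in> ?I" "\<rho> < \<bar>noise_sum x w i\<bar>"
              using elim unfolding D_def by (auto simp: not_le)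
            then have "1 \<le> ?X w"
            proof cases
              case 1
              have "B\<^sup>2 \<le> (w k)\<^sup>2" using 1 B by (simp add: abs_le_square_iff[symmetric])
              then have "ennreal 1 \<le> ennreal ((w k)\<^sup>2 / B\<^sup>2)" using B by (intro ennreal_leI) (simp add: field_simps)
              also have "\<dots> \<le> (\<Sum>k<n. ennreal ((w k)\<^sup>2 / B\<^sup>2))" using 1 by (intro member_le_sum) auto
              finally show ?thesis by (simp add: add_increasing2)
            next
              case 2
              have "\<rho>\<^sup>2 \<le> (noise_sum x w i)\<^sup>2" using 2 \<rho> by (simp add: abs_le_square_iff[symmetric])
              then have "ennreal 1 \<le> ennreal ((noise_sum x w i)\<^sup>2 / \<rho>\<^sup>2)" using \<rho> by (intro ennreal_leI) (simp add: field_simps)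
              also have "\<dots> \<le> (\<Sum>i=1..N. ennreal ((noise_sum x w i)\<^sup>2 / \<rho>\<^sup>2))" using 2 by (intro member_le_sum) auto
              finally show ?thesis by (simp add: add_increasing)
            qed
            then show ?thesis by (simp add: add_increasing)
          qed simp
        qed
      qed
      also have "\<dots> = emeasure (white_noise \<sigma>) D + ((\<Sum>k<n. \<integral>\<^sup>+w. ennreal ((w k)\<^sup>2 / B\<^sup>2) \<partial>white_noise \<sigma>)
          + (\<Sum>i=1..N. \<integral>\<^sup>+w. ennreal ((noise_sum x w i)\<^sup>2 / \<rho>\<^sup>2) \<partial>white_noise \<sigma>))"
        by (simp add: nn_integral_add nn_integral_sum del: sum_ennreal)
      also have "\<dots> \<le> emeasure (white_noise \<sigma>) D + ((\<Sum>k<n. ennreal (\<sigma>\<^sup>2 / B\<^sup>2)) + (\<Sum>i=1..N. ennreal (q2 / \<rho>\<^sup>2)))"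
      proof (intro add_mono sum_mono order_refl)
        fix k
        have "(\<integral>\<^sup>+w. ennreal ((w k)\<^sup>2) \<partial>white_noise \<sigma>) = ennreal (\<sigma>\<^sup>2)"
          using second_moment[of "{k}" "\<lambda>_. 1"] by simp
        then show "(\<integral>\<^sup>+w. ennreal ((w k)\<^sup>2 / B\<^sup>2) \<partial>white_noise \<sigma>) \<le> ennreal (\<sigma>\<^sup>2 / B\<^sup>2)"
          using B by (simp add: divide_ennreal[symmetric] nn_integral_divide)
      next
        fix i assume "i \<in> ?I"
        then have "(\<integral>\<^sup>+w. ennreal ((noise_sum x w i)\<^sup>2) \<partial>white_noise \<sigma>) \<le> ennreal q2"
          unfolding q2_def by (rule noise_sum_second_moment)
        then show "(\<integral>\<^sup>+w. ennreal ((noise_sum x w i)\<^sup>2 / \<rho>\<^sup>2) \<partial>white_noise \<sigma>) \<le> ennreal (q2 / \<rho>\<^sup>2)"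
          using \<rho> q2 by (simp add: divide_ennreal[symmetric] nn_integral_divide divide_right_mono_ennreal)
      qed
      also have "(\<Sum>k<n. ennreal (\<sigma>\<^sup>2 / B\<^sup>2)) + (\<Sum>i=1..N. ennreal (q2 / \<rho>\<^sup>2)) = ennreal (real n * (\<sigma>\<^sup>2 / B\<^sup>2) + real N * (q2 / \<rho>\<^sup>2))"
        using q2 by (simp add: ennreal_plus ennreal_mult[symmetric] ennreal_of_nat_eq_real_of_nat)
      also have "\<dots> \<le> ennreal (1 / 2)"
      proof (rule ennreal_leI)
        have "real n * (\<sigma>\<^sup>2 / B\<^sup>2) \<le> 1 / 4" using B by (simp add: field_simps)
        moreover have "real N * (q2 / \<rho>\<^sup>2) \<le> 1 / 4" using \<rho> by (simp add: field_simps)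
        ultimately show "real n * (\<sigma>\<^sup>2 / B\<^sup>2) + real N * (q2 / \<rho>\<^sup>2) \<le> 1 / 2" by linarith
      qed
      finally have "1 \<le> ennreal (measure (white_noise \<sigma>) D) + ennreal (1 / 2)"
        by (simp add: emeasure_eq_measure)
      then have "ennreal 1 \<le> ennreal (measure (white_noise \<sigma>) D + 1 / 2)" by (simp add: ennreal_plus)
      then have "1 \<le> measure (white_noise \<sigma>) D + 1 / 2" by (subst (asm) ennreal_le_iff) auto
      then have "ennreal (1 / 2) \<le> ennreal (measure (white_noise \<sigma>) D)" by (intro ennreal_leI) simp
      then show ?thesis by (simp add: emeasure_eq_measure ennreal_divide_numeral[symmetric] del: ennreal_half)
    qed
    let ?L = "lborel_on ?I" and ?Q = "Pi\<^sub>E ?I (\<lambda>_. {0..1::real})" and ?B' = "Pi\<^sub>E ?I (\<lambda>_. {-r..r})"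
    let ?P = "\<integral>\<^sup>+w. \<phi> (\<lambda>i. x i + noise_sum x w i) \<partial>white_noise \<sigma>"
    have mS: "(\<lambda>w. noise_sum x w) \<in> borel \<rightarrow>\<^sub>M borel"
      by (rule measurable_coordinatewise_then_product) (rule measurable_noise_sum_right)
    have mxS [measurable]: "(\<lambda>w i. x i + noise_sum x w i) \<in> borel \<rightarrow>\<^sub>M borel"
      by (rule measurable_coordinatewise_then_product) (use measurable_noise_sum_right in simp)
    have Qs [measurable]: "?Q \<in> sets ?L" "?B' \<in> sets ?L" by (auto intro!: sets_PiM_I_finite)
    have mv: "(\<lambda>v. v i) \<in> borel_measurable ?L" for i
      using measurable_compose[OF measurable_lborel_on_id measurable_coordinate] .
    have mj [measurable]: "(\<lambda>p i. x i + noise_sum x (snd p) i + fst p i) \<in> ?L \<Otimes>\<^sub>M white_noise \<sigma> \<rightarrow>\<^sub>M borel"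
    proof (rule measurable_coordinatewise_then_product)
      fix i
      have "(\<lambda>p. fst p i) \<in> borel_measurable (?L \<Otimes>\<^sub>M white_noise \<sigma>)"
        by (rule measurable_compose[OF measurable_fst mv])
      moreover have "(\<lambda>p. noise_sum x (snd p) i) \<in> borel_measurable (?L \<Otimes>\<^sub>M white_noise \<sigma>)"
        by (rule measurable_compose[OF measurable_snd]) (use measurable_noise_sum_right in \<open>simp cong: measurable_cong_sets\<close>)
      ultimately show "(\<lambda>p. x i + noise_sum x (snd p) i + fst p i) \<in> borel_measurable (?L \<Otimes>\<^sub>M white_noise \<sigma>)" by simp
    qed
    \<comment> \<open>For fixed \<open>v\<close>, shifting a noise in \<open>D\<close> by
      \<open>h v\<close> shifts the state by exactly \<open>v\<close>; passing back to the unshifted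
      law costs the factor \<open>c\<close>.\<close>
    have one_v: "ennreal c * (\<integral>\<^sup>+w. \<phi> (\<lambda>i. x i + noise_sum x w i + v i) * indicator D w \<partial>white_noise \<sigma>) \<le> ?P"
      if v: "v \<in> ?B'" for v
    proof -
      have hle: "\<bar>h v k\<bar> \<le> H" if "k < n" for k
      proof -
        have "\<bar>h v k\<bar> \<le> (\<Sum>l=1..N. \<bar>v l * d l k\<bar>)" unfolding h_def by (rule sum_abs)
        also have "\<dots> \<le> (\<Sum>l=1..N. r * (1 + 1 / \<delta>))"
        proof (rule sum_mono)
          fix l assume l: "l \<in> ?I"
          then have "v l \<in> {-r..r}" by (rule PiE_mem[OF v])
          then have "\<bar>v l\<bar> \<le> r" by auto
          then show "\<bar>v l * d l k\<bar> \<le> r * (1 + 1 / \<delta>)"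
            unfolding abs_mult using dle[OF l that] r by (intro mult_mono) auto
        qed
        finally show ?thesis by (simp add: H_def)
      qed
      have "(\<integral>\<^sup>+w. \<phi> (\<lambda>i. x i + noise_sum x w i + v i) * indicator D w \<partial>white_noise \<sigma>)
          = (\<integral>\<^sup>+w. \<phi> (\<lambda>i. x i + noise_sum x (shift n (h v) w) i) * indicator D w \<partial>white_noise \<sigma>)"
      proof (rule nn_integral_cong)
        fix w
        show "\<phi> (\<lambda>i. x i + noise_sum x w i + v i) * indicator D w = \<phi> (\<lambda>i. x i + noise_sum x (shift n (h v) w) i) * indicator D w"
        proof (cases "w \<in> D")
          case True
          have "noise_sum x (shift n (h v) w) i = noise_sum x w i + v i" if "i \<in> ?I" for i
            using True that noise_sum_shift[of x w i n "h v"] hA[OF that] unfolding D_def by auto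
          then show ?thesis using loc by (intro arg_cong2[where f="(*)"] refl) (auto simp: add.assoc)
        qed simp
      qed
      also have "ennreal c * \<dots> \<le> ?P"
        unfolding c_def
      proof (rule nn_integral_shift_ge[where \<phi>="\<lambda>w. \<phi> (\<lambda>i. x i + noise_sum x w i)" and D=D, OF _ D])
        show "(\<lambda>w. \<phi> (\<lambda>i. x i + noise_sum x w i)) \<in> borel_measurable borel" by measurable
        show "\<bar>w k\<bar> \<le> B" if "w \<in> D" "k < n" for w k using that unfolding D_def by auto
      qed (rule hle)
      finally show ?thesis .
    qed
    interpret L: sigma_finite_measure ?L by (rule lborel_product.sigma_finite) simp
    interpret pL: pair_sigma_finite ?L "white_noise \<sigma>" ..
    let ?U = "\<integral>\<^sup>+v. \<phi> v * indicator ?Q v \<partial>?L"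
    \<comment> \<open>For a fixed noise in \<open>D\<close>, translation by x + noise turns the
      integral over the unit cube into one over shifts \<open>v\<close>, all of which lie in the
      box.\<close>
    have inner: "?U \<le> (\<integral>\<^sup>+v. \<phi> (\<lambda>i. x i + noise_sum x w i + v i) * indicator ?B' v \<partial>?L)" if w: "w \<in> D" for w
    proof -
      let ?z = "\<lambda>i. x i + noise_sum x w i"
      have "?U = (\<integral>\<^sup>+v. \<phi> (\<lambda>i\<in>?I. ?z i + v i) * indicator ?Q (\<lambda>i\<in>?I. ?z i + v i) \<partial>?L)"
        using measurable_compose[OF measurable_lborel_on_id \<phi>]
        by (subst lborel_on_translate[where z="?z"]) auto
      also have "\<dots> \<le> (\<integral>\<^sup>+v. \<phi> (\<lambda>i. x i + noise_sum x w i + v i) * indicator ?B' v \<partial>?L)"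
      proof (intro nn_integral_mono mult_mono)
        fix v assume v: "v \<in> space ?L"
        have "\<phi> (\<lambda>i\<in>?I. ?z i + v i) = \<phi> (\<lambda>i. ?z i + v i)" using loc by auto
        then show "\<phi> (\<lambda>i\<in>?I. ?z i + v i) \<le> \<phi> (\<lambda>i. x i + noise_sum x w i + v i)" by simp
        have "v \<in> ?B'" if "(\<lambda>i\<in>?I. ?z i + v i) \<in> ?Q"
        proof -
          have "v i \<in> {-r..r}" if i: "i \<in> ?I" for i
          proof -
            have "?z i + v i \<in> {0..1}" using \<open>(\<lambda>i\<in>?I. ?z i + v i) \<in> ?Q\<close> i by (auto simp: PiE_iff)
            moreover have "\<bar>noise_sum x w i\<bar> \<le> \<rho>" "\<bar>x i\<bar> \<le> R" using w i x unfolding D_def by auto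
            ultimately show ?thesis by (auto simp: r_def)
          qed
          then show ?thesis using v by (auto simp: space_PiM PiE_iff)
        qed
        then show "(indicator ?Q (\<lambda>i\<in>?I. ?z i + v i) :: ennreal) \<le> indicator ?B' v" by (auto simp: indicator_def)
      qed auto
      finally show ?thesis .
    qed
    have mm: "(\<lambda>(v, w). \<phi> (\<lambda>i. x i + noise_sum x w i + v i) * indicator ?B' v * indicator D w) \<in> borel_measurable (?L \<Otimes>\<^sub>M white_noise \<sigma>)"
    proof -
      note measurable_compose[OF mj \<phi>, measurable]
      show ?thesis unfolding split_beta by measurable
    qed
    have volB: "emeasure ?L ?B' = ennreal ((2 * r) ^ N)"
      using r by (subst lborel_product.emeasure_PiM) (auto simp: ennreal_power)
    \<comment> \<open>\<open>one_v\<close> is averaged over the box: \<open>inner\<close> bounds the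
      average from below for each noise in \<open>D\<close>, and Fubini exchanges noise and
      shift.\<close>
    have "ennreal c * (ennreal (1 / 2) * ?U) \<le> ennreal c * (emeasure (white_noise \<sigma>) D * ?U)"
      using PD by (intro mult_left_mono mult_right_mono) (auto simp: ennreal_divide_numeral[symmetric] simp del: ennreal_half)
    also have "emeasure (white_noise \<sigma>) D * ?U = (\<integral>\<^sup>+w. ?U * indicator D w \<partial>white_noise \<sigma>)"
      by (subst nn_integral_cmult_indicator) (auto simp: mult.commute)
    also have "\<dots> \<le> (\<integral>\<^sup>+w. (\<integral>\<^sup>+v. \<phi> (\<lambda>i. x i + noise_sum x w i + v i) * indicator ?B' v * indicator D w \<partial>?L) \<partial>white_noise \<sigma>)"
    proof (rule nn_integral_mono)
      fix w show "?U * indicator D w \<le> (\<integral>\<^sup>+v. \<phi> (\<lambda>i. x i + noise_sum x w i + v i) * indicator ?B' v * indicator D w \<partial>?L)"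
        using inner[of w] by (cases "w \<in> D") auto
    qed
    also have "\<dots> = (\<integral>\<^sup>+v. (\<integral>\<^sup>+w. \<phi> (\<lambda>i. x i + noise_sum x w i + v i) * indicator ?B' v * indicator D w \<partial>white_noise \<sigma>) \<partial>?L)"
      by (rule pL.Fubini'[OF mm])
    also have "ennreal c * \<dots> \<le> (\<integral>\<^sup>+v. ?P * indicator ?B' v \<partial>?L)"
    proof (subst nn_integral_cmult[symmetric])
      show "(\<lambda>v. \<integral>\<^sup>+w. \<phi> (\<lambda>i. x i + noise_sum x w i + v i) * indicator ?B' v * indicator D w \<partial>white_noise \<sigma>) \<in> borel_measurable ?L"
        by (rule borel_measurable_nn_integral[OF mm])
      show "(\<integral>\<^sup>+v. ennreal c * (\<integral>\<^sup>+w. \<phi> (\<lambda>i. x i + noise_sum x w i + v i) * indicator ?B' v * indicator D w \<partial>white_noise \<sigma>) \<partial>?L) \<le> (\<integral>\<^sup>+v. ?P * indicator ?B' v \<partial>?L)"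
      proof (rule nn_integral_mono)
        fix v
        show "ennreal c * (\<integral>\<^sup>+w. \<phi> (\<lambda>i. x i + noise_sum x w i + v i) * indicator ?B' v * indicator D w \<partial>white_noise \<sigma>) \<le> ?P * indicator ?B' v"
          using one_v[of v] by (cases "v \<in> ?B'") auto
      qed
    qed
    also have "\<dots> = ?P * ennreal ((2 * r) ^ N)" by (subst nn_integral_cmult_indicator, rule Qs) (simp only: volB)
    finally have main: "ennreal c * (ennreal (1 / 2) * ?U) \<le> ?P * ennreal ((2 * r) ^ N)"
      by (simp add: mult_left_mono)
    have rr: "(2 * r) ^ N > 0" using r by simp
    have "ennreal ((2 * r) ^ N) * (ennreal \<alpha> * ?U) = ennreal c * (ennreal (1 / 2) * ?U)"
    proof -
      have gen: "t * (a / 2 / t) = a * (1 / 2)" if "t > 0" for t a :: real using that by simp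
      have "ennreal ((2 * r) ^ N) * ennreal \<alpha> = ennreal ((2 * r) ^ N * \<alpha>)"
        by (rule ennreal_mult[symmetric]) (use less_imp_le[OF rr] less_imp_le[OF \<alpha>] in simp_all)
      also have "(2 * r) ^ N * \<alpha> = c * (1 / 2)" unfolding \<alpha>_def by (rule gen[OF rr])
      also have "ennreal (c * (1 / 2)) = ennreal c * ennreal (1 / 2)" by (rule ennreal_mult) (simp_all add: c_def)
      finally have "ennreal ((2 * r) ^ N) * ennreal \<alpha> = ennreal c * ennreal (1 / 2)" .
      then show ?thesis by (simp only: mult.assoc[symmetric])
    qed
    also have "\<dots> \<le> ennreal ((2 * r) ^ N) * ?P" using main by (simp add: mult.commute)
    finally have fin: "ennreal ((2 * r) ^ N) * (ennreal \<alpha> * ?U) \<le> ennreal ((2 * r) ^ N) * ?P" .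
    have "ennreal ((2 * r) ^ N) \<noteq> 0" using rr by (simp only: ennreal_eq_0_iff not_le)
    then show ?thesis using fin ennreal_mult_le_mult_iff[OF _ ennreal_neq_top] by blast
  qed
  with \<alpha> show ?thesis by blast
qed

end

subsection \<open>The transition kernel\<close>

locale euler_galerkin = implicit_step f \<epsilon> \<tau> N + noise_coefficients "sqrt \<tau>" b g K6 N
  for f :: "real \<Rightarrow> real" and \<epsilon> \<tau> :: real and N :: nat
    and b :: "nat \<Rightarrow> real \<Rightarrow> real" and g :: "real \<Rightarrow> real" and K6 :: real
begin

section \<open>Drift and minorisation of the explicit kernel\<close>

definition step_map :: "(nat \<Rightarrow> real) \<Rightarrow> (nat \<Rightarrow> real) \<Rightarrow> real \<Rightarrow> real" where
  "step_map x w = synth N (Jinv (\<lambda>i. x i + noise_sum x w i))"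

definition kernel :: "(real \<Rightarrow> real) \<Rightarrow> (real \<Rightarrow> real) measure" where
  "kernel u = distr (white_noise (sqrt \<tau>)) (VN_borel N) (step_map (coef u))"

lemma measurable_step_map [measurable]: "(\<lambda>p. step_map (fst p) (snd p)) \<in> borel \<Otimes>\<^sub>M borel \<rightarrow>\<^sub>M VN_borel N"
proof -
  have "(\<lambda>p i. fst p i + noise_sum (fst p) (snd p) i) \<in> borel \<Otimes>\<^sub>M borel \<rightarrow>\<^sub>M borel"
  proof (rule measurable_coordinatewise_then_product)
    fix i
    note [measurable] = measurable_noise_sum_component
    show "(\<lambda>p. fst p i + noise_sum (fst p) (snd p) i) \<in> borel_measurable (borel \<Otimes>\<^sub>M borel)" by measurable
  qed
  then show ?thesis unfolding step_map_def by measurable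
qed

lemma measurable_step_map_right [measurable]: "step_map x \<in> borel \<rightarrow>\<^sub>M VN_borel N"
  using measurable_compose[OF _ measurable_step_map, of "\<lambda>w. (x, w)" borel] by simp

lemma measurable_kernel: "kernel \<in> VN_borel N \<rightarrow>\<^sub>M prob_algebra (VN_borel N)"
  unfolding kernel_def
proof (rule measurable_distr_prob_space2)
  show "(\<lambda>u. white_noise (sqrt \<tau>)) \<in> VN_borel N \<rightarrow>\<^sub>M prob_algebra (white_noise (sqrt \<tau>))"
    by (rule measurable_const) (simp add: space_prob_algebra prob_space_axioms)
  have "(\<lambda>p. step_map (coef (fst p)) (snd p)) \<in> VN_borel N \<Otimes>\<^sub>M borel \<rightarrow>\<^sub>M VN_borel N"
    using measurable_compose[OF _ measurable_step_map, of "\<lambda>p. (coef (fst p), snd p)"] by simp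
  then show "(\<lambda>(u, w). step_map (coef u) w) \<in> VN_borel N \<Otimes>\<^sub>M white_noise (sqrt \<tau>) \<rightarrow>\<^sub>M VN_borel N"
    by (simp add: split_beta cong: measurable_cong_sets)
qed

definition energy :: "(real \<Rightarrow> real) \<Rightarrow> ennreal" where
  "energy u = ennreal (\<Sum>i=1..N. (coef u i)\<^sup>2)"

lemma measurable_energy [measurable]: "energy \<in> borel_measurable (VN_borel N)"
proof -
  note [measurable] = measurable_coef_component
  show ?thesis unfolding energy_def[abs_def] by measurable
qed

text \<open>N coordinates of the noise, each with second moment at most \<tau> N K6^2, plus twice
  the constant of \<open>Jinv_growth\<close>.\<close>

definition drift_bound :: real where
  "drift_bound = real N * (\<tau> * (real N * K6\<^sup>2)) + 2 * drift_const"

text \<open>\<open>Jinv_growth\<close> gives the factor 1/4 and (a + b)^2 <= 2 a^2 + 2 b^2 doubles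
  it, so twice the new energy is at most the old energy plus noise. Boundedness of \<open>g\<close>
  makes the noise term uniform in the state.\<close>

lemma kernel_drift: "2 * (\<integral>\<^sup>+v. energy v \<partial>kernel u) \<le> energy u + ennreal drift_bound"
proof -
  let ?x = "coef u"
  note [measurable] = measurable_noise_sum_right
  have dc: "drift_const \<ge> 0" unfolding drift_const_def using tau eps by simp
  have "2 * (\<integral>\<^sup>+v. energy v \<partial>kernel u) = (\<integral>\<^sup>+w. 2 * energy (step_map ?x w) \<partial>white_noise (sqrt \<tau>))"
    unfolding kernel_def by (subst nn_integral_distr) (auto simp: nn_integral_cmult cong: measurable_cong_sets)
  also have "\<dots> \<le> (\<integral>\<^sup>+w. (energy u + (\<Sum>i=1..N. ennreal ((noise_sum ?x w i)\<^sup>2))) + ennreal (2 * drift_const) \<partial>white_noise (sqrt \<tau>))"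
  proof (rule nn_integral_mono)
    fix w
    have "2 * (\<Sum>i=1..N. (coef (step_map ?x w) i)\<^sup>2) = 2 * (\<Sum>i=1..N. (Jinv (\<lambda>i. ?x i + noise_sum ?x w i) i)\<^sup>2)"
      by (intro arg_cong[where f="(*) 2"] sum.cong refl) (simp add: step_map_def coef_synth)
    also have "\<dots> \<le> 2 * ((\<Sum>i=1..N. (?x i + noise_sum ?x w i)\<^sup>2) / 4 + drift_const)"
      by (intro mult_left_mono Jinv_growth) auto
    also have "(\<Sum>i=1..N. (?x i + noise_sum ?x w i)\<^sup>2) \<le> (\<Sum>i=1..N. 2 * (?x i)\<^sup>2 + 2 * (noise_sum ?x w i)\<^sup>2)"
    proof (rule sum_mono)
      fix i
      show "(?x i + noise_sum ?x w i)\<^sup>2 \<le> 2 * (?x i)\<^sup>2 + 2 * (noise_sum ?x w i)\<^sup>2"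
        using sum_squares_bound[of "?x i" "noise_sum ?x w i"] by (simp add: power2_sum)
    qed
    then have "2 * ((\<Sum>i=1..N. (?x i + noise_sum ?x w i)\<^sup>2) / 4 + drift_const)
        \<le> ((\<Sum>i=1..N. (?x i)\<^sup>2) + (\<Sum>i=1..N. (noise_sum ?x w i)\<^sup>2)) + 2 * drift_const"
      by (simp add: sum.distrib sum_distrib_left[symmetric])
    finally have "ennreal (2 * (\<Sum>i=1..N. (coef (step_map ?x w) i)\<^sup>2))
        \<le> ennreal (((\<Sum>i=1..N. (?x i)\<^sup>2) + (\<Sum>i=1..N. (noise_sum ?x w i)\<^sup>2)) + 2 * drift_const)"
      by (rule ennreal_leI)
    then show "2 * energy (step_map ?x w) \<le> (energy u + (\<Sum>i=1..N. ennreal ((noise_sum ?x w i)\<^sup>2))) + ennreal (2 * drift_const)"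
      using dc by (simp add: energy_def ennreal_plus ennreal_mult sum_nonneg)
  qed
  also have "\<dots> = (energy u + (\<Sum>i=1..N. \<integral>\<^sup>+w. ennreal ((noise_sum ?x w i)\<^sup>2) \<partial>white_noise (sqrt \<tau>))) + ennreal (2 * drift_const)"
    using emeasure_space_1 by (simp add: nn_integral_add nn_integral_sum del: sum_ennreal)
  also have "\<dots> \<le> (energy u + (\<Sum>i=1..N. ennreal (\<tau> * (real N * K6\<^sup>2)))) + ennreal (2 * drift_const)"
    using noise_sum_second_moment tau by (intro add_mono sum_mono order_refl) simp
  also have "\<dots> = energy u + ennreal drift_bound"
    using tau dc by (simp add: drift_bound_def add.assoc ennreal_plus ennreal_of_nat_eq_real_of_nat ennreal_mult[symmetric])
  finally show ?thesis .
qed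

text \<open>The kernel and the reference measure are images under the same map
  \<open>synth N\<close> after \<open>Jinv\<close>: of the law of x + noise, and of the uniform law
  on the unit cube. The bound of \<open>noise_minorisation\<close> passes to the images, so no
  density of the inverse step is computed.\<close>

lemma kernel_minorisation:
  "\<exists>\<alpha>>0. \<exists>\<mu>. \<alpha> < \<top> \<and> sets \<mu> = sets (VN_borel N) \<and> prob_space \<mu> \<and>
    (\<forall>u\<in>space (VN_borel N). energy u \<le> ennreal R \<longrightarrow> (\<forall>A\<in>sets (VN_borel N). (\<alpha>::ennreal) * emeasure \<mu> A \<le> emeasure (kernel u) A))"
proof -
  \<comment> \<open>The estimate max R 0 <= (max R 0 + 1)^2 turns an energy level into a bound on
    coordinates without a square root; \<open>max\<close> covers negative \<open>R\<close>, which
    \<open>ennreal\<close> sends to 0.\<close>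
  define R' where "R' = max R 0 + 1"
  have R': "R' \<ge> 0" by (simp add: R'_def)
  let ?I = "{1..N}" and ?Q = "Pi\<^sub>E {1..N} (\<lambda>_. {0..1::real})"
  from noise_minorisation[OF R'] obtain \<alpha> where \<alpha>: "\<alpha> > 0"
    and min: "\<forall>x \<phi>. (\<forall>i\<in>?I. \<bar>x i\<bar> \<le> R') \<longrightarrow> \<phi> \<in> borel_measurable borel \<longrightarrow>
    (\<forall>y y'. (\<forall>i\<in>?I. y i = y' i) \<longrightarrow> \<phi> y = \<phi> y') \<longrightarrow>
    ennreal \<alpha> * (\<integral>\<^sup>+v. \<phi> v * indicator ?Q v \<partial>lborel_on ?I) \<le> (\<integral>\<^sup>+w. \<phi> (\<lambda>i. x i + noise_sum x w i) \<partial>white_noise (sqrt \<tau>))"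
    by (elim exE conjE) (rule that)
  have Q [measurable]: "?Q \<in> sets (lborel_on ?I)" by (auto intro!: sets_PiM_I_finite)
  have vol: "emeasure (lborel_on ?I) ?Q = 1" by (subst lborel_product.emeasure_PiM) auto
  have sJ [measurable]: "(\<lambda>y. synth N (Jinv y)) \<in> borel \<rightarrow>\<^sub>M VN_borel N" by measurable
  have sJL [measurable]: "(\<lambda>y. synth N (Jinv y)) \<in> lborel_on ?I \<rightarrow>\<^sub>M VN_borel N"
    using measurable_compose[OF measurable_lborel_on_id sJ] .
  define D where "D = density (lborel_on ?I) (indicator ?Q)"
  define \<mu> where "\<mu> = distr D (VN_borel N) (\<lambda>y. synth N (Jinv y))"
  have D: "prob_space D"
  proof (rule prob_spaceI)
    have "emeasure D (space D) = (\<integral>\<^sup>+v. indicator ?Q v * indicator (space (lborel_on ?I)) v \<partial>lborel_on ?I)"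
      unfolding D_def by (subst emeasure_density) auto
    also have "\<dots> = (\<integral>\<^sup>+v. indicator ?Q v \<partial>lborel_on ?I)" by (intro nn_integral_cong) auto
    finally show "emeasure D (space D) = 1" using vol by simp
  qed
  have mD: "(\<lambda>y. synth N (Jinv y)) \<in> D \<rightarrow>\<^sub>M VN_borel N"
    using sJL unfolding D_def by (subst measurable_cong_sets[OF sets_density refl])
  have "ennreal \<alpha> * emeasure \<mu> A \<le> emeasure (kernel u) A"
    if u: "u \<in> space (VN_borel N)" "energy u \<le> ennreal R" and A: "A \<in> sets (VN_borel N)" for u A
  proof -
    define \<phi> :: "(nat \<Rightarrow> real) \<Rightarrow> ennreal" where "\<phi> y = indicator A (synth N (Jinv y))" for y
    have "\<forall>i\<in>?I. \<bar>coef u i\<bar> \<le> R'"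
    proof
      fix i assume i: "i \<in> ?I"
      have "(coef u i)\<^sup>2 \<le> (\<Sum>i=1..N. (coef u i)\<^sup>2)" using i by (intro member_le_sum) auto
      also have "\<dots> \<le> max R 0"
      proof -
        have "ennreal (\<Sum>i=1..N. (coef u i)\<^sup>2) \<le> ennreal (max R 0)"
          using u(2) ennreal_leI[of R "max R 0"] unfolding energy_def by auto
        then show ?thesis by (subst (asm) ennreal_le_iff) auto
      qed
      also have "max R 0 \<le> R'\<^sup>2"
      proof -
        have sq: "y \<le> (y + 1)\<^sup>2" if "0 \<le> y" for y :: real using that zero_le_power2[of y] by (simp add: power2_sum)
        show ?thesis unfolding R'_def by (rule sq) simp
      qed
      finally show "\<bar>coef u i\<bar> \<le> R'" using R' abs_le_square_iff[of "coef u i" R'] by simp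
    qed
    moreover have "\<phi> \<in> borel_measurable borel"
      unfolding \<phi>_def using A by measurable
    \<comment> \<open>Locality holds because \<open>Jinv\<close> depends only on the entries 1 to N;
      those outside are \<open>undefined\<close> for vectors of \<open>lborel_on\<close>.\<close>
    moreover have "\<forall>y y'. (\<forall>i\<in>?I. y i = y' i) \<longrightarrow> \<phi> y = \<phi> y'"
    proof (intro allI impI)
      fix y y' :: "nat \<Rightarrow> real" assume "\<forall>i\<in>?I. y i = y' i"
      then have "Jinv y = Jinv y'" by (intro Jinv_cong) blast
      then show "\<phi> y = \<phi> y'" by (simp add: \<phi>_def)
    qed
    ultimately have "ennreal \<alpha> * (\<integral>\<^sup>+v. \<phi> v * indicator ?Q v \<partial>lborel_on ?I)
        \<le> (\<integral>\<^sup>+w. \<phi> (\<lambda>i. coef u i + noise_sum (coef u) w i) \<partial>white_noise (sqrt \<tau>))" 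
      by (rule min[THEN spec, THEN spec, THEN mp, THEN mp, THEN mp])
    moreover have "emeasure \<mu> A = (\<integral>\<^sup>+v. \<phi> v * indicator ?Q v \<partial>lborel_on ?I)"
    proof -
      have m\<phi>: "\<phi> \<in> borel_measurable (lborel_on ?I)"
        unfolding \<phi>_def[abs_def] by (rule measurable_compose[OF sJL]) (use A in simp)
      have "emeasure \<mu> A = (\<integral>\<^sup>+v. indicator A v \<partial>\<mu>)" using A by (simp add: \<mu>_def)
      also have "\<dots> = (\<integral>\<^sup>+v. \<phi> v \<partial>D)"
        unfolding \<mu>_def using A by (subst nn_integral_distr[OF mD]) (auto simp: \<phi>_def[abs_def])
      also have "\<dots> = (\<integral>\<^sup>+v. indicator ?Q v * \<phi> v \<partial>lborel_on ?I)"
        unfolding D_def using m\<phi> by (subst nn_integral_density) auto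
      finally show ?thesis by (simp add: mult.commute)
    qed
    moreover have "emeasure (kernel u) A = (\<integral>\<^sup>+w. \<phi> (\<lambda>i. coef u i + noise_sum (coef u) w i) \<partial>white_noise (sqrt \<tau>))"
    proof -
      have "emeasure (kernel u) A = (\<integral>\<^sup>+v. indicator A v \<partial>kernel u)" using A by (simp add: kernel_def)
      also have "\<dots> = (\<integral>\<^sup>+w. \<phi> (\<lambda>i. coef u i + noise_sum (coef u) w i) \<partial>white_noise (sqrt \<tau>))"
        unfolding kernel_def using A by (subst nn_integral_distr) (auto simp: \<phi>_def step_map_def cong: measurable_cong_sets)
      finally show ?thesis .
    qed
    ultimately show ?thesis by simp
  qed
  moreover have "prob_space \<mu>" unfolding \<mu>_def by (rule prob_space.prob_space_distr[OF D mD])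
  moreover have "sets \<mu> = sets (VN_borel N)" by (simp add: \<mu>_def)
  ultimately show ?thesis using \<alpha>
    by (intro exI[of _ "ennreal \<alpha>"] conjI exI[of _ \<mu>]) auto
qed

lemma uniquely_ergodic_kernel: "uniquely_ergodic (VN_borel N) kernel"
proof -
  interpret drift_minorised_kernel "VN_borel N" kernel energy "ennreal drift_bound"
  proof
    show "space (VN_borel N) \<noteq> {}" using synth_in_VN[of N "\<lambda>_. 0"] unfolding space_VN_borel by blast
    show "\<exists>\<alpha>>0. \<exists>\<mu>. \<alpha> < \<top> \<and> sets \<mu> = sets (VN_borel N) \<and> prob_space \<mu> \<and>
      (\<forall>u\<in>space (VN_borel N). energy u \<le> ennreal R \<longrightarrow> (\<forall>A\<in>sets (VN_borel N). (\<alpha>::ennreal) * emeasure \<mu> A \<le> emeasure (kernel u) A))" for R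
      by (rule kernel_minorisation)
    show "2 * (\<integral>\<^sup>+v. energy v \<partial>kernel u) \<le> energy u + ennreal drift_bound" for u by (rule kernel_drift)
    show "energy u < \<top>" for u by (simp add: energy_def)
  qed (auto simp: measurable_kernel)
  show ?thesis by (rule uniquely_ergodic)
qed

end

subsection \<open>Chains driven by a cylindrical Wiener process\<close>

lemma synth_eq_iff: "synth N c = synth N d \<longleftrightarrow> (\<forall>i\<in>{1..N}. c i = d i)"
proof
  assume eq: "synth N c = synth N d"
  show "\<forall>i\<in>{1..N}. c i = d i"
  proof
    fix i assume "i \<in> {1..N}"
    then show "c i = d i" using arg_cong[OF eq, of "\<lambda>u. coef u i"] by (simp add: coef_synth)
  qed
qed (auto intro: synth_cong)

locale driven_euler_galerkin = euler_galerkin f \<epsilon> \<tau> N b g K6 + P: prob_space M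
  for f \<epsilon> \<tau> N b g K6 and M :: "'a measure" +
  fixes F :: "real \<Rightarrow> 'a measure" and \<beta> :: "nat \<Rightarrow> real \<Rightarrow> 'a \<Rightarrow> real"
  assumes filtered: "complete_filtered_prob_space M F"
    and brownian: "independent_brownian_motions M F \<beta>"
begin

section \<open>Laws of the Brownian increments\<close>

definition \<delta> :: "nat \<Rightarrow> 'a \<Rightarrow> nat \<Rightarrow> real" where
  "\<delta> j \<omega> = (\<lambda>k. \<beta> k (real (Suc j) * \<tau>) \<omega> - \<beta> k (real j * \<tau>) \<omega>)"

lemma times: "0 \<le> real j * \<tau>" "real j * \<tau> < real (Suc j) * \<tau>" "real (Suc j) * \<tau> - real j * \<tau> = \<tau>"
  using tau by (auto simp: algebra_simps)

lemma subalg_F: "0 \<le> t \<Longrightarrow> subalgebra M (F t)"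
  using filtered by (simp add: complete_filtered_prob_space_def)

lemma measurable_F_mono: "0 \<le> s \<Longrightarrow> s \<le> t \<Longrightarrow> X \<in> F s \<rightarrow>\<^sub>M L \<Longrightarrow> X \<in> F t \<rightarrow>\<^sub>M L"
proof -
  assume st: "0 \<le> s" "s \<le> t" and X: "X \<in> F s \<rightarrow>\<^sub>M L"
  have "sets (F s) \<subseteq> sets (F t)" using filtered st by (simp add: complete_filtered_prob_space_def)
  moreover have "space (F s) = space (F t)" using subalg_F[of s] subalg_F[of t] st by (simp add: subalgebra_def)
  ultimately show ?thesis using X by (auto simp: measurable_def)
qed

lemma measurable_from_F: "0 \<le> t \<Longrightarrow> X \<in> F t \<rightarrow>\<^sub>M L \<Longrightarrow> X \<in> M \<rightarrow>\<^sub>M L"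
  using measurable_from_subalg[OF subalg_F] by blast

lemma measurable_\<delta>_F: "\<delta> j \<in> F (real (Suc j) * \<tau>) \<rightarrow>\<^sub>M borel"
proof (rule measurable_coordinatewise_then_product)
  fix k
  have b: "\<beta> k t \<in> borel_measurable (F t)" if "0 \<le> t" for t
    using brownian that by (simp add: independent_brownian_motions_def)
  have "\<beta> k (real j * \<tau>) \<in> borel_measurable (F (real (Suc j) * \<tau>))"
    by (rule measurable_F_mono[OF times(1) less_imp_le[OF times(2)] b[OF times(1)]])
  with b[OF times(1), of "Suc j"] show "(\<lambda>\<omega>. \<delta> j \<omega> k) \<in> borel_measurable (F (real (Suc j) * \<tau>))"
    unfolding \<delta>_def by measurable
qed

lemma measurable_\<delta> [measurable]: "\<delta> j \<in> M \<rightarrow>\<^sub>M borel"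
  by (rule measurable_from_F[OF times(1) measurable_\<delta>_F])

text \<open>Independence of whole paths passes to increments because the difference of two
  evaluations is a measurable function of the path.\<close>

lemma distr_\<delta>: "distr M borel (\<delta> j) = white_noise (sqrt \<tau>)"
proof -
  let ?X = "\<lambda>k \<omega>. \<delta> j \<omega> k"
  have rv: "?X k \<in> borel_measurable M" for k
    by (rule measurable_compose[OF measurable_\<delta> measurable_coordinate])
  have paths: "P.indep_vars (\<lambda>k. \<Pi>\<^sub>M t\<in>{0..}. borel) (\<lambda>k \<omega>. \<lambda>t\<in>{0..}. \<beta> k t \<omega>) UNIV"
    using brownian by (simp add: independent_brownian_motions_def)
  have "(\<lambda>p. p (real (Suc j) * \<tau>) - p (real j * \<tau>)) \<in> borel_measurable (\<Pi>\<^sub>M t\<in>{0..}. (borel :: real measure))"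
    using times(1)[of j] times(1)[of "Suc j"]
    by (intro borel_measurable_diff measurable_component_singleton) (auto simp del: of_nat_Suc)
  then have "P.indep_vars (\<lambda>_. borel) (\<lambda>k \<omega>. (\<lambda>t\<in>{0..}. \<beta> k t \<omega>) (real (Suc j) * \<tau>) - (\<lambda>t\<in>{0..}. \<beta> k t \<omega>) (real j * \<tau>)) UNIV"
    by (intro P.indep_vars_compose2[OF paths])
  then have "P.indep_vars (\<lambda>_. borel) ?X UNIV"
    using times(1)[of j] times(1)[of "Suc j"] by (simp add: \<delta>_def del: of_nat_Suc)
  then have "distr M (\<Pi>\<^sub>M i\<in>UNIV. borel) (\<lambda>\<omega>. \<lambda>i\<in>UNIV. ?X i \<omega>) = (\<Pi>\<^sub>M i\<in>UNIV. distr M borel (?X i))"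
    by (subst (asm) P.indep_vars_iff_distr_eq_PiM) (use rv in auto)
  moreover have "distr M borel (?X k) = density lborel (normal_density 0 (sqrt \<tau>))" for k
  proof -
    have "distributed M lborel (\<lambda>\<omega>. \<beta> k (real (Suc j) * \<tau>) \<omega> - \<beta> k (real j * \<tau>) \<omega>)
        (normal_density 0 (sqrt (real (Suc j) * \<tau> - real j * \<tau>)))"
      using brownian times(1,2)[of j] unfolding independent_brownian_motions_def by blast
    then have "distributed M lborel (?X k) (normal_density 0 (sqrt \<tau>))"
      unfolding times(3) by (simp add: \<delta>_def)
    then have "distr M lborel (?X k) = density lborel (normal_density 0 (sqrt \<tau>))"
      by (rule distributed_distr_eq_density)
    moreover have "distr M borel (?X k) = distr M lborel (?X k)" by (rule distr_cong) auto
    ultimately show ?thesis by simp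
  qed
  ultimately have "distr M (\<Pi>\<^sub>M i\<in>UNIV. borel) (\<lambda>\<omega>. \<lambda>i\<in>UNIV. ?X i \<omega>) = white_noise (sqrt \<tau>)"
    by (simp add: white_noise_def)
  moreover have "distr M borel (\<delta> j) = distr M (\<Pi>\<^sub>M i\<in>UNIV. borel) (\<lambda>\<omega>. \<lambda>i\<in>UNIV. ?X i \<omega>)"
    by (rule distr_cong) (auto simp: sets_PiM_equal_borel)
  ultimately show ?thesis by simp
qed

text \<open>The increments of all Brownian motions together are independent of the past, of which
  \<open>Y\<close> is a function. This allows integrating over the noise with the state
  frozen.\<close>

lemma joint_law:
  fixes Y :: "'a \<Rightarrow> nat \<Rightarrow> real"
  assumes Y: "Y \<in> F (real j * \<tau>) \<rightarrow>\<^sub>M borel"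
  shows "distr M (borel \<Otimes>\<^sub>M borel) (\<lambda>\<omega>. (Y \<omega>, \<delta> j \<omega>)) = distr M borel Y \<Otimes>\<^sub>M white_noise (sqrt \<tau>)"
proof -
  have YM: "Y \<in> M \<rightarrow>\<^sub>M borel" by (rule measurable_from_F[OF times(1) Y])
  have ind: "P.indep_set (sets (F (real j * \<tau>)))
     (sets (vimage_algebra (space M) (\<delta> j) (\<Pi>\<^sub>M k\<in>UNIV. borel)))"
    using brownian times(1,2)[of j] unfolding independent_brownian_motions_def \<delta>_def[abs_def] by auto
  have sp: "space (F (real j * \<tau>)) = space M" using subalg_F[OF times(1)] by (simp add: subalgebra_def)
  have 1: "sigma_sets (space M) {Y -` A \<inter> space M |A. A \<in> sets borel} \<subseteq> sets (F (real j * \<tau>))"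
    unfolding sp[symmetric] by (rule sets.sigma_sets_subset) (use measurable_sets[OF Y] in auto)
  have 2: "sigma_sets (space M) {\<delta> j -` A \<inter> space M |A. A \<in> sets borel}
      \<subseteq> sets (vimage_algebra (space M) (\<delta> j) (\<Pi>\<^sub>M k\<in>UNIV. borel))"
    unfolding sets_vimage_algebra by (simp add: sets_PiM_equal_borel)
  have "P.indep_set (sigma_sets (space M) {Y -` A \<inter> space M |A. A \<in> sets borel})
     (sigma_sets (space M) {\<delta> j -` A \<inter> space M |A. A \<in> sets borel})"
    using ind unfolding P.indep_set_def
    by (rule P.indep_sets_mono_sets) (use 1 2 in \<open>auto split: bool.split\<close>)
  then have "P.indep_var borel Y borel (\<delta> j)"
    unfolding P.indep_var_eq using YM by simp
  then show ?thesis unfolding P.indep_var_distribution_eq distr_\<delta> by simp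
qed

lemma measurable_coef_F: "Y \<in> L \<rightarrow>\<^sub>M VN_borel N \<Longrightarrow> (\<lambda>\<omega>. coef (Y \<omega>)) \<in> L \<rightarrow>\<^sub>M borel"
  by (rule measurable_compose[OF _ measurable_coef])

lemma PN_term: "u \<in> VN N \<Longrightarrow> PN N (\<lambda>\<zeta>. g (u \<zeta>) * b k \<zeta>) = synth N (noise_coef k (coef u))"
  using PN_eq[OF gb_L2[of "coef u" k], of N] synth_coef[of u N] by (simp add: noise_coef_def[abs_def])

section \<open>Identification of the noise increments\<close>

definition noise_error :: "nat \<Rightarrow> nat \<Rightarrow> ('a \<Rightarrow> real \<Rightarrow> real) \<Rightarrow> ('a \<Rightarrow> real \<Rightarrow> real) \<Rightarrow> 'a \<Rightarrow> real" where
  "noise_error j n Y \<eta> \<omega> = (\<Sum>i=1..N. (psum n (coef (Y \<omega>)) (\<delta> j \<omega>) i - coef (\<eta> \<omega>) i)\<^sup>2)"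

text \<open>The norm of V_N is Euclidean in coordinates, so the mean square convergence that defines
  a noise increment becomes convergence of coordinate errors.\<close>

lemma noise_increment_iff:
  assumes Y: "Y \<in> M \<rightarrow>\<^sub>M VN_borel N"
  shows "noise_increment M b \<beta> g N (real j * \<tau>) (real (Suc j) * \<tau>) Y \<eta> \<longleftrightarrow>
    \<eta> \<in> M \<rightarrow>\<^sub>M VN_borel N \<and> (\<lambda>n. \<integral>\<^sup>+\<omega>. ennreal (noise_error j n Y \<eta> \<omega>) \<partial>M) \<longlonglongrightarrow> 0"
proof -
  have "(\<integral>\<^sup>+\<omega>. ennreal ((L2_norm (\<lambda>\<xi>. (\<Sum>k<n. PN N (\<lambda>\<zeta>. g (Y \<omega> \<zeta>) * b k \<zeta>) \<xi> *
          (\<beta> k (real (Suc j) * \<tau>) \<omega> - \<beta> k (real j * \<tau>) \<omega>)) - \<eta> \<omega> \<xi>))\<^sup>2) \<partial>M)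
      = (\<integral>\<^sup>+\<omega>. ennreal (noise_error j n Y \<eta> \<omega>) \<partial>M)" if \<eta>: "\<eta> \<in> M \<rightarrow>\<^sub>M VN_borel N" for n
  proof (rule nn_integral_cong)
    fix \<omega> assume \<omega>: "\<omega> \<in> space M"
    have YV: "Y \<omega> \<in> VN N" and eV: "\<eta> \<omega> \<in> VN N"
      using measurable_space[OF Y \<omega>] measurable_space[OF \<eta> \<omega>] by auto
    have "(\<Sum>k<n. PN N (\<lambda>\<zeta>. g (Y \<omega> \<zeta>) * b k \<zeta>) \<xi> * (\<beta> k (real (Suc j) * \<tau>) \<omega> - \<beta> k (real j * \<tau>) \<omega>))
        = synth N (psum n (coef (Y \<omega>)) (\<delta> j \<omega>)) \<xi>" for \<xi>
      unfolding PN_term[OF YV] synth_def psum_def \<delta>_def sum_distrib_right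
      by (subst sum.swap) (simp add: mult_ac)
    moreover have "\<eta> \<omega> = synth N (coef (\<eta> \<omega>))" using synth_coef[OF eV] by simp
    ultimately have "(\<lambda>\<xi>. (\<Sum>k<n. PN N (\<lambda>\<zeta>. g (Y \<omega> \<zeta>) * b k \<zeta>) \<xi> *
          (\<beta> k (real (Suc j) * \<tau>) \<omega> - \<beta> k (real j * \<tau>) \<omega>)) - \<eta> \<omega> \<xi>)
        = synth N (\<lambda>i. psum n (coef (Y \<omega>)) (\<delta> j \<omega>) i - coef (\<eta> \<omega>) i)"
      using synth_diff[of N "psum n (coef (Y \<omega>)) (\<delta> j \<omega>)" "coef (\<eta> \<omega>)"] by simp
    then show "ennreal ((L2_norm (\<lambda>\<xi>. (\<Sum>k<n. PN N (\<lambda>\<zeta>. g (Y \<omega> \<zeta>) * b k \<zeta>) \<xi> *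
          (\<beta> k (real (Suc j) * \<tau>) \<omega> - \<beta> k (real j * \<tau>) \<omega>)) - \<eta> \<omega> \<xi>))\<^sup>2) = ennreal (noise_error j n Y \<eta> \<omega>)"
      by (simp only: L2_norm_synth noise_error_def)
  qed
  then show ?thesis unfolding noise_increment_def by (intro conj_cong refl) simp
qed

definition increment :: "nat \<Rightarrow> ('a \<Rightarrow> real \<Rightarrow> real) \<Rightarrow> 'a \<Rightarrow> real \<Rightarrow> real" where
  "increment j Y \<omega> = synth N (noise_sum (coef (Y \<omega>)) (\<delta> j \<omega>))"

lemma measurable_increment:
  assumes [measurable]: "Y \<in> M \<rightarrow>\<^sub>M VN_borel N"
  shows "increment j Y \<in> M \<rightarrow>\<^sub>M VN_borel N"
proof -
  have "(\<lambda>\<omega>. (coef (Y \<omega>), \<delta> j \<omega>)) \<in> M \<rightarrow>\<^sub>M borel \<Otimes>\<^sub>M borel" by measurable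
  from measurable_compose[OF measurable_compose[OF this measurable_noise_sum] measurable_synth]
  show ?thesis by (simp add: increment_def[abs_def])
qed

lemma measurable_noise_error:
  assumes [measurable]: "Y \<in> M \<rightarrow>\<^sub>M VN_borel N" "\<eta> \<in> M \<rightarrow>\<^sub>M VN_borel N"
  shows "noise_error j n Y \<eta> \<in> borel_measurable M"
proof -
  have "(\<lambda>\<omega>. (coef (Y \<omega>), \<delta> j \<omega>)) \<in> M \<rightarrow>\<^sub>M borel \<Otimes>\<^sub>M borel" by measurable
  from measurable_compose[OF this measurable_psum]
  have [measurable]: "(\<lambda>\<omega>. psum n (coef (Y \<omega>)) (\<delta> j \<omega>) i) \<in> borel_measurable M" for i by simp
  have [measurable]: "(\<lambda>\<omega>. coef (\<eta> \<omega>) i) \<in> borel_measurable M" for i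
    by (rule measurable_compose[OF assms(2) measurable_coef_component])
  show ?thesis unfolding noise_error_def[abs_def] by measurable
qed

text \<open>By \<open>joint_law\<close> the error is computed with the state frozen, where
  \<open>noise_sum_moment\<close> bounds it by \<open>tail n\<close>. This tends to 0 for each state
  and is uniformly bounded, so dominated convergence over the law of the state applies without
  moments of \<open>Y\<close>.\<close>

lemma noise_increment_increment:
  assumes Y: "Y \<in> F (real j * \<tau>) \<rightarrow>\<^sub>M VN_borel N"
  shows "noise_increment M b \<beta> g N (real j * \<tau>) (real (Suc j) * \<tau>) Y (increment j Y)"
proof -
  have YM: "Y \<in> M \<rightarrow>\<^sub>M VN_borel N" by (rule measurable_from_F[OF times(1) Y])
  let ?L = "distr M borel (\<lambda>\<omega>. coef (Y \<omega>))"
  interpret L: prob_space ?L by (rule P.prob_space_distr[OF measurable_coef_F[OF YM]])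
  define err where "err n p = ennreal (\<Sum>i=1..N. (psum n (fst p) (snd p) i - noise_sum (fst p) (snd p) i)\<^sup>2)" for n p
  have err_meas: "err n \<in> borel_measurable (borel \<Otimes>\<^sub>M borel)" for n
  proof -
    note [measurable] = measurable_psum measurable_noise_sum_component
    show ?thesis unfolding err_def[abs_def] by measurable
  qed
  have le: "(\<integral>\<^sup>+\<omega>. ennreal (noise_error j n Y (increment j Y) \<omega>) \<partial>M) \<le> (\<integral>\<^sup>+y. ennreal (real N * (\<tau> * tail n y)) \<partial>?L)" for n
  proof -
    have "(\<integral>\<^sup>+\<omega>. ennreal (noise_error j n Y (increment j Y) \<omega>) \<partial>M) = (\<integral>\<^sup>+\<omega>. err n (coef (Y \<omega>), \<delta> j \<omega>) \<partial>M)"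
      unfolding noise_error_def err_def increment_def
      by (intro nn_integral_cong arg_cong[where f=ennreal] sum.cong refl) (simp add: coef_synth)
    also have "\<dots> = (\<integral>\<^sup>+p. err n p \<partial>distr M (borel \<Otimes>\<^sub>M borel) (\<lambda>\<omega>. (coef (Y \<omega>), \<delta> j \<omega>)))"
      using measurable_coef_F[OF YM] err_meas by (subst nn_integral_distr) auto
    also have "\<dots> = (\<integral>\<^sup>+y. (\<integral>\<^sup>+w. err n (y, w) \<partial>white_noise (sqrt \<tau>)) \<partial>?L)"
      unfolding joint_law[OF measurable_coef_F[OF Y]] using err_meas
      by (subst nn_integral_fst[symmetric]) (auto cong: measurable_cong_sets)
    also have "\<dots> \<le> (\<integral>\<^sup>+y. ennreal (real N * (\<tau> * tail n y)) \<partial>?L)"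
    proof (rule nn_integral_mono)
      fix y
      note [measurable] = measurable_noise_sum_right
      have [measurable]: "(\<lambda>w. psum n y w i) \<in> borel_measurable borel" for i unfolding psum_def by measurable
      have "(\<integral>\<^sup>+w. err n (y, w) \<partial>white_noise (sqrt \<tau>))
          = (\<Sum>i=1..N. \<integral>\<^sup>+w. ennreal ((psum n y w i - noise_sum y w i)\<^sup>2) \<partial>white_noise (sqrt \<tau>))"
        unfolding err_def by (simp add: nn_integral_sum sum_ennreal[symmetric] del: sum_ennreal)
      also have "\<dots> \<le> (\<Sum>i=1..N. ennreal (\<tau> * tail n y))"
        using noise_sum_moment tau by (intro sum_mono) simp
      also have "\<dots> = ennreal (real N * (\<tau> * tail n y))"
        using tau tail_nonneg by (simp add: ennreal_of_nat_eq_real_of_nat ennreal_mult[symmetric])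
      finally show "(\<integral>\<^sup>+w. err n (y, w) \<partial>white_noise (sqrt \<tau>)) \<le> ennreal (real N * (\<tau> * tail n y))" .
    qed
    finally show ?thesis .
  qed
  have "(\<lambda>n. \<integral>\<^sup>+y. ennreal (real N * (\<tau> * tail n y)) \<partial>?L) \<longlonglongrightarrow> (\<integral>\<^sup>+y. 0 \<partial>?L)"
  proof (rule nn_integral_dominated_convergence)
    show "(\<lambda>y. ennreal (real N * (\<tau> * tail n y))) \<in> borel_measurable ?L" for n
      using measurable_tail by simp
    show "(\<integral>\<^sup>+y. ennreal (real N * (\<tau> * (real N * K6\<^sup>2))) \<partial>?L) < \<infinity>" using L.emeasure_space_1 by simp
    show "AE y in ?L. ennreal (real N * (\<tau> * tail n y)) \<le> ennreal (real N * (\<tau> * (real N * K6\<^sup>2)))" for n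
      using tau tail_le by (intro AE_I2 ennreal_leI mult_left_mono) auto
    show "AE y in ?L. (\<lambda>n. ennreal (real N * (\<tau> * tail n y))) \<longlonglongrightarrow> 0"
    proof (rule AE_I2)
      fix y
      have "(\<lambda>n. ennreal (real N * (\<tau> * tail n y))) \<longlonglongrightarrow> ennreal (real N * (\<tau> * 0))"
        by (intro tendsto_ennrealI tendsto_intros tail_tendsto)
      then show "(\<lambda>n. ennreal (real N * (\<tau> * tail n y))) \<longlonglongrightarrow> 0" by simp
    qed
  qed auto
  then have "(\<lambda>n. \<integral>\<^sup>+y. ennreal (real N * (\<tau> * tail n y)) \<partial>?L) \<longlonglongrightarrow> 0" by simp
  then have "(\<lambda>n. \<integral>\<^sup>+\<omega>. ennreal (noise_error j n Y (increment j Y) \<omega>) \<partial>M) \<longlonglongrightarrow> 0"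
    by (rule tendsto_sandwich[OF _ _ tendsto_const, rotated 2]) (auto simp: le)
  then show ?thesis using measurable_increment[OF YM] by (simp only: noise_increment_iff[OF YM])
qed

text \<open>Mean square limits are unique: the squared distance of the two limits is at most twice
  the sum of their squared errors, for every \<open>n\<close>.\<close>

lemma noise_increment_unique:
  assumes Y: "Y \<in> M \<rightarrow>\<^sub>M VN_borel N"
    and 1: "noise_increment M b \<beta> g N (real j * \<tau>) (real (Suc j) * \<tau>) Y \<eta>"
    and 2: "noise_increment M b \<beta> g N (real j * \<tau>) (real (Suc j) * \<tau>) Y \<eta>'"
  shows "AE \<omega> in M. \<eta> \<omega> = \<eta>' \<omega>"
proof -
  have m: "\<eta> \<in> M \<rightarrow>\<^sub>M VN_borel N" "\<eta>' \<in> M \<rightarrow>\<^sub>M VN_borel N"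
    and l: "(\<lambda>n. \<integral>\<^sup>+\<omega>. ennreal (noise_error j n Y \<eta> \<omega>) \<partial>M) \<longlonglongrightarrow> 0"
      "(\<lambda>n. \<integral>\<^sup>+\<omega>. ennreal (noise_error j n Y \<eta>' \<omega>) \<partial>M) \<longlonglongrightarrow> 0"
    using 1 2 by (auto simp only: noise_increment_iff[OF Y])
  let ?d = "\<lambda>\<omega>. \<Sum>i=1..N. (coef (\<eta> \<omega>) i - coef (\<eta>' \<omega>) i)\<^sup>2"
  have [measurable]: "noise_error j n Y \<eta> \<in> borel_measurable M" "noise_error j n Y \<eta>' \<in> borel_measurable M" for n
    using measurable_noise_error[OF Y] m by auto
  have [measurable]: "(\<lambda>\<omega>. coef (\<eta> \<omega>) i) \<in> borel_measurable M" "(\<lambda>\<omega>. coef (\<eta>' \<omega>) i) \<in> borel_measurable M" for i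
    using measurable_compose[OF m(1) measurable_coef_component] measurable_compose[OF m(2) measurable_coef_component] by auto
  have le: "(\<integral>\<^sup>+\<omega>. ennreal (?d \<omega>) \<partial>M) \<le> 2 * (\<integral>\<^sup>+\<omega>. ennreal (noise_error j n Y \<eta> \<omega>) \<partial>M) + 2 * (\<integral>\<^sup>+\<omega>. ennreal (noise_error j n Y \<eta>' \<omega>) \<partial>M)" for n
  proof -
    have "(\<integral>\<^sup>+\<omega>. ennreal (?d \<omega>) \<partial>M) \<le> (\<integral>\<^sup>+\<omega>. 2 * ennreal (noise_error j n Y \<eta> \<omega>) + 2 * ennreal (noise_error j n Y \<eta>' \<omega>) \<partial>M)"
    proof (rule nn_integral_mono)
      fix \<omega>
      have sq: "(y - z)\<^sup>2 \<le> 2 * (x - y)\<^sup>2 + 2 * (x - z)\<^sup>2" for x y z :: real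
        using sum_squares_bound[of "x - y" "x - z"] zero_le_power2[of "(x - y) + (x - z)"]
        by (simp add: power2_eq_square algebra_simps)
      have "?d \<omega> \<le> (\<Sum>i=1..N. 2 * (psum n (coef (Y \<omega>)) (\<delta> j \<omega>) i - coef (\<eta> \<omega>) i)\<^sup>2 + 2 * (psum n (coef (Y \<omega>)) (\<delta> j \<omega>) i - coef (\<eta>' \<omega>) i)\<^sup>2)"
        by (intro sum_mono sq)
      also have "\<dots> = 2 * noise_error j n Y \<eta> \<omega> + 2 * noise_error j n Y \<eta>' \<omega>"
        by (simp add: noise_error_def sum.distrib sum_distrib_left)
      finally have "ennreal (?d \<omega>) \<le> ennreal (2 * noise_error j n Y \<eta> \<omega> + 2 * noise_error j n Y \<eta>' \<omega>)"
        by (rule ennreal_leI)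
      moreover have "0 \<le> noise_error j n Y \<eta> \<omega>" "0 \<le> noise_error j n Y \<eta>' \<omega>"
        by (simp_all add: noise_error_def sum_nonneg)
      ultimately show "ennreal (?d \<omega>) \<le> 2 * ennreal (noise_error j n Y \<eta> \<omega>) + 2 * ennreal (noise_error j n Y \<eta>' \<omega>)"
        by (simp add: ennreal_plus ennreal_mult)
    qed
    also have "\<dots> = 2 * (\<integral>\<^sup>+\<omega>. ennreal (noise_error j n Y \<eta> \<omega>) \<partial>M) + 2 * (\<integral>\<^sup>+\<omega>. ennreal (noise_error j n Y \<eta>' \<omega>) \<partial>M)"
      by (simp add: nn_integral_add nn_integral_cmult)
    finally show ?thesis .
  qed
  have "(\<lambda>n. 2 * (\<integral>\<^sup>+\<omega>. ennreal (noise_error j n Y \<eta> \<omega>) \<partial>M) + 2 * (\<integral>\<^sup>+\<omega>. ennreal (noise_error j n Y \<eta>' \<omega>) \<partial>M)) \<longlonglongrightarrow> 2 * 0 + 2 * 0"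
    by (intro tendsto_add ennreal_tendsto_cmult l) auto
  then have "(\<integral>\<^sup>+\<omega>. ennreal (?d \<omega>) \<partial>M) \<le> 2 * 0 + 2 * 0"
    by (rule LIMSEQ_le_const) (use le in blast)
  then have "(\<integral>\<^sup>+\<omega>. ennreal (?d \<omega>) \<partial>M) = 0" by simp
  then have "AE \<omega> in M. ennreal (?d \<omega>) = 0" by (subst (asm) nn_integral_0_iff_AE) auto
  with AE_space[of M] show ?thesis
  proof eventually_elim
    case (elim \<omega>)
    then have "?d \<omega> \<le> 0" by (simp only: ennreal_eq_0_iff)
    then have d0: "?d \<omega> = 0" by (intro antisym sum_nonneg) auto
    have "\<forall>i\<in>{1..N}. coef (\<eta> \<omega>) i = coef (\<eta>' \<omega>) i"
      using d0 by (subst (asm) sum_nonneg_eq_0_iff) auto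
    then have "synth N (coef (\<eta> \<omega>)) = synth N (coef (\<eta>' \<omega>))" by (simp only: synth_eq_iff)
    then show ?case using measurable_space[OF m(1) elim(1)] measurable_space[OF m(2) elim(1)] synth_coef by auto
  qed
qed

section \<open>From the scheme to the explicit kernel\<close>

text \<open>Comparing coordinates turns the implicit equation into J c = x + noise, whose only
  solution vanishing outside 1 to N is given by \<open>Jinv\<close>.\<close>

lemma implicit_equation_iff:
  assumes "u \<in> VN N" "e \<in> VN N" "v \<in> VN N"
  shows "v = (\<lambda>\<xi>. u \<xi> + \<tau> * DeltaN N v \<xi> + \<tau> * PN N (\<lambda>\<zeta>. f (v \<zeta>)) \<xi> + e \<xi>)
    \<longleftrightarrow> v = synth N (Jinv (\<lambda>i. coef u i + coef e i))"
proof -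
  define c where "c = coef v"
  have v: "v = synth N c" using synth_coef[OF assms(3)] by (simp add: c_def)
  have c0: "c i = 0" if "i \<notin> {1..N}" for i
    using that assms(3) unfolding c_def VN_iff by (auto simp: coef_synth)
  let ?F = "coef (\<lambda>\<zeta>. f (synth N c \<zeta>))"
  have "u \<xi> + \<tau> * DeltaN N v \<xi> + \<tau> * PN N (\<lambda>\<zeta>. f (v \<zeta>)) \<xi> + e \<xi>
      = synth N (coef u) \<xi> + \<tau> * synth N (\<lambda>k. - (real k * pi)\<^sup>2 * c k) \<xi> + \<tau> * synth N ?F \<xi> + synth N (coef e) \<xi>" for \<xi>
    unfolding v DeltaN_synth PN_eq[OF f_synth_L2] synth_coef[OF assms(1)] synth_coef[OF assms(2)] ..
  then have "v = (\<lambda>\<xi>. u \<xi> + \<tau> * DeltaN N v \<xi> + \<tau> * PN N (\<lambda>\<zeta>. f (v \<zeta>)) \<xi> + e \<xi>)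
    \<longleftrightarrow> synth N c = synth N (\<lambda>i. coef u i + \<tau> * (- (real i * pi)\<^sup>2 * c i) + \<tau> * ?F i + coef e i)"
    unfolding synth_add synth_cmult by (simp add: v)
  also have "\<dots> \<longleftrightarrow> (\<forall>i\<in>{1..N}. J c i = coef u i + coef e i)"
    unfolding synth_eq_iff J_def by (intro ball_cong refl) (auto simp: algebra_simps)
  also have "\<dots> \<longleftrightarrow> v = synth N (Jinv (\<lambda>i. coef u i + coef e i))"
  proof
    assume "\<forall>i\<in>{1..N}. J c i = coef u i + coef e i"
    then have "Jinv (\<lambda>i. coef u i + coef e i) = c" by (intro Jinv_unique c0) auto
    then show "v = synth N (Jinv (\<lambda>i. coef u i + coef e i))" using v by simp
  next
    assume "v = synth N (Jinv (\<lambda>i. coef u i + coef e i))"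
    then have "\<forall>i\<in>{1..N}. c i = Jinv (\<lambda>i. coef u i + coef e i) i" unfolding v synth_eq_iff .
    then have "c = Jinv (\<lambda>i. coef u i + coef e i)" using c0 Jinv(1) by (metis ext)
    then show "\<forall>i\<in>{1..N}. J c i = coef u i + coef e i" using Jinv(2) by simp
  qed
  finally show ?thesis .
qed

lemma chain_step:
  assumes "euler_galerkin_chain M F b \<beta> f g N \<tau> X"
  shows "AE \<omega> in M. X (Suc j) \<omega> = step_map (coef (X j \<omega>)) (\<delta> j \<omega>)"
proof -
  have X: "X j \<in> F (real j * \<tau>) \<rightarrow>\<^sub>M VN_borel N" for j
    using assms unfolding euler_galerkin_chain_def by blast
  have XM: "X j \<in> M \<rightarrow>\<^sub>M VN_borel N" for j by (rule measurable_from_F[OF times(1) X])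
  obtain \<eta> where \<eta>: "noise_increment M b \<beta> g N (real j * \<tau>) (real (Suc j) * \<tau>) (X j) \<eta>"
    and eq: "AE \<omega> in M. X (Suc j) \<omega> = (\<lambda>\<xi>. X j \<omega> \<xi> + \<tau> * DeltaN N (X (Suc j) \<omega>) \<xi>
                 + \<tau> * PN N (\<lambda>\<zeta>. f (X (Suc j) \<omega> \<zeta>)) \<xi> + \<eta> \<omega> \<xi>)"
    using assms unfolding euler_galerkin_chain_def by blast
  have "AE \<omega> in M. \<eta> \<omega> = increment j (X j) \<omega>"
    by (rule noise_increment_unique[OF XM \<eta> noise_increment_increment[OF X]])
  with eq AE_space[of M] show ?thesis
  proof eventually_elim
    case (elim \<omega>)
    have V: "X j \<omega> \<in> VN N" "X (Suc j) \<omega> \<in> VN N" "increment j (X j) \<omega> \<in> VN N"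
      using measurable_space[OF XM elim(2)] by (auto simp: increment_def)
    have "X (Suc j) \<omega> = synth N (Jinv (\<lambda>i. coef (X j \<omega>) i + coef (increment j (X j) \<omega>) i))"
      using elim(1) unfolding elim(3) implicit_equation_iff[OF V(1,3,2)] .
    also have "Jinv (\<lambda>i. coef (X j \<omega>) i + coef (increment j (X j) \<omega>) i) = Jinv (\<lambda>i. coef (X j \<omega>) i + noise_sum (coef (X j \<omega>)) (\<delta> j \<omega>) i)"
      by (rule Jinv_cong) (simp add: increment_def coef_synth)
    finally show ?case by (simp add: step_map_def)
  qed
qed

text \<open>A freezing argument: the next state is a function of the present one and of independent
  noise, so conditioning on \<open>X\<close> integrates out the noise. It is checked on the events
  that \<open>X\<close> lies in a Borel set \<open>D\<close>.\<close>

lemma kernel_conditional: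
  assumes X: "X \<in> F (real j * \<tau>) \<rightarrow>\<^sub>M VN_borel N" and X': "X' \<in> M \<rightarrow>\<^sub>M VN_borel N"
    and eq: "AE \<omega> in M. X' \<omega> = step_map (coef (X \<omega>)) (\<delta> j \<omega>)"
    and C [measurable]: "C \<in> sets (VN_borel N)"
  shows "AE \<omega> in M. real_cond_exp M (vimage_algebra (space M) X (VN_borel N))
            (indicator {\<omega>' \<in> space M. X' \<omega>' \<in> C}) \<omega> = measure (kernel (X \<omega>)) C"
proof -
  note [measurable] = X'
  have XM [measurable]: "X \<in> M \<rightarrow>\<^sub>M VN_borel N" by (rule measurable_from_F[OF times(1) X])
  let ?G = "vimage_algebra (space M) X (VN_borel N)"
  have Xsp: "X \<in> space M \<rightarrow> space (VN_borel N)" using measurable_space[OF XM] by auto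
  have "subalgebra M ?G"
    unfolding subalgebra_def using measurable_sets[OF XM] by (auto simp: sets_vimage_algebra2[OF Xsp])
  then interpret G: finite_measure_subalgebra M ?G
    by (simp add: finite_measure_subalgebra_def finite_measure_subalgebra_axioms_def P.finite_measure_axioms)
  let ?E = "{\<omega>' \<in> space M. X' \<omega>' \<in> C}"
  have E [measurable]: "?E \<in> sets M" by measurable
  have mk: "(\<lambda>u. measure (kernel u) C) \<in> borel_measurable (VN_borel N)"
    by (rule measurable_compose[OF measurable_kernel measurable_measure_prob_algebra[OF C]])
  have kb: "measure (kernel u) C \<le> 1" for u
  proof -
    have "prob_space (kernel u)" unfolding kernel_def by (rule prob_space_distr) (simp cong: measurable_cong_sets)
    then show ?thesis by (rule prob_space.prob_le_1)
  qed
  have mkX: "(\<lambda>\<omega>. measure (kernel (X \<omega>)) C) \<in> borel_measurable M" by (rule measurable_compose[OF XM mk])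
  show ?thesis
  proof (rule G.real_cond_exp_charact)
    fix B assume "B \<in> sets ?G"
    then obtain D where D [measurable]: "D \<in> sets (VN_borel N)" and B: "B = X -` D \<inter> space M"
      by (auto simp: sets_vimage_algebra2[OF Xsp])
    \<comment> \<open>\<open>synth N (fst p)\<close> recovers the state from its coordinates, so
      both events become one function on the product space, where \<open>joint_law\<close>
      applies.\<close>
    let ?h = "\<lambda>p. indicator D (synth N (fst p)) * indicator C (step_map (fst p) (snd p)) :: ennreal"
    have mh: "?h \<in> borel_measurable (borel \<Otimes>\<^sub>M borel)"
    proof -
      note [measurable] = measurable_step_map
      show ?thesis by measurable
    qed
    have sX: "synth N (coef (X \<omega>)) = X \<omega>" if "\<omega> \<in> space M" for \<omega>
      using measurable_space[OF XM that] by (intro synth_coef) simp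
    have kc: "kernel (synth N (coef (X \<omega>))) = kernel (X \<omega>)" if "\<omega> \<in> space M" for \<omega> using sX[OF that] by simp
    have "(\<integral>\<^sup>+\<omega>. ennreal (indicator B \<omega> * indicator ?E \<omega>) \<partial>M) = (\<integral>\<^sup>+\<omega>. ?h (coef (X \<omega>), \<delta> j \<omega>) \<partial>M)"
    proof (rule nn_integral_cong_AE)
      show "AE \<omega> in M. ennreal (indicator B \<omega> * indicator ?E \<omega>) = ?h (coef (X \<omega>), \<delta> j \<omega>)"
        using eq AE_space[of M]
      proof eventually_elim
        case (elim \<omega>)
        then show ?case using sX[of \<omega>] by (auto simp: indicator_def B)
      qed
    qed
    also have "\<dots> = (\<integral>\<^sup>+p. ?h p \<partial>distr M (borel \<Otimes>\<^sub>M borel) (\<lambda>\<omega>. (coef (X \<omega>), \<delta> j \<omega>)))"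
      using measurable_coef_F[OF XM] mh by (subst nn_integral_distr) auto
    also have "\<dots> = (\<integral>\<^sup>+x. (\<integral>\<^sup>+w. ?h (x, w) \<partial>white_noise (sqrt \<tau>)) \<partial>distr M borel (\<lambda>\<omega>. coef (X \<omega>)))"
      unfolding joint_law[OF measurable_coef_F[OF X]] using mh
      by (subst nn_integral_fst[symmetric]) (auto cong: measurable_cong_sets)
    also have "\<dots> = (\<integral>\<^sup>+\<omega>. (\<integral>\<^sup>+w. ?h (coef (X \<omega>), w) \<partial>white_noise (sqrt \<tau>)) \<partial>M)"
    proof (rule nn_integral_distr[OF measurable_coef_F[OF XM]])
      have "?h \<in> borel_measurable (borel \<Otimes>\<^sub>M white_noise (sqrt \<tau>))" using mh by (simp cong: measurable_cong_sets)
      then show "(\<lambda>x. \<integral>\<^sup>+w. ?h (x, w) \<partial>white_noise (sqrt \<tau>)) \<in> borel_measurable (distr M borel (\<lambda>\<omega>. coef (X \<omega>)))"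
        using borel_measurable_nn_integral_fst[of ?h borel] by simp
    qed
    also have "\<dots> = (\<integral>\<^sup>+\<omega>. ennreal (indicator B \<omega> * measure (kernel (X \<omega>)) C) \<partial>M)"
    proof (rule nn_integral_cong)
      fix \<omega> assume \<omega>: "\<omega> \<in> space M"
      have "(\<integral>\<^sup>+w. ?h (coef (X \<omega>), w) \<partial>white_noise (sqrt \<tau>)) = indicator B \<omega> * (\<integral>\<^sup>+w. indicator C (step_map (coef (X \<omega>)) w) \<partial>white_noise (sqrt \<tau>))"
        using \<omega> by (subst nn_integral_cmult[symmetric]) (auto simp: sX B indicator_def cong: measurable_cong_sets)
      also have "(\<integral>\<^sup>+w. indicator C (step_map (coef (X \<omega>)) w) \<partial>white_noise (sqrt \<tau>)) = (\<integral>\<^sup>+v. indicator C v \<partial>kernel (X \<omega>))"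
        unfolding kernel_def by (subst nn_integral_distr) (auto cong: measurable_cong_sets)
      also have "\<dots> = emeasure (kernel (X \<omega>)) C" by (simp add: kernel_def)
      also have "\<dots> = ennreal (measure (kernel (X \<omega>)) C)"
      proof -
        have "prob_space (kernel (X \<omega>))" unfolding kernel_def by (rule prob_space_distr) (simp cong: measurable_cong_sets)
        then show ?thesis by (simp add: finite_measure.emeasure_eq_measure prob_space.finite_measure)
      qed
      finally show "(\<integral>\<^sup>+w. ?h (coef (X \<omega>), w) \<partial>white_noise (sqrt \<tau>)) = ennreal (indicator B \<omega> * measure (kernel (X \<omega>)) C)"
        by (auto simp: indicator_def)
    qed
    finally have nn: "(\<integral>\<^sup>+\<omega>. ennreal (indicator B \<omega> * indicator ?E \<omega>) \<partial>M) = (\<integral>\<^sup>+\<omega>. ennreal (indicator B \<omega> * measure (kernel (X \<omega>)) C) \<partial>M)" .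
    have Bm: "B \<in> sets M" unfolding B by (rule measurable_sets[OF XM D])
    have "(\<integral>\<omega>. indicator B \<omega> * indicator ?E \<omega> \<partial>M) = (\<integral>\<omega>. indicator B \<omega> * measure (kernel (X \<omega>)) C \<partial>M)"
      using nn Bm E mkX by (subst (1 2) integral_eq_nn_integral) auto
    then show "(\<integral>\<omega>\<in>B. indicator ?E \<omega> \<partial>M) = (\<integral>\<omega>\<in>B. measure (kernel (X \<omega>)) C \<partial>M)"
      by (simp add: set_lebesgue_integral_def)
  next
    show "integrable M (indicator ?E :: 'a \<Rightarrow> real)"
      by (rule integrable_real_indicator) (use P.emeasure_finite in \<open>auto simp: less_top[symmetric]\<close>)
    show "integrable M (\<lambda>\<omega>. measure (kernel (X \<omega>)) C)"
      by (rule P.integrable_const_bound[where B=1]) (use mkX kb in auto)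
    show "(\<lambda>\<omega>. measure (kernel (X \<omega>)) C) \<in> borel_measurable ?G"
      by (rule measurable_compose[OF measurable_vimage_algebra1[OF Xsp] mk])
  qed
qed

lemma transition_kernel_kernel: "transition_kernel M F b \<beta> f g N \<tau> kernel"
  unfolding transition_kernel_def
proof (intro conjI allI impI ballI measurable_kernel)
  fix X n C assume chain: "euler_galerkin_chain M F b \<beta> f g N \<tau> X" and C: "C \<in> sets (VN_borel N)"
  have X: "X j \<in> F (real j * \<tau>) \<rightarrow>\<^sub>M VN_borel N" for j
    using chain unfolding euler_galerkin_chain_def by blast
  show "AE \<omega> in M. real_cond_exp M (vimage_algebra (space M) (X n) (VN_borel N))
            (indicator {\<omega>' \<in> space M. X (Suc n) \<omega>' \<in> C}) \<omega> = measure (kernel (X n \<omega>)) C"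
    by (rule kernel_conditional[OF X measurable_from_F[OF times(1) X] chain_step[OF chain] C])
qed

text \<open>Joint measurability of \<open>step_map\<close> keeps the recursion adapted.
  Deterministic starts at every point are what pins down a transition kernel pointwise in
  \<open>transition_kernel_unique\<close>.\<close>

lemma ex_chain:
  assumes u: "u \<in> VN N"
  shows "\<exists>X. euler_galerkin_chain M F b \<beta> f g N \<tau> X \<and> X 0 = (\<lambda>_. u)"
proof -
  define X where "X = rec_nat (\<lambda>_. u) (\<lambda>j Y \<omega>. step_map (coef (Y \<omega>)) (\<delta> j \<omega>))"
  have X0: "X 0 = (\<lambda>_. u)" and XS: "X (Suc j) = (\<lambda>\<omega>. step_map (coef (X j \<omega>)) (\<delta> j \<omega>))" for j
    by (simp_all add: X_def)
  have XF: "X j \<in> F (real j * \<tau>) \<rightarrow>\<^sub>M VN_borel N" for j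
  proof (induction j)
    case 0
    then show ?case unfolding X0 using u by simp
  next
    case (Suc j)
    have "X j \<in> F (real (Suc j) * \<tau>) \<rightarrow>\<^sub>M VN_borel N"
      by (rule measurable_F_mono[OF times(1) less_imp_le[OF times(2)] Suc])
    then have "(\<lambda>\<omega>. (coef (X j \<omega>), \<delta> j \<omega>)) \<in> F (real (Suc j) * \<tau>) \<rightarrow>\<^sub>M borel \<Otimes>\<^sub>M borel"
      by (intro measurable_Pair measurable_coef_F measurable_\<delta>_F)
    from measurable_compose[OF this measurable_step_map] show ?case by (simp add: XS)
  qed
  have XM: "X j \<in> M \<rightarrow>\<^sub>M VN_borel N" for j by (rule measurable_from_F[OF times(1) XF])
  have eq: "AE \<omega> in M. X (Suc j) \<omega> = (\<lambda>\<xi>. X j \<omega> \<xi> + \<tau> * DeltaN N (X (Suc j) \<omega>) \<xi>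
                 + \<tau> * PN N (\<lambda>\<zeta>. f (X (Suc j) \<omega> \<zeta>)) \<xi> + increment j (X j) \<omega> \<xi>)" for j
    proof (rule AE_I2)
      fix \<omega> assume \<omega>: "\<omega> \<in> space M"
      have V: "X j \<omega> \<in> VN N" "X (Suc j) \<omega> \<in> VN N" "increment j (X j) \<omega> \<in> VN N"
        using measurable_space[OF XM \<omega>] by (auto simp: increment_def)
      have "Jinv (\<lambda>i. coef (X j \<omega>) i + coef (increment j (X j) \<omega>) i) = Jinv (\<lambda>i. coef (X j \<omega>) i + noise_sum (coef (X j \<omega>)) (\<delta> j \<omega>) i)"
        by (rule Jinv_cong) (simp add: increment_def coef_synth)
      then show "X (Suc j) \<omega> = (\<lambda>\<xi>. X j \<omega> \<xi> + \<tau> * DeltaN N (X (Suc j) \<omega>) \<xi>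
                 + \<tau> * PN N (\<lambda>\<zeta>. f (X (Suc j) \<omega> \<zeta>)) \<xi> + increment j (X j) \<omega> \<xi>)"
        unfolding implicit_equation_iff[OF V(1,3,2)] by (simp add: XS step_map_def)
    qed
  have "euler_galerkin_chain M F b \<beta> f g N \<tau> X"
    unfolding euler_galerkin_chain_def using XF noise_increment_increment[OF XF] eq by blast
  with X0 show ?thesis by blast
qed

text \<open>For a deterministic start both sides of the almost sure identity are constants, so it
  holds outright.\<close>

lemma transition_kernel_unique:
  assumes \<kappa>: "transition_kernel M F b \<beta> f g N \<tau> \<kappa>" and u: "u \<in> VN N" and C: "C \<in> sets (VN_borel N)"
  shows "measure (\<kappa> u) C = measure (kernel u) C"
proof -
  obtain X where X: "euler_galerkin_chain M F b \<beta> f g N \<tau> X" "X 0 = (\<lambda>_. u)"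
    using ex_chain[OF u] by blast
  let ?c = "real_cond_exp M (vimage_algebra (space M) (X 0) (VN_borel N)) (indicator {\<omega>' \<in> space M. X (Suc 0) \<omega>' \<in> C})"
  have "AE \<omega> in M. ?c \<omega> = measure (\<kappa> (X 0 \<omega>)) C"
    using \<kappa> X(1) C unfolding transition_kernel_def by blast
  moreover have "AE \<omega> in M. ?c \<omega> = measure (kernel (X 0 \<omega>)) C"
    using transition_kernel_kernel X(1) C unfolding transition_kernel_def by blast
  ultimately have "AE \<omega> in M. measure (\<kappa> u) C = measure (kernel u) C"
    by eventually_elim (simp add: X(2))
  then show ?thesis by (simp add: P.AE_const)
qed

text \<open>Invariance involves a kernel only through its values on Borel sets at points of V_N, and
  these are the same for every transition kernel.\<close>

lemma uniquely_ergodic_transition_kernel: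
  assumes \<kappa>: "transition_kernel M F b \<beta> f g N \<tau> \<kappa>"
  shows "uniquely_ergodic (VN_borel N) \<kappa>"
proof -
  have "invariant_prob_measure (VN_borel N) \<kappa> \<mu> \<longleftrightarrow> invariant_prob_measure (VN_borel N) kernel \<mu>" for \<mu>
  proof -
    have "(\<integral>x. measure (\<kappa> x) C \<partial>\<mu>) = (\<integral>x. measure (kernel x) C \<partial>\<mu>)"
      if "sets \<mu> = sets (VN_borel N)" "C \<in> sets (VN_borel N)" for C
      using sets_eq_imp_space_eq[OF that(1)] transition_kernel_unique[OF \<kappa> _ that(2)]
      by (intro Bochner_Integration.integral_cong) auto
    then show ?thesis unfolding invariant_prob_measure_def by auto
  qed
  then have "invariant_prob_measure (VN_borel N) \<kappa> = invariant_prob_measure (VN_borel N) kernel" by (intro ext)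
  then show ?thesis using uniquely_ergodic_kernel by (simp only: uniquely_ergodic_def)
qed

end

theorem theorem3p2:
  fixes M :: "'a measure" and F :: "real \<Rightarrow> 'a measure"
    and b :: "nat \<Rightarrow> real \<Rightarrow> real" and \<beta> :: "nat \<Rightarrow> real \<Rightarrow> 'a \<Rightarrow> real"
    and f g :: "real \<Rightarrow> real" and K6 \<epsilon> \<tau> :: real and N :: nat
  assumes "complete_filtered_prob_space M F"
    and "cylindrical_wiener M F b \<beta>"
    and "continuous_on UNIV g"
    and "K6 \<ge> 0"
    and "\<And>\<xi>. 0 \<noteq> \<bar>g \<xi>\<bar> \<and> \<bar>g \<xi>\<bar> \<le> K6"
    and "\<epsilon> > 0"
    and "\<And>\<xi>. f \<xi> = (1 / \<epsilon>\<^sup>2) * (\<xi> - \<xi> ^ 3)"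
    and "N \<ge> 1"
    and "0 < \<tau>" and "\<tau> < 1"
    and "(1 / \<epsilon>\<^sup>2 - pi\<^sup>2) * \<tau> < 1"
  shows "(\<exists>\<kappa>. transition_kernel M F b \<beta> f g N \<tau> \<kappa>) \<and>
         (\<forall>\<kappa>. transition_kernel M F b \<beta> f g N \<tau> \<kappa> \<longrightarrow> uniquely_ergodic (VN_borel N) \<kappa>)"
proof -
  interpret P: prob_space M using assms(1) by (simp add: complete_filtered_prob_space_def)
  interpret driven_euler_galerkin f \<epsilon> \<tau> N b g K6 M F \<beta>
    by unfold_locales (use assms in \<open>auto simp: cylindrical_wiener_def\<close>)
  show ?thesis using transition_kernel_kernel uniquely_ergodic_transition_kernel by blast
qed

end
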